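(* Let $d\ge 5$. Assume conditions (S1), (H0) and (H1) below hold, with $\alpha\in(0,2]$, $\mathcal Z_1$ and $\Lambda$ as in (H1). Then there exists a constant $C>0$ depending only on $d,\alpha,\mathcal X,\mathcal Y,\mathcal Z_1$ such that for every $n\ge1$, $$\sup_{\mu\in\mathcal P(\mathcal X),\ \nu\in\mathcal P(\mathcal Y)}\ \mathbb E_{\mu,\nu}\big|\mathcal T_c(\mu_n,\nu_n)-\mathcal T_c(\mu,\nu)\big|\le C\Lambda n^{-\alpha/d}.$$
   Context: For sets $\mathcal X,\mathcal Y\subseteq\mathbb R^d$, $\mathcal P(\mathcal X)$ denotes the Borel probability measures supported in $\mathcal X$. For $\mu\in\mathcal P(\mathcal X)$, $\nu\in\mathcal P(\mathcal Y)$ and a cost $c:\mathcal X\times\mathcal Y\to\mathbb R$, the optimal transport cost is $\mathcal T_c(\mu,\nu)=\inf_{\pi\in\Pi(\mu,\nu)}\int c\,d\pi$, where $\Pi(\mu,\nu)$ is the set of couplings (joint Borel probability measures with marginals $\mu,\nu$). Given i.i.d. $X_1,\dots,X_n\sim\mu$ and i.i.d. $Y_1,\dots,Y_n\sim\nu$, $\mu_n=\frac1n\sum_i\delta_{X_i}$ and $\nu_n=\frac1n\sum_i\delta_{Y_i}$. Set $\mathcal Z=\mathcal X-\mathcal Y=\{x-y:x\in\mathcal X,y\in\mathcal Y\}$. $B_{x,r}$ is the closed Euclidean ball of radius $r$ centered at $x$. Hölder spaces: for $\alpha>0$ let $\underline\alpha$ be the largest integer strictly smaller than $\alpha$. For $\Omega\subseteq\mathbb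 R^d$, $\mathcal C^\alpha(\Omega)$ is the set of $f:\Omega\to\mathbb R$ with $\underline\alpha$ continuous derivatives on the interior $\Omega^\circ$, extending continuously to the boundary, with finite norm $\|f\|_{\mathcal C^\alpha(\Omega)}=\sum_{j=0}^{\underline\alpha}\sup_{|\beta|=j}\|D^\beta f\|_{L^\infty(\Omega^\circ)}+\sum_{|\beta|=\underline\alpha}\sup_{x\ne y\in\Omega^\circ}\frac{|D^\beta f(x)-D^\beta f(y)|}{\|x-y\|^{\alpha-\underline\alpha}}$. (H0): $c(x,y)=h(x-y)$ with $h:\mathbb R^d\to[0,\infty)$ convex, even and lower semi-continuous. (S1): $\mathcal X,\mathcal Y\subseteq\mathbb R^d$ are convex compact sets with nonempty interior and $\mathcal X,\mathcal Y,\mathcal Z\subseteq B_{0,1}$. (H1): there exist $\alpha\in(0,2]$ and a convex open set $\mathcal Z_1$ with $\mathcal Z\subseteq\mathcal Z_1\subseteq B_{0,2}$ such that $h\in\mathcal C^\alpha(\mathcal Z_1)$ and $0\le h\le 1$ on $\mathcal Z_1$; write $\Lambda:=1\vee\|h\|_{\mathcal C^\alpha(\mathcal Z_1)}<\infty$. *)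

theory Defs
  imports "HOL-Probability.Probability"
begin

definition floor_strict :: "real \<Rightarrow> nat" where
  "floor_strict \<alpha> = nat (\<lceil>\<alpha>\<rceil> - 1)"

fun pdiff :: "'a list \<Rightarrow> ('a::euclidean_space \<Rightarrow> real) \<Rightarrow> 'a \<Rightarrow> real" where
  "pdiff [] f = f"
| "pdiff (b # bs) f = (\<lambda>x. frechet_derivative (pdiff bs f) (at x) b)"

text \<open>Derivative for a multi-index beta, represented as a multiset of basis vectors.\<close>
definition mderiv :: "'a multiset \<Rightarrow> ('a::euclidean_space \<Rightarrow> real) \<Rightarrow> 'a \<Rightarrow> real" where
  "mderiv \<beta> f = pdiff (SOME bs. mset bs = \<beta>) f"

definition multi_indices :: "nat \<Rightarrow> 'a::euclidean_space multiset set" where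
  "multi_indices j = {\<beta>. set_mset \<beta> \<subseteq> Basis \<and> size \<beta> = j}"

definition deriv_vals :: "'a::euclidean_space set \<Rightarrow> ('a \<Rightarrow> real) \<Rightarrow> nat \<Rightarrow> real set" where
  "deriv_vals \<Omega> f j = {\<bar>mderiv \<beta> f x\<bar> | \<beta> x. \<beta> \<in> multi_indices j \<and> x \<in> interior \<Omega>}"

definition holder_quots :: "'a::euclidean_space set \<Rightarrow> ('a \<Rightarrow> real) \<Rightarrow> real \<Rightarrow> real set" where
  "holder_quots \<Omega> g \<gamma> = {\<bar>g x - g y\<bar> / (norm (x - y) powr \<gamma>) | x y.
       x \<in> interior \<Omega> \<and> y \<in> interior \<Omega> \<and> x \<noteq> y}"

definition holder_norm :: "real \<Rightarrow> 'a::euclidean_space set \<Rightarrow> ('a \<Rightarrow> real) \<Rightarrow> real" where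
  "holder_norm \<alpha> \<Omega> f =
     (\<Sum>j\<le>floor_strict \<alpha>. Sup (deriv_vals \<Omega> f j)) +
     (\<Sum>\<beta>\<in>multi_indices (floor_strict \<alpha>).
        Sup (holder_quots \<Omega> (mderiv \<beta> f) (\<alpha> - real (floor_strict \<alpha>))))"

definition holder_space :: "real \<Rightarrow> 'a::euclidean_space set \<Rightarrow> ('a \<Rightarrow> real) \<Rightarrow> bool" where
  "holder_space \<alpha> \<Omega> f \<longleftrightarrow>
     (\<forall>bs. set bs \<subseteq> Basis \<and> length bs < floor_strict \<alpha> \<longrightarrow>
        (\<forall>x\<in>interior \<Omega>. pdiff bs f differentiable (at x))) \<and>
     (\<forall>bs. set bs \<subseteq> Basis \<and> length bs \<le> floor_strict \<alpha> \<longrightarrow>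
        continuous_on (interior \<Omega>) (pdiff bs f)) \<and>
     continuous_on \<Omega> f \<and>
     (\<forall>j\<le>floor_strict \<alpha>. bdd_above (deriv_vals \<Omega> f j)) \<and>
     (\<forall>\<beta>\<in>multi_indices (floor_strict \<alpha>).
        bdd_above (holder_quots \<Omega> (mderiv \<beta> f) (\<alpha> - real (floor_strict \<alpha>))))"

definition lsc :: "('a::topological_space \<Rightarrow> real) \<Rightarrow> bool" where
  "lsc h \<longleftrightarrow> (\<forall>a. closed {x. h x \<le> a})"

definition prob_measures_on :: "'a::topological_space set \<Rightarrow> 'a measure set" where
  "prob_measures_on S = {\<mu>. prob_space \<mu> \<and> sets \<mu> = sets borel \<and> emeasure \<mu> S = 1}"

definition couplings :: "'a::topological_space measure \<Rightarrow> 'b::topological_space measure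
    \<Rightarrow> ('a \<times> 'b) measure set" where
  "couplings \<mu> \<nu> = {\<pi>. prob_space \<pi> \<and> sets \<pi> = sets borel \<and>
      distr \<pi> borel fst = \<mu> \<and> distr \<pi> borel snd = \<nu>}"

definition ot_cost :: "('a::topological_space \<Rightarrow> 'b::topological_space \<Rightarrow> real)
    \<Rightarrow> 'a measure \<Rightarrow> 'b measure \<Rightarrow> real" where
  "ot_cost c \<mu> \<nu> = enn2real (INF \<pi>\<in>couplings \<mu> \<nu>. \<integral>\<^sup>+ z. ennreal (c (fst z) (snd z)) \<partial>\<pi>)"

definition empirical :: "(nat \<Rightarrow> 'a::topological_space) \<Rightarrow> nat \<Rightarrow> 'a measure" where
  "empirical xs n = distr (uniform_count_measure {..<n}) borel xs"

definition expected_ot_dev :: "('a::topological_space \<Rightarrow> 'b::topological_space \<Rightarrow> real)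
    \<Rightarrow> 'a measure \<Rightarrow> 'b measure \<Rightarrow> nat \<Rightarrow> ennreal" where
  "expected_ot_dev c \<mu> \<nu> n =
     (\<integral>\<^sup>+ \<omega>. ennreal \<bar>ot_cost c (empirical (fst \<omega>) n) (empirical (snd \<omega>) n) - ot_cost c \<mu> \<nu>\<bar>
        \<partial>(PiM {..<n} (\<lambda>_. \<mu>) \<Otimes>\<^sub>M PiM {..<n} (\<lambda>_. \<nu>)))"

end

(*
Kantorovich potentials for the cost h(x - y) are, at scale delta, semiconcave with constant
K = L delta^(alpha - 2) up to an error L delta^alpha, so after division by K they lie in a class of
functions that does not depend on h. The Moreau-type transform f -> sup_x (f x - 2 |x - u|^2) is
inverted by a sup-norm contraction and maps the class to functions that are smooth from both sides;
rounding their values on dyadic grids gives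
at most exp(C 2^(d j)) codes at sup-norm accuracy 4^(-j), the
Bronshtein bound without a logarithm. Chaining with d >= 5 bounds the uniform deviation of the class by
C delta^2 when delta = n^(-1/d), and C K delta^2 is of order Lambda n^(-alpha/d).

Duality is only needed for two samples of n points, where it is the shortest-path potential of an
optimal permutation. Averaging the optimal permutations of a fresh sample yields a coupling of the
population measures, which replaces duality for them.
*)

theory Submission
  imports Defs "HOL-Combinatorics.Cycles"
begin

text \<open>Upper paraboloids give no control from below: a kink between grid points costs the first
  power of the grid width, so grid values of a semiconcave function itself are too coarse. The
  transform supplies the missing side, but because of the slack only at contact points and up to
  \<open>\<eta>\<close>. Near such points the difference of two transforms is affine up to an error
  of order 4^(-j), hence fixed by its values at the d + 1 vertices of one small simplex, without
  recording slopes. Each function has its own contact points, so a code also records which grid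
  points lie near one; equal codes then place contact points of both functions close together.
  Division by K frees every entropy constant from h and leaves only d. K returns linearly at the end
  and carries the whole dependence on \<Lambda>: slack and finest accuracy are both \<delta>^2, and
  K \<delta>^2 = 2 L \<delta>^\<alpha>. Suprema over the uncountable class are not known to be
  measurable, so the deviation bounds produce measurable majorants and estimate their
  integrals.\<close>

section \<open>Metric entropy of semiconcave functions\<close>

text \<open>The slack \<open>\<eta>\<close> absorbs the error of replacing an \<open>\<alpha>\<close>-power by a paraboloid.\<close>

definition semiconcave_class :: "'a::euclidean_space set \<Rightarrow> real \<Rightarrow> ('a \<Rightarrow> real) set" where
  "semiconcave_class X \<eta> = {f \<in> borel_measurable borel. (\<forall>x\<in>X. \<bar>f x\<bar> \<le> 1) \<and>
     (\<forall>x0\<in>X. \<exists>v. norm v \<le> 2 \<and>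
        (\<forall>x\<in>X. f x \<le> f x0 + (norm (x - v))\<^sup>2 - (norm (x0 - v))\<^sup>2 + \<eta>))}"

text \<open>For \<open>f\<close> in the class, \<open>f x\<close> is up to \<open>\<eta>\<close> the infimum of \<open>sup_conv X f u + 2 * |x - u|^2\<close> over \<open>u\<close>.
  The factor 2, twice the coefficient of the touching paraboloids, makes the supremum a maximum of strongly
  concave functions, so that it is smooth from both sides at every \<open>u\<close> that is needed to recover \<open>f\<close>.\<close>

definition sup_conv :: "'a::euclidean_space set \<Rightarrow> ('a \<Rightarrow> real) \<Rightarrow> 'a \<Rightarrow> real" where
  "sup_conv X f u = (SUP x\<in>X. f x - 2 * (norm (x - u))\<^sup>2)"

text \<open>A two-sided first-order expansion at the single point \<open>u\<close>, with a remainder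
  valid for all \<open>w\<close>: functions that are smooth at different nearby points can still be
  compared at any common \<open>w\<close>.\<close>

definition smooth_at :: "'a::euclidean_space set \<Rightarrow> real \<Rightarrow> ('a \<Rightarrow> real) \<Rightarrow> 'a \<Rightarrow> bool" where
  "smooth_at X \<eta> f u \<longleftrightarrow> (\<exists>s. \<forall>w. \<bar>sup_conv X f w - sup_conv X f u - s \<bullet> (w - u)\<bar>
      \<le> 2 * (norm (w - u))\<^sup>2 + \<eta>)"

lemma sup_conv_ge:
  assumes "\<forall>x\<in>X. \<bar>f x\<bar> \<le> 1" "x \<in> X"
  shows "f x - 2 * (norm (x - u))\<^sup>2 \<le> sup_conv X f u"
  unfolding sup_conv_def
proof (rule cSUP_upper[OF assms(2)])
  show "bdd_above ((\<lambda>x. f x - 2 * (norm (x - u))\<^sup>2) ` X)"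
  proof (rule bdd_aboveI2[where M=1])
    fix x assume "x \<in> X"
    then have "\<bar>f x\<bar> \<le> 1" using assms(1) by blast
    moreover have "(norm (x - u))\<^sup>2 \<ge> 0" by simp
    ultimately show "f x - 2 * (norm (x - u))\<^sup>2 \<le> 1" by linarith
  qed
qed

text \<open>Serves the coarsest grid, where no earlier code restricts the values.\<close>

lemma sup_conv_bound:
  assumes f: "\<forall>x\<in>X. \<bar>f x\<bar> \<le> 1" and X: "X \<noteq> {}" "X \<subseteq> cball 0 1"
  shows "\<bar>sup_conv X f u\<bar> \<le> 1 + 2 * (1 + norm u)\<^sup>2"
proof -
  obtain x where x: "x \<in> X" using X by blast
  have "norm (x - u) \<le> 1 + norm u"
    using norm_triangle_ineq4[of x u] X x by auto
  then have "(norm (x - u))\<^sup>2 \<le> (1 + norm u)\<^sup>2" by (intro power_mono) auto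
  moreover have "-1 \<le> f x" using f x by force
  ultimately have 1: "sup_conv X f u \<ge> - 1 - 2 * (1 + norm u)\<^sup>2"
    using sup_conv_ge[OF f x, of u] by linarith
  have "sup_conv X f u \<le> 1" unfolding sup_conv_def
  proof (rule cSUP_least[OF X(1)])
    fix x assume "x \<in> X"
    then have "\<bar>f x\<bar> \<le> 1" using f by blast
    moreover have "(norm (x - u))\<^sup>2 \<ge> 0" by simp
    ultimately show "f x - 2 * (norm (x - u))\<^sup>2 \<le> 1" by linarith
  qed
  moreover have "(1 + norm u)\<^sup>2 \<ge> 0" by simp
  ultimately show ?thesis using 1 unfolding abs_le_iff by linarith
qed

text \<open>At \<open>x0\<close> the paraboloid with vertex \<open>v\<close> has slope
  \<open>2 * (x0 - v)\<close> and the one with vertex \<open>u\<close> and coefficient 2 has slope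
  \<open>4 * (x0 - u)\<close>; they agree when \<open>u\<close> is the midpoint of \<open>x0\<close>
  and \<open>v\<close>. For this \<open>u\<close> the point \<open>x0\<close> attains the supremum
  up to \<open>\<eta>\<close>, which gives both the expansion of the transform and the recovery of
  \<open>f x0\<close>.\<close>

lemma semiconcave_class_touching:
  fixes f :: "'a::euclidean_space \<Rightarrow> real"
  assumes f: "f \<in> semiconcave_class X \<eta>" and x0: "x0 \<in> X" and X: "X \<subseteq> cball 0 1"
  obtains u where "norm u \<le> 2" "smooth_at X \<eta> f u"
    "sup_conv X f u + 2 * (norm (x0 - u))\<^sup>2 \<le> f x0 + \<eta>"
proof -
  from f x0 obtain v where v: "norm v \<le> 2"
    and touch: "\<And>x. x \<in> X \<Longrightarrow> f x \<le> f x0 + (norm (x - v))\<^sup>2 - (norm (x0 - v))\<^sup>2 + \<eta>"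
    unfolding semiconcave_class_def by blast
  have f1: "\<forall>x\<in>X. \<bar>f x\<bar> \<le> 1" using f unfolding semiconcave_class_def by blast
  define u where "u = (1/2) *\<^sub>R (x0 + v)"
  define s where "s = 4 *\<^sub>R (x0 - u)"
  have v_eq: "v = 2 *\<^sub>R u - x0" unfolding u_def by simp
  have up: "sup_conv X f w \<le> f x0 - 2 * (norm (x0 - u))\<^sup>2 + \<eta> + s \<bullet> (w - u) + 2 * (norm (w - u))\<^sup>2"
    for w
    unfolding sup_conv_def
  proof (rule cSUP_least)
    show "X \<noteq> {}" using x0 by blast
    fix x assume x: "x \<in> X"
    \<comment> \<open>Completing the square eliminates \<open>x\<close>; the square vanishes when
      \<open>w\<close> is the midpoint of \<open>x\<close> and \<open>v\<close>.\<close>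
    have "2 * (norm (x - w))\<^sup>2 + 2 * (norm (w - v))\<^sup>2 - (norm (x - v))\<^sup>2 = (norm (x - 2 *\<^sub>R w + v))\<^sup>2"
      by (simp add: power2_norm_eq_inner inner_simps inner_commute algebra_simps)
    then have "(norm (x - v))\<^sup>2 \<le> 2 * (norm (x - w))\<^sup>2 + 2 * (norm (w - v))\<^sup>2"
      by (smt (verit) zero_le_power2)
    moreover have "2 * (norm (w - v))\<^sup>2 - (norm (x0 - v))\<^sup>2
        = 2 * (norm (w - u))\<^sup>2 + s \<bullet> (w - u) - 2 * (norm (x0 - u))\<^sup>2"
      unfolding v_eq s_def
      by (simp add: power2_norm_eq_inner inner_simps inner_commute algebra_simps)
    ultimately show "f x - 2 * (norm (x - w))\<^sup>2
        \<le> f x0 - 2 * (norm (x0 - u))\<^sup>2 + \<eta> + s \<bullet> (w - u) + 2 * (norm (w - u))\<^sup>2"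
      using touch[OF x] by linarith
  qed
  \<comment> \<open>Here \<open>x0\<close> is the competitor in the supremum, and this side is
    exact.\<close>
  have lo: "f x0 - 2 * (norm (x0 - u))\<^sup>2 + s \<bullet> (w - u) - 2 * (norm (w - u))\<^sup>2 \<le> sup_conv X f w" for w
  proof -
    have "2 * (norm (x0 - w))\<^sup>2 = 2 * (norm (x0 - u))\<^sup>2 - s \<bullet> (w - u) + 2 * (norm (w - u))\<^sup>2"
      unfolding s_def
      by (simp add: power2_norm_eq_inner inner_simps inner_commute algebra_simps)
    then show ?thesis using sup_conv_ge[OF f1 x0, of w] by linarith
  qed
  show thesis
  proof
    have "norm (x0 + v) \<le> 4" using norm_triangle_ineq[of x0 v] v x0 X by auto
    then show "norm u \<le> 2" unfolding u_def by simp
    have "\<bar>sup_conv X f w - sup_conv X f u - s \<bullet> (w - u)\<bar> \<le> 2 * (norm (w - u))\<^sup>2 + \<eta>" for w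
      using up[of w] lo[of w] up[of u] lo[of u] by simp
    then show "smooth_at X \<eta> f u" unfolding smooth_at_def by blast
    show "sup_conv X f u + 2 * (norm (x0 - u))\<^sup>2 \<le> f x0 + \<eta>" using up[of u] by simp
  qed
qed

text \<open>Differences along the edges bound each coordinate of the slope by
  \<open>2 * \<epsilon> / \<delta>\<close>; a displacement of length \<open>r * \<delta>\<close>
  then costs at most \<open>2 * \<epsilon> * r\<close> per coordinate.\<close>

lemma affine_bound_of_simplex:
  fixes s z w :: "'a::euclidean_space"
  assumes \<delta>: "\<delta> > 0"
    and z: "\<bar>a + s \<bullet> z\<bar> \<le> \<epsilon>"
    and zb: "\<And>b. b \<in> Basis \<Longrightarrow> \<bar>a + s \<bullet> (z + \<delta> *\<^sub>R b)\<bar> \<le> \<epsilon>"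
    and w: "norm (w - z) \<le> r * \<delta>"
  shows "\<bar>a + s \<bullet> w\<bar> \<le> \<epsilon> * (1 + 2 * r * DIM('a))"
proof -
  have sb: "\<bar>s \<bullet> b\<bar> \<le> 2 * \<epsilon> / \<delta>" if "b \<in> Basis" for b
  proof -
    have "\<delta> * (s \<bullet> b) = (a + s \<bullet> (z + \<delta> *\<^sub>R b)) - (a + s \<bullet> z)" by (simp add: inner_simps)
    then have "\<bar>\<delta> * (s \<bullet> b)\<bar> \<le> 2 * \<epsilon>" using z zb[OF that] by linarith
    then show ?thesis using \<delta> by (simp add: abs_mult field_simps)
  qed
  have eps: "\<epsilon> \<ge> 0" using z by linarith
  have "\<bar>s \<bullet> (w - z)\<bar> = \<bar>\<Sum>b\<in>Basis. (s \<bullet> b) * ((w - z) \<bullet> b)\<bar>"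
    by (simp add: euclidean_inner[of s "w - z"])
  also have "\<dots> \<le> (\<Sum>b\<in>(Basis::'a set). (2 * \<epsilon> / \<delta>) * (r * \<delta>))"
  proof (rule order_trans[OF sum_abs sum_mono])
    fix b :: 'a assume b: "b \<in> Basis"
    have "\<bar>(w - z) \<bullet> b\<bar> \<le> r * \<delta>" using Basis_le_norm[OF b, of "w - z"] w by linarith
    then show "\<bar>(s \<bullet> b) * ((w - z) \<bullet> b)\<bar> \<le> (2 * \<epsilon> / \<delta>) * (r * \<delta>)"
      unfolding abs_mult using sb[OF b] eps \<delta> by (intro mult_mono) auto
  qed
  also have "\<dots> = \<epsilon> * (2 * r * DIM('a))" using \<delta> by simp
  finally have "\<bar>s \<bullet> (w - z)\<bar> \<le> \<epsilon> * (2 * r * DIM('a))" .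
  moreover have "a + s \<bullet> w = (a + s \<bullet> z) + s \<bullet> (w - z)" by (simp add: inner_simps)
  ultimately show ?thesis using z by (simp add: algebra_simps)
qed

text \<open>Subtracting the two expansions leaves an affine function plus errors of order
  \<open>\<delta>\<^sup>2\<close>. The values at \<open>z\<close> and
  \<open>z + \<delta> *\<^sub>R b\<close> bound the affine part, and hence the difference on the
  whole ball around \<open>z\<close>.\<close>

lemma sup_conv_close:
  fixes f g :: "'a::euclidean_space \<Rightarrow> real"
  assumes \<delta>: "\<delta> > 0" and eta: "\<eta> \<le> \<delta>\<^sup>2" and r: "r \<ge> 0"
    and u: "smooth_at X \<eta> f u" "norm (u - z) \<le> r * \<delta>"
    and v: "smooth_at X \<eta> g v" "norm (v - z) \<le> r * \<delta>"
    and z: "\<bar>sup_conv X f z - sup_conv X g z\<bar> \<le> \<delta>\<^sup>2"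
    and zb: "\<And>b. b \<in> Basis \<Longrightarrow>
          \<bar>sup_conv X f (z + \<delta> *\<^sub>R b) - sup_conv X g (z + \<delta> *\<^sub>R b)\<bar> \<le> \<delta>\<^sup>2"
    and w: "norm (w - z) \<le> r * \<delta>"
  shows "\<bar>sup_conv X f w - sup_conv X g w\<bar>
     \<le> ((3 + 4 * (r + 1)\<^sup>2) * (1 + 2 * r * DIM('a)) + 16 * r\<^sup>2 + 2) * \<delta>\<^sup>2"
proof -
  let ?M = "sup_conv X f" and ?N = "sup_conv X g"
  obtain s where s: "\<And>w. \<bar>?M w - ?M u - s \<bullet> (w - u)\<bar> \<le> 2 * (norm (w - u))\<^sup>2 + \<eta>"
    using u(1) unfolding smooth_at_def by blast
  obtain t where t: "\<And>w. \<bar>?N w - ?N v - t \<bullet> (w - v)\<bar> \<le> 2 * (norm (w - v))\<^sup>2 + \<eta>"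
    using v(1) unfolding smooth_at_def by blast
  define a where "a = (?M u - s \<bullet> u) - (?N v - t \<bullet> v)"
  \<comment> \<open>\<open>q\<close> bounds, in units of \<open>\<delta>\<close>, the distance from
    \<open>y\<close> to both expansion points. It is \<open>r + 1\<close> at the vertices of the
    simplex and \<open>2 * r\<close> at the target \<open>w\<close>.\<close>
  have diff: "\<bar>(?M y - ?N y) - (a + (s - t) \<bullet> y)\<bar> \<le> (4 * q\<^sup>2 + 2) * \<delta>\<^sup>2"
    if y: "norm (y - z) + r * \<delta> \<le> q * \<delta>" for y q
  proof -
    have "norm (y - u) \<le> q * \<delta>" "norm (y - v) \<le> q * \<delta>"
      using y u(2) v(2) norm_triangle_ineq4[of "y - z" "u - z"] norm_triangle_ineq4[of "y - z" "v - z"]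
      by auto
    then have "(norm (y - u))\<^sup>2 \<le> (q * \<delta>)\<^sup>2" "(norm (y - v))\<^sup>2 \<le> (q * \<delta>)\<^sup>2"
      by (auto intro!: power_mono)
    moreover have "(?M y - ?N y) - (a + (s - t) \<bullet> y)
        = (?M y - ?M u - s \<bullet> (y - u)) - (?N y - ?N v - t \<bullet> (y - v))"
      unfolding a_def by (simp add: inner_simps)
    ultimately have "\<bar>(?M y - ?N y) - (a + (s - t) \<bullet> y)\<bar> \<le> 4 * (q * \<delta>)\<^sup>2 + 2 * \<eta>"
      using s[of y] t[of y] by linarith
    then show ?thesis using eta by (simp add: algebra_simps)
  qed
  have 1: "\<bar>a + (s - t) \<bullet> z\<bar> \<le> (3 + 4 * (r + 1)\<^sup>2) * \<delta>\<^sup>2"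
    using diff[of z "r + 1"] z \<delta> by (simp add: algebra_simps)
  have 2: "\<bar>a + (s - t) \<bullet> (z + \<delta> *\<^sub>R b)\<bar> \<le> (3 + 4 * (r + 1)\<^sup>2) * \<delta>\<^sup>2" if "b \<in> Basis" for b
    using diff[of "z + \<delta> *\<^sub>R b" "r + 1"] zb[OF that] \<delta> that by (simp add: algebra_simps)
  have "\<bar>a + (s - t) \<bullet> w\<bar> \<le> ((3 + 4 * (r + 1)\<^sup>2) * \<delta>\<^sup>2) * (1 + 2 * r * DIM('a))"
    by (rule affine_bound_of_simplex[OF \<delta> 1 2 w])
  moreover have "\<bar>(?M w - ?N w) - (a + (s - t) \<bullet> w)\<bar> \<le> (16 * r\<^sup>2 + 2) * \<delta>\<^sup>2"
    using diff[of w "2 * r"] w by (simp add: algebra_simps power2_eq_square)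
  ultimately show ?thesis by (simp add: algebra_simps)
qed

section \<open>Dyadic grids and codes of transforms\<close>

definition dyadic_grid :: "nat \<Rightarrow> 'a::euclidean_space set" where
  "dyadic_grid j = {z. \<forall>b\<in>Basis. \<exists>k::int. \<bar>k\<bar> \<le> (3 * 2 ^ j :: int) \<and> z \<bullet> b = k / 2 ^ j}"

text \<open>The radius of d + 1 grid steps reaches from \<open>u\<close> to the lower corner of its
  grid cell (at most d steps) and to the neighbours of that corner in the basis directions (one step
  more).\<close>

definition active :: "'a::euclidean_space set \<Rightarrow> real \<Rightarrow> nat \<Rightarrow> ('a \<Rightarrow> real) \<Rightarrow> 'a \<Rightarrow> bool" where
  "active X \<eta> j f z \<longleftrightarrow>
     (\<exists>u. norm u \<le> 2 \<and> smooth_at X \<eta> f u \<and> norm (u - z) \<le> (DIM('a) + 1) / 2 ^ j)"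

text \<open>A value at \<open>z\<close> helps only if the transform is smooth nearby;
  \<open>None\<close> marks the other points. Activity belongs to the code so that equality of codes
  passes a nearby smoothness point from one function to the other. The resolution
  \<open>4 ^ (-j)\<close> matches the quadratic remainder at grid width
  \<open>2 ^ (-j)\<close>.\<close>

definition level_code ::
    "'a::euclidean_space set \<Rightarrow> real \<Rightarrow> nat \<Rightarrow> ('a \<Rightarrow> real) \<Rightarrow> 'a \<Rightarrow> int option" where
  "level_code X \<eta> j f z =
     (if z \<in> dyadic_grid j \<and> active X \<eta> j f z then Some \<lfloor>4 ^ j * sup_conv X f z\<rfloor> else None)"

lemma dyadic_grid_image:
  "(dyadic_grid j :: 'a::euclidean_space set) =
     (\<lambda>k. \<Sum>b\<in>Basis. (real_of_int (k b) / 2 ^ j) *\<^sub>R b) ` (Basis \<rightarrow>\<^sub>E {- (3 * 2 ^ j)..3 * 2 ^ j})"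
proof (intro equalityI subsetI)
  fix z :: 'a assume "z \<in> dyadic_grid j"
  then obtain k :: "'a \<Rightarrow> int" where k: "\<And>b. b \<in> Basis \<Longrightarrow> \<bar>k b\<bar> \<le> (3 * 2 ^ j :: int) \<and> z \<bullet> b = k b / 2 ^ j"
    unfolding dyadic_grid_def mem_Collect_eq by metis
  have "z = (\<Sum>b\<in>Basis. (z \<bullet> b) *\<^sub>R b)" by (simp add: euclidean_representation)
  also have "\<dots> = (\<Sum>b\<in>Basis. (real_of_int (restrict k Basis b) / 2 ^ j) *\<^sub>R b)"
    using k by (intro sum.cong) auto
  finally have "z = (\<Sum>b\<in>Basis. (real_of_int (restrict k Basis b) / 2 ^ j) *\<^sub>R b)" .
  moreover have "restrict k Basis \<in> Basis \<rightarrow>\<^sub>E {- (3 * 2 ^ j)..3 * 2 ^ j}"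
    using k by (force simp: abs_le_iff)
  ultimately show "z \<in> (\<lambda>k. \<Sum>b\<in>Basis. (real_of_int (k b) / 2 ^ j) *\<^sub>R b) `
      (Basis \<rightarrow>\<^sub>E {- (3 * 2 ^ j)..3 * 2 ^ j})" by blast
next
  fix z :: 'a assume "z \<in> (\<lambda>k. \<Sum>b\<in>Basis. (real_of_int (k b) / 2 ^ j) *\<^sub>R b) `
      (Basis \<rightarrow>\<^sub>E {- (3 * 2 ^ j)..3 * 2 ^ j})"
  then obtain k where k: "k \<in> Basis \<rightarrow>\<^sub>E {- (3 * 2 ^ j)..3 * 2 ^ j}"
    and z: "z = (\<Sum>b\<in>Basis. (real_of_int (k b) / 2 ^ j) *\<^sub>R b)" by blast
  show "z \<in> dyadic_grid j" unfolding dyadic_grid_def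
  proof (intro CollectI ballI exI conjI)
    fix b :: 'a assume b: "b \<in> Basis"
    show "\<bar>k b\<bar> \<le> (3 * 2 ^ j :: int)" using PiE_mem[OF k b] by auto
    show "z \<bullet> b = k b / 2 ^ j" unfolding z using b by (simp add: inner_sum_left inner_Basis if_distrib cong: if_cong)
  qed
qed

lemma
  shows finite_dyadic_grid: "finite (dyadic_grid j :: 'a::euclidean_space set)"
    and card_dyadic_grid: "card (dyadic_grid j :: 'a set) \<le> (7 * 2 ^ j) ^ DIM('a)"
proof -
  let ?P = "(Basis :: 'a set) \<rightarrow>\<^sub>E {- (3 * 2 ^ j)..(3 * 2 ^ j :: int)}"
  have fin: "finite ?P" by (intro finite_PiE) auto
  show "finite (dyadic_grid j :: 'a set)" unfolding dyadic_grid_image using fin by simp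
  have "card (dyadic_grid j :: 'a set) \<le> card ?P" unfolding dyadic_grid_image by (rule card_image_le[OF fin])
  also have "\<dots> = (nat (6 * 2 ^ j + 1)) ^ DIM('a)" by (simp add: card_PiE)
  also have "\<dots> \<le> (7 * 2 ^ j) ^ DIM('a)"
  proof (rule power_mono)
    have "(1::int) \<le> 2 ^ j" by simp
    then have "6 * 2 ^ j + 1 \<le> (7 * 2 ^ j :: int)" by linarith
    also have "\<dots> = int (7 * 2 ^ j)" by simp
    finally show "nat (6 * 2 ^ j + 1) \<le> 7 * 2 ^ j" by (simp only: nat_le_iff)
  qed simp
  finally show "card (dyadic_grid j :: 'a set) \<le> (7 * 2 ^ j) ^ DIM('a)" .
qed

lemma norm_dyadic_grid:
  fixes z :: "'a::euclidean_space"
  assumes "z \<in> dyadic_grid j"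
  shows "norm z \<le> 3 * DIM('a)"
proof -
  have "norm z \<le> (\<Sum>b\<in>Basis. \<bar>z \<bullet> b\<bar>)" by (rule norm_le_l1)
  also have "\<dots> \<le> (\<Sum>b\<in>(Basis::'a set). 3)"
  proof (rule sum_mono)
    fix b :: 'a assume "b \<in> Basis"
    then obtain k :: int where k: "\<bar>k\<bar> \<le> (3 * 2 ^ j :: int)" "z \<bullet> b = k / 2 ^ j"
      using assms unfolding dyadic_grid_def by blast
    from k(1) have "real_of_int \<bar>k\<bar> \<le> real_of_int (3 * 2 ^ j)" by (simp only: of_int_le_iff)
    then have "\<bar>real_of_int k\<bar> \<le> 3 * 2 ^ j" by simp
    then have "\<bar>real_of_int k\<bar> / 2 ^ j \<le> 3" by (simp add: pos_divide_le_eq)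
    then show "\<bar>z \<bullet> b\<bar> \<le> 3" using k(2) by (simp add: abs_divide)
  qed
  finally show ?thesis by simp
qed

text \<open>Coordinates are rounded down. The grid reaches to 3 in each coordinate, while
  \<open>u\<close> has norm at most 2, to leave room for the rounding and for the forward
  neighbours.\<close>

lemma dyadic_grid_approx:
  fixes u :: "'a::euclidean_space"
  assumes "norm u \<le> 2"
  obtains z where "norm (u - z) \<le> DIM('a) / 2 ^ j" "z \<in> dyadic_grid j"
    "\<And>b. b \<in> Basis \<Longrightarrow> z + (1 / 2 ^ j) *\<^sub>R b \<in> dyadic_grid j"
proof -
  define k where "k b = \<lfloor>2 ^ j * (u \<bullet> b)\<rfloor>" for b
  define z where "z = (\<Sum>b\<in>Basis. (real_of_int (k b) / 2 ^ j) *\<^sub>R b)"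
  have zb: "z \<bullet> b = k b / 2 ^ j" if "b \<in> Basis" for b
    unfolding z_def using that by (simp add: inner_sum_left inner_Basis if_distrib cong: if_cong)
  have kb: "\<bar>k b\<bar> \<le> 2 * 2 ^ j + 1" if "b \<in> Basis" for b
  proof -
    have "\<bar>u \<bullet> b\<bar> \<le> 2" using Basis_le_norm[OF that, of u] assms by linarith
    then have "\<bar>2 ^ j * (u \<bullet> b)\<bar> \<le> 2 ^ j * 2" by (simp add: abs_mult)
    then have "\<bar>real_of_int (k b)\<bar> \<le> 2 * 2 ^ j + 1" unfolding k_def by linarith
    then have "real_of_int \<bar>k b\<bar> \<le> real_of_int (2 * 2 ^ j + 1)" by simp
    then show ?thesis by linarith
  qed
  have one: "(1::int) \<le> 2 ^ j" by simp
  show thesis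
  proof
    have "norm (u - z) \<le> (\<Sum>b\<in>Basis. \<bar>(u - z) \<bullet> b\<bar>)" by (rule norm_le_l1)
    also have "\<dots> \<le> (\<Sum>b\<in>(Basis::'a set). 1 / 2 ^ j)"
    proof (rule sum_mono)
      fix b :: 'a assume b: "b \<in> Basis"
      have "\<bar>2 ^ j * (u \<bullet> b) - k b\<bar> \<le> 1" unfolding k_def by linarith
      moreover have "(u - z) \<bullet> b = (2 ^ j * (u \<bullet> b) - k b) / 2 ^ j"
        using zb[OF b] by (simp add: inner_simps field_simps)
      ultimately show "\<bar>(u - z) \<bullet> b\<bar> \<le> 1 / 2 ^ j" by (simp add: divide_right_mono)
    qed
    finally show "norm (u - z) \<le> DIM('a) / 2 ^ j" by simp
    show "z \<in> dyadic_grid j" unfolding dyadic_grid_def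
    proof (intro CollectI ballI exI conjI)
      fix b :: 'a assume b: "b \<in> Basis"
      show "\<bar>k b\<bar> \<le> (3 * 2 ^ j :: int)" using kb[OF b] one by linarith
      show "z \<bullet> b = k b / 2 ^ j" by (rule zb[OF b])
    qed
    fix b :: 'a assume b: "b \<in> Basis"
    show "z + (1 / 2 ^ j) *\<^sub>R b \<in> dyadic_grid j" unfolding dyadic_grid_def
    proof (intro CollectI ballI exI conjI)
      fix b' :: 'a assume b': "b' \<in> Basis"
      let ?k = "k b' + (if b = b' then 1 else 0)"
      show "\<bar>?k\<bar> \<le> (3 * 2 ^ j :: int)"
      \<comment> \<open>On the coarsest grid the bound \<open>2 * 2 ^ j + 1\<close> leaves no room
        for the neighbour; there the floor of a number of modulus at most 2 again has modulus at
        most 2.\<close>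
      proof (cases "j = 0")
        case True
        have "\<bar>u \<bullet> b'\<bar> \<le> 2" using Basis_le_norm[OF b', of u] assms by linarith
        then have "\<bar>k b'\<bar> \<le> 2" unfolding k_def True by simp linarith
        then show ?thesis using True by (auto simp: abs_le_iff)
      next
        case False
        then have "(2::int) \<le> 2 ^ j" by (simp add: self_le_power)
        then show ?thesis using kb[OF b'] by (auto simp: abs_le_iff)
      qed
      show "(z + (1 / 2 ^ j) *\<^sub>R b) \<bullet> b' = ?k / 2 ^ j"
        using zb[OF b'] b b' by (simp add: inner_simps inner_Basis add_divide_distrib)
    qed
  qed
qed

text \<open>The constant of \<open>sup_conv_close\<close> for \<open>r = 2 * (d + 1)\<close>: a
  point within d + 1 grid steps of \<open>u\<close>, which is itself within d steps of
  \<open>z\<close>, stays within \<open>r\<close> steps of \<open>z\<close>. It measures accuracy in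
  units of \<open>4 ^ (-j)\<close>.\<close>

definition code_radius :: "'a::euclidean_space itself \<Rightarrow> real" where
  "code_radius _ = (let r = 2 * (real DIM('a) + 1) in
     (3 + 4 * (r + 1)\<^sup>2) * (1 + 2 * r * DIM('a)) + 16 * r\<^sup>2 + 2)"

lemma code_radius_pos: "code_radius TYPE('a::euclidean_space) > 0"
  unfolding code_radius_def Let_def
  by (intro add_nonneg_pos add_nonneg_nonneg mult_nonneg_nonneg) auto

text \<open>Smoothness at \<open>u\<close> is given for \<open>f\<close> only. Equal codes make the
  grid corner next to \<open>u\<close> active for \<open>g\<close> too, which yields a nearby point
  where \<open>g\<close> is smooth, and the simplex at this corner controls the difference of the
  transforms. The range of \<open>w\<close> includes the grid points of the next finer level that
  are active through \<open>u\<close>.\<close>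

lemma level_code_sup_conv_close:
  fixes f g :: "'a::euclidean_space \<Rightarrow> real"
  assumes eq: "level_code X \<eta> j f = level_code X \<eta> j g" and eta: "\<eta> \<le> 1 / 4 ^ j"
    and u: "norm u \<le> 2" "smooth_at X \<eta> f u"
    and w: "norm (w - u) \<le> (DIM('a) + 1) / 2 ^ j"
  shows "\<bar>sup_conv X f w - sup_conv X g w\<bar> \<le> code_radius TYPE('a) / 4 ^ j"
proof -
  define \<delta> :: real where "\<delta> = 1 / 2 ^ j"
  have \<delta>: "\<delta> > 0" unfolding \<delta>_def by simp
  have \<delta>2: "\<delta>\<^sup>2 = 1 / 4 ^ j" unfolding \<delta>_def power_divide
    by (simp add: power2_eq_square flip: power_mult_distrib)
  define r where "r = 2 * (real DIM('a) + 1)"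
  obtain z where z: "norm (u - z) \<le> DIM('a) / 2 ^ j" "z \<in> dyadic_grid j"
    "\<And>b. b \<in> Basis \<Longrightarrow> z + (1 / 2 ^ j) *\<^sub>R b \<in> dyadic_grid j" using dyadic_grid_approx[OF u(1)] by blast
  have near: "\<bar>sup_conv X f y - sup_conv X g y\<bar> \<le> \<delta>\<^sup>2 \<and> active X \<eta> j g y"
    if y: "y \<in> dyadic_grid j" "norm (u - y) \<le> (DIM('a) + 1) / 2 ^ j" for y
  proof -
    have "active X \<eta> j f y" unfolding active_def using u y by blast
    then have c: "level_code X \<eta> j f y = Some \<lfloor>4 ^ j * sup_conv X f y\<rfloor>"
      unfolding level_code_def using y by simp
    then have c': "level_code X \<eta> j g y = Some \<lfloor>4 ^ j * sup_conv X f y\<rfloor>" using eq by simp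
    then have act: "active X \<eta> j g y" and fl: "\<lfloor>4 ^ j * sup_conv X g y\<rfloor> = \<lfloor>4 ^ j * sup_conv X f y\<rfloor>"
      unfolding level_code_def by (auto split: if_splits)
    from fl have "\<bar>4 ^ j * sup_conv X f y - 4 ^ j * sup_conv X g y\<bar> \<le> 1" by linarith
    then have "4 ^ j * \<bar>sup_conv X f y - sup_conv X g y\<bar> \<le> 1"
      by (metis abs_mult abs_numeral power_abs right_diff_distrib)
    then have "\<bar>sup_conv X f y - sup_conv X g y\<bar> \<le> \<delta>\<^sup>2" unfolding \<delta>2 by (simp add: field_simps)
    then show ?thesis using act by simp
  qed
  have "DIM('a) / 2 ^ j \<le> (real DIM('a) + 1) / 2 ^ j" by (simp add: divide_right_mono)
  then have z1: "norm (u - z) \<le> (DIM('a) + 1) / 2 ^ j" using z(1) by (simp add: add.commute)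
  have nz: "\<bar>sup_conv X f z - sup_conv X g z\<bar> \<le> \<delta>\<^sup>2" "active X \<eta> j g z"
    using near[OF z(2) z1] by auto
  have nb: "\<bar>sup_conv X f (z + \<delta> *\<^sub>R b) - sup_conv X g (z + \<delta> *\<^sub>R b)\<bar> \<le> \<delta>\<^sup>2"
    if b: "b \<in> Basis" for b
  proof -
    have "norm (u - (z + \<delta> *\<^sub>R b)) \<le> norm (u - z) + norm (\<delta> *\<^sub>R b)"
      using norm_triangle_ineq4[of "u - z" "\<delta> *\<^sub>R b"] by (simp add: algebra_simps)
    also have "\<dots> \<le> (DIM('a) + 1) / 2 ^ j"
      using z(1) b unfolding \<delta>_def by (simp add: add_divide_distrib)
    finally show ?thesis using near[of "z + \<delta> *\<^sub>R b"] z(3)[OF b] unfolding \<delta>_def by blast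
  qed
  obtain v where v: "smooth_at X \<eta> g v" "norm (v - z) \<le> (DIM('a) + 1) / 2 ^ j"
    using nz(2) unfolding active_def by blast
  have r0: "r \<ge> 0" unfolding r_def by simp
  have le: "(DIM('a) + 1) / 2 ^ j \<le> r * \<delta>" unfolding r_def \<delta>_def by (simp add: field_simps)
  have uz: "norm (u - z) \<le> r * \<delta>" using z1 le by linarith
  have "norm (w - z) \<le> norm (w - u) + norm (u - z)"
    using norm_triangle_ineq[of "w - u" "u - z"] by simp
  also have "\<dots> \<le> r * \<delta>" using w z(1) unfolding r_def \<delta>_def by (simp add: field_simps)
  finally have wz: "norm (w - z) \<le> r * \<delta>" .
  have "\<eta> \<le> \<delta>\<^sup>2" using eta \<delta>2 by simp
  from sup_conv_close[OF \<delta> this r0 u(2) uz v(1) order_trans[OF v(2) le] nz(1) nb wz]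
  show ?thesis unfolding code_radius_def Let_def r_def[symmetric] \<delta>2 by simp
qed

text \<open>The transforms are compared only at the contact point \<open>u\<close> of
  \<open>f\<close> at \<open>x\<close>: there the transform of \<open>f\<close> bounds
  \<open>f x\<close> from below up to \<open>\<eta>\<close>, while that of \<open>g\<close>
  dominates \<open>g x - 2 * |x - u|^2\<close>. Exchanging \<open>f\<close> and \<open>g\<close>
  gives the other inequality.\<close>

lemma level_code_close:
  fixes f g :: "'a::euclidean_space \<Rightarrow> real"
  assumes f: "f \<in> semiconcave_class X \<eta>" and g: "g \<in> semiconcave_class X \<eta>"
    and eq: "level_code X \<eta> j f = level_code X \<eta> j g" and eta: "\<eta> \<le> 1 / 4 ^ j"
    and X: "X \<subseteq> cball 0 1" and x: "x \<in> X"
  shows "\<bar>f x - g x\<bar> \<le> (code_radius TYPE('a) + 1) / 4 ^ j"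
proof -
  have *: "g x \<le> f x + (code_radius TYPE('a) + 1) / 4 ^ j"
    if f: "f \<in> semiconcave_class X \<eta>" and g: "g \<in> semiconcave_class X \<eta>"
      and eq: "level_code X \<eta> j f = level_code X \<eta> j g" for f g
  proof -
    obtain u where u: "norm u \<le> 2" "smooth_at X \<eta> f u"
      "sup_conv X f u + 2 * (norm (x - u))\<^sup>2 \<le> f x + \<eta>"
      using semiconcave_class_touching[OF f x X] by blast
    have "\<bar>sup_conv X f u - sup_conv X g u\<bar> \<le> code_radius TYPE('a) / 4 ^ j"
      by (rule level_code_sup_conv_close[OF eq eta u(1,2)]) simp
    moreover have "g x - 2 * (norm (x - u))\<^sup>2 \<le> sup_conv X g u"
      by (rule sup_conv_ge[OF _ x]) (use g in \<open>auto simp: semiconcave_class_def\<close>)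
    ultimately show ?thesis using u(3) eta by (simp add: add_divide_distrib)
  qed
  show ?thesis using *[OF f g eq] *[OF g f eq[symmetric]] by linarith
qed

text \<open>At each grid point the code is \<open>None\<close> or an integer within
  \<open>D + 1\<close> of a reference value taken from one active member of \<open>G\<close>, hence
  one of \<open>2 * D + 4\<close> choices. What counts is the oscillation within \<open>G\<close>,
  not the size of the values.\<close>

lemma card_level_code_le:
  fixes G :: "('a::euclidean_space \<Rightarrow> real) set" and D :: nat
  assumes osc: "\<And>f g z. \<lbrakk>f \<in> G; g \<in> G; z \<in> dyadic_grid j; active X \<eta> j f z; active X \<eta> j g z\<rbrakk>
      \<Longrightarrow> \<bar>4 ^ j * sup_conv X f z - 4 ^ j * sup_conv X g z\<bar> \<le> real D"
  shows "finite (level_code X \<eta> j ` G)"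
    and "card (level_code X \<eta> j ` G) \<le> (2 * D + 4) ^ card (dyadic_grid j :: 'a set)"
proof -
  define v where "v z = \<lfloor>4 ^ j * sup_conv X (SOME g. g \<in> G \<and> active X \<eta> j g z) z\<rfloor>" for z
  define B where "B z = insert None (Some ` {v z - int D - 1..v z + int D + 1})" for z
  have sub: "level_code X \<eta> j ` G \<subseteq> PiE_dflt (dyadic_grid j) None B"
  proof clarify
    fix f assume f: "f \<in> G"
    have "level_code X \<eta> j f z \<in> B z" if z: "z \<in> dyadic_grid j" for z
    proof (cases "active X \<eta> j f z")
      case True
      define g where "g = (SOME g. g \<in> G \<and> active X \<eta> j g z)"
      have "g \<in> G \<and> active X \<eta> j g z" unfolding g_def by (rule someI[of _ f]) (use f True in simp)
      then have "\<bar>4 ^ j * sup_conv X f z - 4 ^ j * sup_conv X g z\<bar> \<le> real D"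
        using osc[OF f _ z True] by blast
      then have "\<lfloor>4 ^ j * sup_conv X f z\<rfloor> \<in> {v z - int D - 1..v z + int D + 1}"
        unfolding v_def g_def[symmetric] by simp linarith
      then show ?thesis unfolding B_def level_code_def using z True by simp
    qed (simp add: level_code_def B_def)
    then show "level_code X \<eta> j f \<in> PiE_dflt (dyadic_grid j) None B"
      unfolding PiE_dflt_def by (auto simp: level_code_def)
  qed
  have finB: "finite (B z)" for z unfolding B_def by simp
  have cardB: "card (B z) \<le> 2 * D + 4" for z
  proof -
    have "card (B z) \<le> Suc (card (Some ` {v z - int D - 1..v z + int D + 1}))"
      unfolding B_def by (simp add: card_insert_if)
    also have "\<dots> \<le> Suc (card {v z - int D - 1..v z + int D + 1})"
      by (intro Suc_le_mono[THEN iffD2] card_image_le) simp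
    also have "\<dots> = 2 * D + 4" by simp
    finally show ?thesis .
  qed
  have fin: "finite (PiE_dflt (dyadic_grid j :: 'a set) None B)"
    by (intro finite_PiE_dflt finite_dyadic_grid finB)
  then show "finite (level_code X \<eta> j ` G)" using sub finite_subset by blast
  have "card (level_code X \<eta> j ` G) \<le> card (PiE_dflt (dyadic_grid j :: 'a set) None B)"
    by (rule card_mono[OF fin sub])
  also have "\<dots> = (\<Prod>z\<in>dyadic_grid j. card (B z))"
    by (intro card_PiE_dflt finite_dyadic_grid finB)
  also have "\<dots> \<le> (\<Prod>z\<in>(dyadic_grid j :: 'a set). 2 * D + 4)"
    by (intro prod_mono) (use cardB in auto)
  finally show "card (level_code X \<eta> j ` G) \<le> (2 * D + 4) ^ card (dyadic_grid j :: 'a set)"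
    by simp
qed

text \<open>A code at level \<open>j\<close> determines the values at level \<open>j + 1\<close> up to boundedly many choices per grid
  point, which avoids a logarithmic factor in the entropy.\<close>

lemma card_level_code_semiconcave:
  "\<exists>A>0. \<forall>(X::'a::euclidean_space set) \<eta> j. X \<noteq> {} \<longrightarrow> X \<subseteq> cball 0 1 \<longrightarrow> \<eta> \<le> 1 / 4 ^ j \<longrightarrow>
     finite (level_code X \<eta> j ` semiconcave_class X \<eta>) \<and>
     real (card (level_code X \<eta> j ` semiconcave_class X \<eta>)) \<le> exp (A * (2 ^ DIM('a)) ^ j)"
proof -
  define d where "d = DIM('a)"
  \<comment> \<open>The first entry bounds the oscillation among functions with the same code one
    level up, where the finer resolution costs a factor 4; the second bounds it at level 0 by the
    size of the transforms.\<close>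
  define D where "D = nat \<lceil>max (4 * code_radius TYPE('a)) (2 * (1 + 2 * (1 + 3 * real d)\<^sup>2))\<rceil>"
  have D1: "4 * code_radius TYPE('a) \<le> D" and D2: "2 * (1 + 2 * (1 + 3 * real d)\<^sup>2) \<le> D"
    using real_nat_ceiling_ge[of "max (4 * code_radius TYPE('a)) (2 * (1 + 2 * (1 + 3 * real d)\<^sup>2))"]
    unfolding D_def by auto
  \<comment> \<open>Level \<open>j\<close> alone contributes at most
    \<open>A / 2 * (2 ^ d) ^ j\<close> to the exponent. Doubling this constant absorbs the earlier
    levels, whose contributions grow geometrically with ratio \<open>2 ^ d\<close>, at least
    2.\<close>
  define A where "A = 2 * 7 ^ d * ln (2 * real D + 4)"
  have lnD: "ln (2 * real D + 4) > 0" by (intro ln_gt_zero) auto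
  have A0: "A > 0" unfolding A_def using lnD by simp
  have point: "real ((2 * D + 4) ^ card (dyadic_grid j :: 'a set)) \<le> exp (A / 2 * (2 ^ d) ^ j)" for j
  proof -
    have "real (card (dyadic_grid j :: 'a set)) \<le> (7 * 2 ^ j) ^ d"
      using of_nat_mono[OF card_dyadic_grid[where 'a='a, of j], where 'a=real] unfolding d_def by simp
    also have "\<dots> = 7 ^ d * (2 ^ d) ^ j"
      by (metis mult.commute power_mult power_mult_distrib)
    finally have *: "real (card (dyadic_grid j :: 'a set)) \<le> 7 ^ d * (2 ^ d) ^ j" .
    have "real ((2 * D + 4) ^ card (dyadic_grid j :: 'a set))
        = exp (real (card (dyadic_grid j :: 'a set)) * ln (2 * real D + 4))"
    proof -
      have "real (2 * D + 4) = exp (ln (2 * real D + 4))" by simp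
      then show ?thesis unfolding exp_of_nat_mult by (metis of_nat_power)
    qed
    also have "\<dots> \<le> exp ((7 ^ d * (2 ^ d) ^ j) * ln (2 * real D + 4))"
      unfolding exp_le_cancel_iff by (intro mult_right_mono *) (use lnD in simp)
    also have "\<dots> = exp (A / 2 * (2 ^ d) ^ j)" unfolding A_def by (simp add: mult_ac)
    finally show ?thesis .
  qed
  have "finite (level_code X \<eta> j ` semiconcave_class X \<eta>) \<and>
     real (card (level_code X \<eta> j ` semiconcave_class X \<eta>)) \<le> exp (A * (2 ^ d) ^ j)"
    if X: "X \<noteq> {}" "X \<subseteq> cball 0 1" and eta: "\<eta> \<le> 1 / 4 ^ j" for X :: "'a set" and \<eta> j
    using eta
  proof (induction j)
    case 0
    have osc: "\<bar>4 ^ 0 * sup_conv X f z - 4 ^ 0 * sup_conv X g z\<bar> \<le> real D"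
      if f: "f \<in> semiconcave_class X \<eta>" and g: "g \<in> semiconcave_class X \<eta>"
        and z: "z \<in> dyadic_grid 0" for f g and z :: 'a
    proof -
      have "(1 + norm z)\<^sup>2 \<le> (1 + 3 * real d)\<^sup>2"
        using norm_dyadic_grid[OF z] unfolding d_def by (intro power_mono) auto
      moreover have "\<bar>sup_conv X f z\<bar> \<le> 1 + 2 * (1 + norm z)\<^sup>2"
        by (rule sup_conv_bound[OF _ X]) (use f in \<open>auto simp: semiconcave_class_def\<close>)
      moreover have "\<bar>sup_conv X g z\<bar> \<le> 1 + 2 * (1 + norm z)\<^sup>2"
        by (rule sup_conv_bound[OF _ X]) (use g in \<open>auto simp: semiconcave_class_def\<close>)
      ultimately show ?thesis using D2 abs_triangle_ineq4[of "sup_conv X f z" "sup_conv X g z"]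
        unfolding power_0 mult_1 by argo
    qed
    have card: "finite (level_code X \<eta> 0 ` semiconcave_class X \<eta>)"
      "card (level_code X \<eta> 0 ` semiconcave_class X \<eta>) \<le> (2 * D + 4) ^ card (dyadic_grid 0 :: 'a set)"
      by (rule card_level_code_le, rule osc; assumption)+
    have "real (card (level_code X \<eta> 0 ` semiconcave_class X \<eta>)) \<le> exp (A / 2 * (2 ^ d) ^ 0)"
      by (rule order_trans[OF of_nat_mono[OF card(2)] point])
    also have "\<dots> \<le> exp (A * (2 ^ d) ^ 0)" using A0 by simp
    finally show ?case using card(1) by blast
  next
    case (Suc j)
    let ?F = "semiconcave_class X \<eta>"
    have "(1::real) / 4 ^ Suc j \<le> 1 / 4 ^ j" by (simp add: field_simps)
    then have eta: "\<eta> \<le> 1 / 4 ^ j" using Suc.prems by linarith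
    have IH: "finite (level_code X \<eta> j ` ?F)" "real (card (level_code X \<eta> j ` ?F)) \<le> exp (A * (2 ^ d) ^ j)"
      using Suc.IH[OF eta] by auto
    define fib where "fib c = {f \<in> ?F. level_code X \<eta> j f = c}" for c
    have osc: "\<bar>4 ^ Suc j * sup_conv X f z - 4 ^ Suc j * sup_conv X g z\<bar> \<le> real D"
      if f: "f \<in> fib c" and g: "g \<in> fib c" and act: "active X \<eta> (Suc j) f z" for f g c z
    proof -
      obtain u where u: "norm u \<le> 2" "smooth_at X \<eta> f u" "norm (u - z) \<le> (DIM('a) + 1) / 2 ^ Suc j"
        using act unfolding active_def by blast
      \<comment> \<open>A point active at the finer level through \<open>u\<close> lies within the
        coarser radius of the same \<open>u\<close>, so closeness at level \<open>j\<close> applies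
        to it.\<close>
      have "(real DIM('a) + 1) / 2 ^ Suc j \<le> (DIM('a) + 1) / 2 ^ j" by (simp add: field_simps)
      then have z: "norm (z - u) \<le> (DIM('a) + 1) / 2 ^ j" using u(3) by (simp add: norm_minus_commute add.commute)
      have "level_code X \<eta> j f = level_code X \<eta> j g" using f g unfolding fib_def by simp
      from level_code_sup_conv_close[OF this eta u(1,2) z]
      have "4 ^ Suc j * \<bar>sup_conv X f z - sup_conv X g z\<bar>
          \<le> 4 ^ Suc j * (code_radius TYPE('a) / 4 ^ j)" by (intro mult_left_mono) auto
      also have "\<dots> \<le> D" using D1 by simp
      finally show ?thesis by (simp add: abs_mult right_diff_distrib[symmetric])
    qed
    have card: "finite (level_code X \<eta> (Suc j) ` fib c)"
      "card (level_code X \<eta> (Suc j) ` fib c) \<le> (2 * D + 4) ^ card (dyadic_grid (Suc j) :: 'a set)" for c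
      by (rule card_level_code_le, rule osc; assumption)+
    have eq: "level_code X \<eta> (Suc j) ` ?F = (\<Union>c\<in>level_code X \<eta> j ` ?F. level_code X \<eta> (Suc j) ` fib c)"
      unfolding fib_def by blast
    have "card (level_code X \<eta> (Suc j) ` ?F)
        \<le> (\<Sum>c\<in>level_code X \<eta> j ` ?F. card (level_code X \<eta> (Suc j) ` fib c))"
      unfolding eq by (rule card_UN_le[OF IH(1)])
    also have "\<dots> \<le> (\<Sum>c\<in>level_code X \<eta> j ` ?F. (2 * D + 4) ^ card (dyadic_grid (Suc j) :: 'a set))"
      by (intro sum_mono card(2))
    also have "\<dots> = card (level_code X \<eta> j ` ?F) * (2 * D + 4) ^ card (dyadic_grid (Suc j) :: 'a set)"
      by simp
    finally have "real (card (level_code X \<eta> (Suc j) ` ?F))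
        \<le> real (card (level_code X \<eta> j ` ?F)) * real ((2 * D + 4) ^ card (dyadic_grid (Suc j) :: 'a set))"
      by (metis of_nat_le_iff of_nat_mult)
    also have "\<dots> \<le> exp (A * (2 ^ d) ^ j) * exp (A / 2 * (2 ^ d) ^ Suc j)"
      by (intro mult_mono IH(2) point) auto
    also have "\<dots> = exp ((A / 2 * (2 ^ d) ^ j) * (2 + 2 ^ d))"
      by (simp add: exp_add[symmetric] algebra_simps)
    also have "\<dots> \<le> exp ((A / 2 * (2 ^ d) ^ j) * (2 ^ d + 2 ^ d))"
    proof -
      have "(2::real) \<le> 2 ^ d" unfolding d_def by (simp add: self_le_power)
      then show ?thesis using A0 by (intro exp_le_cancel_iff[THEN iffD2] mult_left_mono) auto
    qed
    also have "\<dots> = exp (A * (2 ^ d) ^ Suc j)" by simp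
    finally have "real (card (level_code X \<eta> (Suc j) ` ?F)) \<le> exp (A * (2 ^ d) ^ Suc j)" .
    moreover have "finite (level_code X \<eta> (Suc j) ` ?F)"
      unfolding eq by (intro finite_UN_I IH(1) card(1))
    ultimately show ?case by blast
  qed
  then show ?thesis using A0 unfolding d_def by blast
qed

section \<open>Chaining\<close>

definition emp_dev :: "nat \<Rightarrow> 'a measure \<Rightarrow> ('a \<Rightarrow> real) \<Rightarrow> (nat \<Rightarrow> 'a) \<Rightarrow> real" where
  "emp_dev n \<mu> f \<omega> = (\<Sum>i<n. f (\<omega> i)) / real n - (\<integral>x. f x \<partial>\<mu>)"

text \<open>Independence factors the exponential moment, and Hoeffding's lemma with range
  \<open>2 * b\<close> and parameter \<open>l / n\<close> bounds each of the \<open>n\<close>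
  factors.\<close>

lemma nn_integral_exp_emp_dev:
  fixes f :: "'a \<Rightarrow> real"
  assumes \<mu>: "prob_space \<mu>" and f: "f \<in> borel_measurable \<mu>" and b: "AE x in \<mu>. \<bar>f x\<bar> \<le> b"
    and n: "n > 0" and l: "l > 0"
  shows "(\<integral>\<^sup>+\<omega>. ennreal (exp (l * emp_dev n \<mu> f \<omega>)) \<partial>PiM {..<n} (\<lambda>_. \<mu>))
    \<le> ennreal (exp (l\<^sup>2 * b\<^sup>2 / (2 * real n)))"
proof -
  interpret \<mu>: prob_space \<mu> by (rule \<mu>)
  interpret P: product_sigma_finite "\<lambda>_::nat. \<mu>" ..
  interpret I: interval_bounded_random_variable \<mu> f "-b" b
  proof
    show "f \<in> borel_measurable \<mu>" by (rule f)
    show "AE x in \<mu>. f x \<in> {-b..b}" using b by eventually_elim (simp add: abs_le_iff)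
  qed
  note [measurable] = f
  let ?E = "\<integral>x. f x \<partial>\<mu>"
  have eq: "exp (l * emp_dev n \<mu> f \<omega>) = (\<Prod>i<n. exp (l / n * (f (\<omega> i) - ?E)))" for \<omega>
  proof -
    have "(\<Sum>i<n. l / n * (f (\<omega> i) - ?E)) = l / n * ((\<Sum>i<n. f (\<omega> i)) - n * ?E)"
      by (simp only: sum_distrib_left[symmetric] sum_subtractf sum_constant card_lessThan)
    also have "\<dots> = l * emp_dev n \<mu> f \<omega>"
      unfolding emp_dev_def using n by (simp add: right_diff_distrib)
    finally have "l * emp_dev n \<mu> f \<omega> = (\<Sum>i<n. l / n * (f (\<omega> i) - ?E))" by simp
    then show ?thesis by (simp add: exp_sum)
  qed
  have "(\<integral>\<^sup>+\<omega>. ennreal (exp (l * emp_dev n \<mu> f \<omega>)) \<partial>PiM {..<n} (\<lambda>_. \<mu>))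
      = (\<integral>\<^sup>+\<omega>. (\<Prod>i<n. ennreal (exp (l / n * (f (\<omega> i) - ?E)))) \<partial>PiM {..<n} (\<lambda>_. \<mu>))"
    unfolding eq by (simp add: prod_ennreal)
  also have "\<dots> = (\<Prod>i<n. \<integral>\<^sup>+x. ennreal (exp (l / n * (f x - ?E))) \<partial>\<mu>)"
    by (rule P.product_nn_integral_prod) auto
  also have "\<dots> \<le> (\<Prod>i<n. ennreal (exp ((l / n)\<^sup>2 * (b - - b)\<^sup>2 / 8)))"
    by (intro prod_mono_ennreal I.Hoeffdings_lemma_nn_integral) (use l n in auto)
  also have "\<dots> = ennreal (exp ((l / n)\<^sup>2 * (b - - b)\<^sup>2 / 8) ^ n)"
    by (simp add: ennreal_power)
  also have "exp ((l / n)\<^sup>2 * (b - - b)\<^sup>2 / 8) ^ n = exp (l\<^sup>2 * b\<^sup>2 / (2 * real n))"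
  proof -
    have "real n * ((l / n)\<^sup>2 * (b - - b)\<^sup>2 / 8) = l\<^sup>2 * b\<^sup>2 / (2 * real n)"
      using n by (simp add: power2_eq_square field_simps)
    then show ?thesis by (metis exp_of_nat_mult)
  qed
  finally show ?thesis .
qed

lemma emp_dev_measurable [measurable]:
  fixes f :: "'a \<Rightarrow> real"
  assumes [measurable]: "f \<in> borel_measurable \<mu>"
  shows "emp_dev n \<mu> f \<in> borel_measurable (PiM {..<n} (\<lambda>_. \<mu>))"
  unfolding emp_dev_def by measurable

lemma emp_dev_uminus: "emp_dev n \<mu> (\<lambda>x. - f x) \<omega> = - emp_dev n \<mu> f \<omega>"
  unfolding emp_dev_def by (simp add: sum_negf)

text \<open>A maximal inequality with an explicit majorant in place of the maximum. Let
  \<open>S\<close> be the sum of the exponentials of both signs and \<open>M\<close> a bound on its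
  integral; the tangent of the logarithm at \<open>M\<close> gives
  \<open>l * t \<le> ln M + S / M\<close> whenever \<open>exp (l * t) \<le> S\<close>. Linearity of
  the integral then does the work of Jensen's inequality, and \<open>l\<close> is left for the
  caller to optimise.\<close>

lemma finite_class_deviation:
  fixes H :: "('a \<Rightarrow> real) set"
  assumes \<mu>: "prob_space \<mu>" and H: "finite H" "H \<noteq> {}" and meas: "\<And>f. f \<in> H \<Longrightarrow> f \<in> borel_measurable \<mu>"
    and b: "\<And>f. f \<in> H \<Longrightarrow> AE x in \<mu>. \<bar>f x\<bar> \<le> b" and n: "n > 0" and l: "l > 0"
  obtains G where "G \<in> borel_measurable (PiM {..<n} (\<lambda>_. \<mu>))" "\<And>\<omega>. 0 \<le> G \<omega>"
    "\<And>f \<omega>. f \<in> H \<Longrightarrow> \<bar>emp_dev n \<mu> f \<omega>\<bar> \<le> G \<omega>"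
    "(\<integral>\<^sup>+\<omega>. ennreal (G \<omega>) \<partial>PiM {..<n} (\<lambda>_. \<mu>))
       \<le> ennreal ((ln (2 * real (card H)) + 1) / l + l * b\<^sup>2 / (2 * real n))"
proof -
  interpret P: prob_space "PiM {..<n} (\<lambda>_. \<mu>)" by (intro prob_space_PiM \<mu>)
  define M where "M = 2 * real (card H) * exp (l\<^sup>2 * b\<^sup>2 / (2 * real n))"
  have cH: "real (card H) \<ge> 1" using H by (simp add: Suc_leI card_gt_0_iff)
  have M1: "M > 0" unfolding M_def using cH by simp
  have "1 \<le> 2 * real (card H)" using cH by linarith
  then have "1 \<le> M" unfolding M_def using mult_mono[of 1 "2 * real (card H)" 1 "exp (l\<^sup>2 * b\<^sup>2 / (2 * real n))"] by simp
  then have lnM0: "0 \<le> ln M" by simp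
  have lnM: "ln M = ln (2 * real (card H)) + l\<^sup>2 * b\<^sup>2 / (2 * real n)"
    unfolding M_def using cH by (subst ln_mult) auto
  define S where "S \<omega> = (\<Sum>f\<in>H. exp (l * emp_dev n \<mu> f \<omega>) + exp (l * emp_dev n \<mu> (\<lambda>x. - f x) \<omega>))" for \<omega>
  have S0: "0 \<le> S \<omega>" for \<omega> unfolding S_def by (intro sum_nonneg add_nonneg_nonneg) auto
  define G where "G \<omega> = (ln M + S \<omega> / M) / l" for \<omega>
  note [measurable] = meas
  have Smeas[measurable]: "S \<in> borel_measurable (PiM {..<n} (\<lambda>_. \<mu>))"
    unfolding S_def by measurable
    have 1: "G \<in> borel_measurable (PiM {..<n} (\<lambda>_. \<mu>))" unfolding G_def by measurable
    have 2: "0 \<le> G \<omega>" for \<omega> unfolding G_def using lnM0 S0 M1 l by simp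
    have 3: "\<bar>emp_dev n \<mu> f \<omega>\<bar> \<le> G \<omega>" if f: "f \<in> H" for f \<omega>
    proof -
      have "t \<le> G \<omega>" if t: "exp (l * t) \<le> S \<omega>" for t
      proof -
        have "1 + (l * t - ln M) \<le> exp (l * t - ln M)" by (rule exp_ge_add_one_self)
        also have "\<dots> = exp (l * t) / M" using M1 by (simp add: exp_diff)
        also have "\<dots> \<le> S \<omega> / M" using t M1 by (intro divide_right_mono) auto
        finally have "l * t \<le> ln M + S \<omega> / M" by linarith
        then show ?thesis unfolding G_def using l by (simp add: field_simps)
      qed
      moreover have "exp (l * emp_dev n \<mu> f \<omega>) + exp (l * emp_dev n \<mu> (\<lambda>x. - f x) \<omega>) \<le> S \<omega>"
        unfolding S_def by (rule member_le_sum[OF f]) (auto intro: H)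
      then have "exp (l * emp_dev n \<mu> f \<omega>) \<le> S \<omega>" "exp (l * (- emp_dev n \<mu> f \<omega>)) \<le> S \<omega>"
        unfolding emp_dev_uminus using exp_gt_zero[of "l * emp_dev n \<mu> f \<omega>"]
          exp_gt_zero[of "l * (- emp_dev n \<mu> f \<omega>)"] by linarith+
      ultimately have "emp_dev n \<mu> f \<omega> \<le> G \<omega>" "- emp_dev n \<mu> f \<omega> \<le> G \<omega>" by blast+
      then show ?thesis by linarith
    qed
    have mf: "(\<lambda>\<omega>. exp (l * emp_dev n \<mu> f \<omega>)) \<in> borel_measurable (PiM {..<n} (\<lambda>_. \<mu>))"
      "(\<lambda>\<omega>. exp (l * emp_dev n \<mu> (\<lambda>x. - f x) \<omega>)) \<in> borel_measurable (PiM {..<n} (\<lambda>_. \<mu>))"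
      if [measurable]: "f \<in> H" for f by measurable
    have "ennreal (S \<omega>) = (\<Sum>f\<in>H. ennreal (exp (l * emp_dev n \<mu> f \<omega>))
        + ennreal (exp (l * emp_dev n \<mu> (\<lambda>x. - f x) \<omega>)))" for \<omega>
      unfolding S_def by (subst sum_ennreal[symmetric]) (auto intro!: sum.cong ennreal_plus)
    then have "(\<integral>\<^sup>+\<omega>. ennreal (S \<omega>) \<partial>PiM {..<n} (\<lambda>_. \<mu>))
        = (\<Sum>f\<in>H. \<integral>\<^sup>+\<omega>. ennreal (exp (l * emp_dev n \<mu> f \<omega>))
            + ennreal (exp (l * emp_dev n \<mu> (\<lambda>x. - f x) \<omega>)) \<partial>PiM {..<n} (\<lambda>_. \<mu>))"
      using mf by (simp add: nn_integral_sum)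
    also have "\<dots> = (\<Sum>f\<in>H. (\<integral>\<^sup>+\<omega>. ennreal (exp (l * emp_dev n \<mu> f \<omega>)) \<partial>PiM {..<n} (\<lambda>_. \<mu>))
            + (\<integral>\<^sup>+\<omega>. ennreal (exp (l * emp_dev n \<mu> (\<lambda>x. - f x) \<omega>)) \<partial>PiM {..<n} (\<lambda>_. \<mu>)))"
      using mf by (intro sum.cong refl nn_integral_add) auto
    also have "\<dots> \<le> (\<Sum>f\<in>H. ennreal (exp (l\<^sup>2 * b\<^sup>2 / (2 * real n))) + ennreal (exp (l\<^sup>2 * b\<^sup>2 / (2 * real n))))"
      by (intro sum_mono add_mono nn_integral_exp_emp_dev \<mu> n l) (use b in auto)
    also have "\<dots> = ennreal M"
      unfolding M_def by (simp add: ennreal_of_nat_eq_real_of_nat ennreal_mult'[symmetric] ennreal_plus[symmetric] algebra_simps del: ennreal_plus)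
    finally have intS: "(\<integral>\<^sup>+\<omega>. ennreal (S \<omega>) \<partial>PiM {..<n} (\<lambda>_. \<mu>)) \<le> ennreal M" .
    have "(\<integral>\<^sup>+\<omega>. ennreal (G \<omega>) \<partial>PiM {..<n} (\<lambda>_. \<mu>))
        = (\<integral>\<^sup>+\<omega>. ennreal (ln M / l) + ennreal (1 / (M * l)) * ennreal (S \<omega>) \<partial>PiM {..<n} (\<lambda>_. \<mu>))"
    proof (intro nn_integral_cong)
      fix \<omega>
      have "G \<omega> = ln M / l + 1 / (M * l) * S \<omega>" unfolding G_def by (simp add: add_divide_distrib mult.commute)
      moreover have "0 \<le> ln M / l" "0 \<le> 1 / (M * l)" using lnM0 l M1 by simp_all
      ultimately show "ennreal (G \<omega>) = ennreal (ln M / l) + ennreal (1 / (M * l)) * ennreal (S \<omega>)"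
        using S0[of \<omega>] by (simp only: ennreal_plus ennreal_mult mult_nonneg_nonneg)
    qed
    also have "\<dots> = ennreal (ln M / l) + ennreal (1 / (M * l)) * (\<integral>\<^sup>+\<omega>. ennreal (S \<omega>) \<partial>PiM {..<n} (\<lambda>_. \<mu>))"
      by (subst nn_integral_add) (auto simp: nn_integral_cmult P.emeasure_space_1)
    also have "\<dots> \<le> ennreal (ln M / l) + ennreal (1 / (M * l)) * ennreal M"
      by (intro add_mono mult_left_mono intS) auto
    also have "\<dots> = ennreal (ln M / l + 1 / (M * l) * M)"
      using lnM0 l M1 by (simp only: ennreal_plus ennreal_mult divide_nonneg_nonneg mult_nonneg_nonneg less_imp_le zero_le_one)
    also have "ln M / l + 1 / (M * l) * M = (ln (2 * real (card H)) + 1) / l + l * b\<^sup>2 / (2 * real n)"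
      unfolding lnM using M1 l n by (simp add: field_simps power2_eq_square)
    finally have 4: "(\<integral>\<^sup>+\<omega>. ennreal (G \<omega>) \<partial>PiM {..<n} (\<lambda>_. \<mu>))
       \<le> ennreal ((ln (2 * real (card H)) + 1) / l + l * b\<^sup>2 / (2 * real n))" .
  show thesis using that[OF 1 2 3 4] .
qed

section \<open>Integrals and empirical deviations for measures carried by a set\<close>

lemma AE_prob_measures_on:
  assumes "\<mu> \<in> prob_measures_on X"
  shows "AE x in \<mu>. x \<in> X"
proof -
  interpret prob_space \<mu> using assms unfolding prob_measures_on_def by blast
  \<comment> \<open>A set outside the sigma-algebra has \<open>emeasure\<close> 0, so mass 1 makes
    \<open>X\<close> measurable.\<close>
  have "X \<in> sets \<mu>" using assms emeasure_notin_sets[of X \<mu>] unfolding prob_measures_on_def by fastforce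
  moreover have "prob X = 1" using assms unfolding prob_measures_on_def measure_def by simp
  ultimately show ?thesis by (simp add: AE_in_set_eq_1)
qed

lemma integrable_prob_measures_on:
  fixes f :: "'a::topological_space \<Rightarrow> real"
  assumes \<mu>: "\<mu> \<in> prob_measures_on X" and f: "f \<in> borel_measurable borel"
    and b: "\<And>x. x \<in> X \<Longrightarrow> \<bar>f x\<bar> \<le> b"
  shows "integrable \<mu> f"
proof -
  interpret prob_space \<mu> using \<mu> unfolding prob_measures_on_def by blast
  have "sets \<mu> = sets borel" using \<mu> unfolding prob_measures_on_def by blast
  then have "f \<in> borel_measurable \<mu>" using f by (simp cong: measurable_cong_sets)
  then show ?thesis
    by (rule integrable_const_bound[where B=b, rotated])
       (use AE_prob_measures_on[OF \<mu>] b in \<open>auto elim: eventually_mono\<close>)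
qed

lemma abs_integral_prob_measures_on_le:
  fixes f :: "'a::topological_space \<Rightarrow> real"
  assumes \<mu>: "\<mu> \<in> prob_measures_on X" and f: "f \<in> borel_measurable borel"
    and b: "\<And>x. x \<in> X \<Longrightarrow> \<bar>f x\<bar> \<le> b"
  shows "\<bar>\<integral>x. f x \<partial>\<mu>\<bar> \<le> b"
proof -
  interpret prob_space \<mu> using \<mu> unfolding prob_measures_on_def by blast
  note int = integrable_prob_measures_on[OF \<mu> f b]
  have "\<bar>\<integral>x. f x \<partial>\<mu>\<bar> \<le> (\<integral>x. \<bar>f x\<bar> \<partial>\<mu>)" by (rule integral_abs_bound)
  also have "\<dots> \<le> (\<integral>x. b \<partial>\<mu>)"
    using int AE_prob_measures_on[OF \<mu>] b by (intro integral_mono_AE) (auto elim: eventually_mono)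
  finally show ?thesis by (simp add: prob_space)
qed

lemma abs_emp_dev_le:
  fixes f :: "'a::topological_space \<Rightarrow> real"
  assumes \<mu>: "\<mu> \<in> prob_measures_on X" and f: "f \<in> borel_measurable borel"
    and b: "\<And>x. x \<in> X \<Longrightarrow> \<bar>f x\<bar> \<le> b" and n: "n > 0" and \<omega>: "\<And>i. i < n \<Longrightarrow> \<omega> i \<in> X"
  shows "\<bar>emp_dev n \<mu> f \<omega>\<bar> \<le> 2 * b"
proof -
  have "\<bar>\<Sum>i<n. f (\<omega> i)\<bar> \<le> (\<Sum>i<n. b)"
    by (rule order_trans[OF sum_abs sum_mono]) (use b \<omega> in auto)
  then have "\<bar>(\<Sum>i<n. f (\<omega> i)) / n\<bar> \<le> b" using n by (simp add: abs_divide pos_divide_le_eq mult.commute)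
  then show ?thesis using abs_integral_prob_measures_on_le[OF \<mu> f b] unfolding emp_dev_def by linarith
qed

lemma emp_dev_add:
  assumes "integrable \<mu> f" "integrable \<mu> g"
  shows "emp_dev n \<mu> (\<lambda>x. f x + g x) \<omega> = emp_dev n \<mu> f \<omega> + emp_dev n \<mu> g \<omega>"
  using assms unfolding emp_dev_def by (simp add: sum.distrib add_divide_distrib)

lemma emp_dev_sum:
  assumes "\<And>k. k \<in> K \<Longrightarrow> integrable \<mu> (f k)"
  shows "emp_dev n \<mu> (\<lambda>x. \<Sum>k\<in>K. f k x) \<omega> = (\<Sum>k\<in>K. emp_dev n \<mu> (f k) \<omega>)"
proof -
  have "(\<Sum>i<n. \<Sum>k\<in>K. f k (\<omega> i)) = (\<Sum>k\<in>K. \<Sum>i<n. f k (\<omega> i))" by (rule sum.swap)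
  then show ?thesis using assms unfolding emp_dev_def by (simp add: sum_subtractf sum_divide_distrib)
qed

text \<open>The threshold is \<open>sqrt D > 4\<close>: then the weights grow geometrically up to
  \<open>k = J\<close>. At \<open>D = 16\<close> the left-hand side would be
  \<open>1 / sqrt n\<close> for every \<open>k\<close>, and summation would produce a factor
  \<open>J\<close>, that is, a logarithm.\<close>

lemma chaining_weight:
  fixes D :: real
  assumes D: "D \<ge> 32" and n: "D ^ J \<le> real n" and k: "k \<le> J"
  shows "sqrt (D ^ k / n) / 4 ^ k \<le> (3 / 4) ^ (J - k) / 4 ^ J"
proof -
  have D0: "D > 0" using D by simp
  have DJ: "D ^ J > 0" using D0 by simp
  then have "real n > 0" using n by linarith
  with n DJ D0 have "D ^ k / n \<le> D ^ k / D ^ J" by (intro divide_left_mono mult_pos_pos) auto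
  also have "\<dots> = (1 / D) ^ (J - k)" using D0 k by (simp add: power_diff power_one_over field_simps)
  \<comment> \<open>1/32 = 8/256 is enlarged to the perfect square 9/256; its root 3/16 is still
    below 1/4 and leaves the ratio 3/4.\<close>
  also have "\<dots> \<le> (9 / 256) ^ (J - k)" using D by (intro power_mono) (auto simp: field_simps)
  also have "\<dots> = ((3 / 16) ^ (J - k))\<^sup>2" by (simp add: power2_eq_square flip: power_mult_distrib)
  finally have "sqrt (D ^ k / n) \<le> sqrt (((3 / 16) ^ (J - k))\<^sup>2)" by (rule real_sqrt_le_mono)
  then have "sqrt (D ^ k / n) \<le> (3 / 16) ^ (J - k)" by simp
  then have "sqrt (D ^ k / n) / 4 ^ k \<le> (3 / 16) ^ (J - k) / 4 ^ k" by (rule divide_right_mono) simp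
  also have "\<dots> = (3 / 4) ^ (J - k) / (4 ^ (J - k) * 4 ^ k)"
  proof -
    have "(3 / 16 :: real) ^ (J - k) = (3 / 4) ^ (J - k) / 4 ^ (J - k)" by (simp flip: power_divide)
    then show ?thesis by (simp only: divide_divide_eq_left)
  qed
  also have "4 ^ (J - k) * 4 ^ k = (4 ^ J :: real)" using k by (simp flip: power_add)
  finally show ?thesis .
qed

lemma sum_geometric_le: "(\<Sum>k\<le>J. (3 / 4 :: real) ^ (J - k)) \<le> 4"
proof -
  have "(\<Sum>k\<le>J. (3 / 4 :: real) ^ (J - k)) = (\<Sum>k\<le>J. (3 / 4 :: real) ^ k)"
    by (rule sum.reindex_bij_witness[of _ "\<lambda>k. J - k" "\<lambda>k. J - k"]) auto
  also have "\<dots> \<le> 4" by (simp add: sum_gp0)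
  finally show ?thesis .
qed

text \<open>The telescoping increments between representatives of consecutive levels form finite classes;
  with \<open>D = 2^d\<close> and \<open>d \<ge> 5\<close> the entropy grows slowly enough for the finest level to dominate.\<close>

lemma chaining:
  fixes F :: "('a::topological_space \<Rightarrow> real) set" and code :: "nat \<Rightarrow> ('a \<Rightarrow> real) \<Rightarrow> 'c"
  assumes \<mu>: "\<mu> \<in> prob_measures_on X" and F: "F \<noteq> {}" "F \<subseteq> borel_measurable borel"
    and bound: "\<And>f x. f \<in> F \<Longrightarrow> x \<in> X \<Longrightarrow> \<bar>f x\<bar> \<le> 1"
    and close: "\<And>k f g x. \<lbrakk>k \<le> J; f \<in> F; g \<in> F; code k f = code k g; x \<in> X\<rbrakk> \<Longrightarrow> \<bar>f x - g x\<bar> \<le> B / 4 ^ k"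
    and fin: "\<And>k. k \<le> J \<Longrightarrow> finite (code k ` F)"
    and card: "\<And>k. k \<le> J \<Longrightarrow> real (card (code k ` F)) \<le> exp (A * D ^ k)"
    and A: "A \<ge> 0" and B: "B \<ge> 0" and D: "D \<ge> 32" and n: "D ^ J \<le> real n"
  obtains G where "G \<in> borel_measurable (PiM {..<n} (\<lambda>_. \<mu>))" "\<And>\<omega>. 0 \<le> G \<omega>"
    "\<And>f \<omega>. f \<in> F \<Longrightarrow> (\<And>i. i < n \<Longrightarrow> \<omega> i \<in> X) \<Longrightarrow> \<bar>emp_dev n \<mu> f \<omega>\<bar> \<le> G \<omega>"
    "(\<integral>\<^sup>+\<omega>. ennreal (G \<omega>) \<partial>PiM {..<n} (\<lambda>_. \<mu>))
       \<le> ennreal ((2 * B + 4 * (2 * A + 2 + (1 + 5 * B)\<^sup>2)) / 4 ^ J)"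
proof -
  have ps: "prob_space \<mu>" and sets: "sets \<mu> = sets borel" using \<mu> unfolding prob_measures_on_def by auto
  have "D ^ J > 0" using D by simp
  then have npos: "n > 0" using n by (metis less_le_trans of_nat_0_less_iff)
  interpret P: prob_space "PiM {..<n} (\<lambda>_. \<mu>)" by (intro prob_space_PiM ps)
  \<comment> \<open>The representatives are members of \<open>F\<close>, so they inherit
    measurability and the bound 1.\<close>
  define R where "R k c = (SOME g. g \<in> F \<and> code k g = c)" for k c
  have R: "R k (code k f) \<in> F \<and> code k (R k (code k f)) = code k f" if "f \<in> F" for k f
    unfolding R_def by (rule someI[of _ f]) (use that in simp)
  define step where "step k f = (\<lambda>x. R k (code k f) x - (if k = 0 then 0 else R (k - 1) (code (k - 1) f) x))"
    for k f
  \<comment> \<open>\<open>5 * B\<close> is \<open>B + 4 * B\<close>, from the representatives of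
    levels \<open>k\<close> and \<open>k - 1\<close>; the 1 covers level 0, where the increment is a
    representative itself.\<close>
  define b where "b k = (1 + 5 * B) / 4 ^ k" for k :: nat
  have R_close: "\<bar>R k (code k f) x - f x\<bar> \<le> B / 4 ^ k" if "f \<in> F" "k \<le> J" "x \<in> X" for f k x
    by (rule close) (use R that in auto)
  have step_bound: "\<bar>step k f x\<bar> \<le> b k" if "f \<in> F" "k \<le> J" "x \<in> X" for f k x
  proof (cases k)
    case 0
    have "\<bar>R k (code k f) x\<bar> \<le> 1" by (rule bound) (use R that in auto)
    then show ?thesis using 0 B unfolding step_def b_def by simp
  next
    case (Suc m)
    have "\<bar>R k (code k f) x - f x\<bar> \<le> B / 4 ^ k" "\<bar>R m (code m f) x - f x\<bar> \<le> B / 4 ^ m"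
      by (intro R_close; use that Suc in simp)+
    then have "\<bar>step k f x\<bar> \<le> B / 4 ^ k + B / 4 ^ m" unfolding step_def Suc by simp
    also have "\<dots> = 5 * B / 4 ^ k" unfolding Suc by simp
    also have "\<dots> \<le> b k" unfolding b_def by (intro divide_right_mono) auto
    finally show ?thesis .
  qed
  have step_meas: "step k f \<in> borel_measurable borel" if "f \<in> F" for k f
    unfolding step_def using R[OF that] F(2) by (cases "k = 0") (auto intro!: borel_measurable_diff)
  have step_meas': "step k f \<in> borel_measurable \<mu>" if "f \<in> F" for k f
    using step_meas[OF that] sets by (simp cong: measurable_cong_sets)
  have step_fin: "finite (step k ` F)" and step_card: "real (card (step k ` F)) \<le> exp (2 * A * D ^ k)"
    if k: "k \<le> J" for k
  proof -
    \<comment> \<open>An increment depends only on the pair of consecutive codes, so the exponents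
      add up and \<open>A\<close> doubles. At \<open>k = 0\<close> the number \<open>k - 1\<close>
      is again 0 and the second code is ignored.\<close>
    define h where "h = (\<lambda>(c, c'). \<lambda>x. R k c x - (if k = 0 then 0 else R (k - 1) c' x))"
    have sub: "step k ` F \<subseteq> h ` (code k ` F \<times> code (k - 1) ` F)"
      unfolding step_def h_def by force
    have fin': "finite (code k ` F \<times> code (k - 1) ` F)" using fin k by simp
    then show "finite (step k ` F)" using sub finite_surj by blast
    have "card (step k ` F) \<le> card (code k ` F \<times> code (k - 1) ` F)"
      by (rule surj_card_le[OF fin' sub])
    then have "real (card (step k ` F)) \<le> real (card (code k ` F)) * real (card (code (k - 1) ` F))"
      unfolding card_cartesian_product by (metis of_nat_le_iff of_nat_mult)
    also have "\<dots> \<le> exp (A * D ^ k) * exp (A * D ^ (k - 1))"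
      using card k by (intro mult_mono) auto
    also have "\<dots> \<le> exp (A * D ^ k) * exp (A * D ^ k)"
      using A D by (intro mult_left_mono exp_le_cancel_iff[THEN iffD2] power_increasing) auto
    also have "\<dots> = exp (2 * A * D ^ k)" by (simp flip: exp_add)
    finally show "real (card (step k ` F)) \<le> exp (2 * A * D ^ k)" .
  qed
  define C where "C = 2 * A + 2 + (1 + 5 * B)\<^sup>2"
  have C0: "C \<ge> 0" unfolding C_def using A by simp
  have "\<exists>G. G \<in> borel_measurable (PiM {..<n} (\<lambda>_. \<mu>)) \<and> (\<forall>\<omega>. 0 \<le> G \<omega>) \<and>
      (\<forall>f\<in>F. \<forall>\<omega>. \<bar>emp_dev n \<mu> (step k f) \<omega>\<bar> \<le> G \<omega>) \<and>
      (\<integral>\<^sup>+\<omega>. ennreal (G \<omega>) \<partial>PiM {..<n} (\<lambda>_. \<mu>)) \<le> ennreal (C * ((3 / 4) ^ (J - k) / 4 ^ J))"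
    if k: "k \<le> J" for k
  proof -
    \<comment> \<open>Balances the two terms of \<open>finite_class_deviation\<close>: an entropy of
      order \<open>D ^ k\<close> divided by \<open>l\<close>, against
      \<open>l * (b k)\<^sup>2 / n\<close> with \<open>b k\<close> of order
      \<open>4 ^ (-k)\<close>.\<close>
    define l where "l = 4 ^ k * sqrt (n * D ^ k)"
    have Dk: "D ^ k \<ge> 1" using D by (simp add: one_le_power)
    have l: "l > 0" unfolding l_def using npos Dk by simp
    have ab: "AE x in \<mu>. \<bar>g x\<bar> \<le> b k" if "g \<in> step k ` F" for g
      using AE_prob_measures_on[OF \<mu>] by eventually_elim (use that step_bound k in auto)
    have ne: "step k ` F \<noteq> {}" using F by simp
    have gm: "g \<in> borel_measurable \<mu>" if "g \<in> step k ` F" for g using that step_meas' by auto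
    obtain G where G: "G \<in> borel_measurable (PiM {..<n} (\<lambda>_. \<mu>))" "\<And>\<omega>. 0 \<le> G \<omega>"
      "\<And>f \<omega>. f \<in> step k ` F \<Longrightarrow> \<bar>emp_dev n \<mu> f \<omega>\<bar> \<le> G \<omega>"
      "(\<integral>\<^sup>+\<omega>. ennreal (G \<omega>) \<partial>PiM {..<n} (\<lambda>_. \<mu>))
         \<le> ennreal ((ln (2 * real (card (step k ` F))) + 1) / l + l * (b k)\<^sup>2 / (2 * real n))"
      using finite_class_deviation[OF ps step_fin[OF k] ne gm ab npos l] by blast
    have "(ln (2 * real (card (step k ` F))) + 1) / l + l * (b k)\<^sup>2 / (2 * real n)
        \<le> C * (sqrt (D ^ k / n) / 4 ^ k)"
    proof -
      have c1: "real (card (step k ` F)) \<ge> 1"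
        using step_fin[OF k] ne by (simp add: Suc_leI card_gt_0_iff)
      have "ln (2 * real (card (step k ` F))) \<le> ln 2 + 2 * A * D ^ k"
      proof -
        have "ln (real (card (step k ` F))) \<le> ln (exp (2 * A * D ^ k))"
          using step_card[OF k] c1 by (subst ln_le_cancel_iff) auto
        then show ?thesis using c1 by (subst ln_mult) auto
      qed
      moreover have "ln 2 \<le> (1::real)" using ln_2_less_1 by simp
      ultimately have "ln (2 * real (card (step k ` F))) + 1 \<le> (2 * A + 2) * D ^ k"
        using Dk unfolding distrib_right by linarith
      then have "(ln (2 * real (card (step k ` F))) + 1) / l \<le> (2 * A + 2) * D ^ k / l"
        using l by (intro divide_right_mono) auto
      moreover have "D ^ k / l = sqrt (D ^ k / n) / 4 ^ k"
      proof -
        have "D ^ k / l = sqrt (D ^ k) * sqrt (D ^ k) / (4 ^ k * (sqrt n * sqrt (D ^ k)))"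
          unfolding l_def real_sqrt_mult using Dk by simp
        also have "\<dots> = sqrt (D ^ k) / sqrt n / 4 ^ k"
        proof -
          have "p * p / (4 ^ k * (sqrt n * p)) = p / sqrt n / 4 ^ k" if "p > 0" for p
            using that by simp
          moreover have "sqrt (D ^ k) > 0" using Dk by simp
          ultimately show ?thesis by blast
        qed
        finally show ?thesis by (simp only: real_sqrt_divide)
      qed
      moreover have "l * (b k)\<^sup>2 / (2 * real n) = (1 + 5 * B)\<^sup>2 / 2 * (sqrt (D ^ k / n) / 4 ^ k)"
      proof -
        have "l / n = 4 ^ k * (sqrt n * sqrt (D ^ k)) / (sqrt n * sqrt n)"
          unfolding l_def real_sqrt_mult by simp
        also have "\<dots> = 4 ^ k * (sqrt (D ^ k) / sqrt n)"
        proof -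
          have "4 ^ k * (q * p) / (q * q) = 4 ^ k * (p / q)" if "q > 0" for p q :: real
            using that by simp
          moreover have "sqrt n > 0" using npos by simp
          ultimately show ?thesis by blast
        qed
        finally have "l / n = 4 ^ k * sqrt (D ^ k / n)" by (simp only: real_sqrt_divide)
        moreover have "l * (b k)\<^sup>2 / (2 * real n) = (l / n) * (b k)\<^sup>2 / 2" by simp
        ultimately have "l * (b k)\<^sup>2 / (2 * real n) = (4 ^ k * sqrt (D ^ k / n)) * (b k)\<^sup>2 / 2"
          by simp
        also have "\<dots> = (1 + 5 * B)\<^sup>2 / 2 * (sqrt (D ^ k / n) / 4 ^ k)"
          unfolding b_def by (simp add: power_divide power2_eq_square mult.commute)
        finally show ?thesis .
      qed
      ultimately have "(ln (2 * real (card (step k ` F))) + 1) / l + l * (b k)\<^sup>2 / (2 * real n)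
          \<le> (2 * A + 2) * (sqrt (D ^ k / n) / 4 ^ k) + (1 + 5 * B)\<^sup>2 / 2 * (sqrt (D ^ k / n) / 4 ^ k)"
        by (simp add: times_divide_eq_right[symmetric] del: times_divide_eq_right)
      also have "\<dots> \<le> C * (sqrt (D ^ k / n) / 4 ^ k)"
        unfolding C_def distrib_right[symmetric] using Dk by (intro mult_right_mono) auto
      finally show ?thesis .
    qed
    also have "\<dots> \<le> C * ((3 / 4) ^ (J - k) / 4 ^ J)"
      by (intro mult_left_mono chaining_weight D n k C0)
    finally show ?thesis using G by (intro exI[of _ G]) (auto intro: order_trans ennreal_leI)
  qed
  then obtain G where G: "\<And>k. k \<le> J \<Longrightarrow> G k \<in> borel_measurable (PiM {..<n} (\<lambda>_. \<mu>))"
      "\<And>k \<omega>. k \<le> J \<Longrightarrow> 0 \<le> G k \<omega>"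
      "\<And>k f \<omega>. k \<le> J \<Longrightarrow> f \<in> F \<Longrightarrow> \<bar>emp_dev n \<mu> (step k f) \<omega>\<bar> \<le> G k \<omega>"
      "\<And>k. k \<le> J \<Longrightarrow> (\<integral>\<^sup>+\<omega>. ennreal (G k \<omega>) \<partial>PiM {..<n} (\<lambda>_. \<mu>)) \<le> ennreal (C * ((3 / 4) ^ (J - k) / 4 ^ J))"
    by metis
  \<comment> \<open>The chain stops at level \<open>J\<close>: on \<open>X\<close> the remainder is
    at most \<open>B / 4 ^ J\<close>, so its empirical deviation is at most twice that.\<close>
  define H where "H \<omega> = 2 * (B / 4 ^ J) + (\<Sum>k\<le>J. G k \<omega>)" for \<omega>
  show thesis
  proof (rule that[of H])
    show "H \<in> borel_measurable (PiM {..<n} (\<lambda>_. \<mu>))"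
      unfolding H_def using G(1) by (intro borel_measurable_add borel_measurable_sum) auto
    show "0 \<le> H \<omega>" for \<omega> unfolding H_def using G(2) B by (intro add_nonneg_nonneg sum_nonneg) auto
    show "\<bar>emp_dev n \<mu> f \<omega>\<bar> \<le> H \<omega>" if f: "f \<in> F" and \<omega>: "\<And>i. i < n \<Longrightarrow> \<omega> i \<in> X" for f \<omega>
    proof -
      let ?r = "\<lambda>x. f x - R J (code J f) x"
      have tele: "(\<Sum>k\<le>m. step k f x) = R m (code m f) x" for m x
        by (induction m) (auto simp: step_def)
      have r_bound: "\<bar>?r x\<bar> \<le> B / 4 ^ J" if "x \<in> X" for x using R_close[OF f order_refl that] by linarith
      have r_meas: "?r \<in> borel_measurable borel"
        using f R[OF f] F(2) by (intro borel_measurable_diff) auto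
      have int_r: "integrable \<mu> ?r" by (rule integrable_prob_measures_on[OF \<mu> r_meas r_bound])
      have int_s: "integrable \<mu> (step k f)" if "k \<le> J" for k
        by (rule integrable_prob_measures_on[OF \<mu> step_meas[OF f] step_bound[OF f that]])
      have "emp_dev n \<mu> f \<omega> = emp_dev n \<mu> (\<lambda>x. ?r x + (\<Sum>k\<le>J. step k f x)) \<omega>"
        unfolding tele by simp
      also have "\<dots> = emp_dev n \<mu> ?r \<omega> + (\<Sum>k\<le>J. emp_dev n \<mu> (step k f) \<omega>)"
      proof -
        have "emp_dev n \<mu> (\<lambda>x. \<Sum>k\<le>J. step k f x) \<omega> = (\<Sum>k\<le>J. emp_dev n \<mu> (step k f) \<omega>)"
          by (rule emp_dev_sum) (use int_s in auto)
        moreover have "integrable \<mu> (\<lambda>x. \<Sum>k\<le>J. step k f x)" using int_s by auto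
        ultimately show ?thesis using emp_dev_add[OF int_r] by simp
      qed
      finally have "\<bar>emp_dev n \<mu> f \<omega>\<bar> \<le> \<bar>emp_dev n \<mu> ?r \<omega>\<bar> + (\<Sum>k\<le>J. \<bar>emp_dev n \<mu> (step k f) \<omega>\<bar>)"
        using sum_abs[of "\<lambda>k. emp_dev n \<mu> (step k f) \<omega>" "{..J}"] by linarith
      also have "\<dots> \<le> 2 * (B / 4 ^ J) + (\<Sum>k\<le>J. G k \<omega>)"
        using G(3) f by (intro add_mono sum_mono abs_emp_dev_le[OF \<mu> r_meas r_bound npos \<omega>]) auto
      finally show ?thesis unfolding H_def .
    qed
    have "(\<integral>\<^sup>+\<omega>. ennreal (H \<omega>) \<partial>PiM {..<n} (\<lambda>_. \<mu>))
        = (\<integral>\<^sup>+\<omega>. ennreal (2 * (B / 4 ^ J)) + (\<Sum>k\<le>J. ennreal (G k \<omega>)) \<partial>PiM {..<n} (\<lambda>_. \<mu>))"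
    proof (intro nn_integral_cong)
      fix \<omega>
      have "ennreal (H \<omega>) = ennreal (2 * (B / 4 ^ J)) + ennreal (\<Sum>k\<le>J. G k \<omega>)"
        unfolding H_def using G(2) B by (intro ennreal_plus sum_nonneg) auto
      also have "ennreal (\<Sum>k\<le>J. G k \<omega>) = (\<Sum>k\<le>J. ennreal (G k \<omega>))"
        using G(2) by (intro sum_ennreal[symmetric]) auto
      finally show "ennreal (H \<omega>) = ennreal (2 * (B / 4 ^ J)) + (\<Sum>k\<le>J. ennreal (G k \<omega>))" .
    qed
    also have "\<dots> = ennreal (2 * (B / 4 ^ J)) + (\<Sum>k\<le>J. \<integral>\<^sup>+\<omega>. ennreal (G k \<omega>) \<partial>PiM {..<n} (\<lambda>_. \<mu>))"
    proof -
      have m: "(\<lambda>\<omega>. ennreal (G k \<omega>)) \<in> borel_measurable (PiM {..<n} (\<lambda>_. \<mu>))" if "k \<in> {..J}" for k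
        using G(1)[of k] that by simp
      have "(\<lambda>\<omega>. \<Sum>k\<le>J. ennreal (G k \<omega>)) \<in> borel_measurable (PiM {..<n} (\<lambda>_. \<mu>))"
        by (rule borel_measurable_sum[OF m])
      then show ?thesis
        using nn_integral_sum[of "{..J}" "\<lambda>k \<omega>. ennreal (G k \<omega>)", OF m]
        by (subst nn_integral_add) (auto simp: P.emeasure_space_1)
    qed
    also have "\<dots> \<le> ennreal (2 * (B / 4 ^ J)) + (\<Sum>k\<le>J. ennreal (C * ((3 / 4) ^ (J - k) / 4 ^ J)))"
      using G(4) by (intro add_mono sum_mono) auto
    also have "\<dots> = ennreal (2 * (B / 4 ^ J) + (\<Sum>k\<le>J. C * ((3 / 4) ^ (J - k) / 4 ^ J)))"
    proof -
      have "(\<Sum>k\<le>J. ennreal (C * ((3 / 4) ^ (J - k) / 4 ^ J))) = ennreal (\<Sum>k\<le>J. C * ((3 / 4) ^ (J - k) / 4 ^ J))"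
        using C0 by (intro sum_ennreal) auto
      then show ?thesis using C0 B by (simp only:) (intro ennreal_plus[symmetric] sum_nonneg; simp)
    qed
    also have "\<dots> \<le> ennreal ((2 * B + 4 * C) / 4 ^ J)"
    proof (rule ennreal_leI)
      have "(\<Sum>k\<le>J. C * ((3 / 4) ^ (J - k) / 4 ^ J)) = C / 4 ^ J * (\<Sum>k\<le>J. (3 / 4) ^ (J - k))"
        by (simp add: sum_distrib_left)
      also have "\<dots> \<le> C / 4 ^ J * 4" using C0 by (intro mult_left_mono sum_geometric_le) auto
      finally show "2 * (B / 4 ^ J) + (\<Sum>k\<le>J. C * ((3 / 4) ^ (J - k) / 4 ^ J)) \<le> (2 * B + 4 * C) / 4 ^ J"
        by (simp add: add_divide_distrib mult.commute)
    qed
    finally show "(\<integral>\<^sup>+\<omega>. ennreal (H \<omega>) \<partial>PiM {..<n} (\<lambda>_. \<mu>))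
       \<le> ennreal ((2 * B + 4 * (2 * A + 2 + (1 + 5 * B)\<^sup>2)) / 4 ^ J)" unfolding C_def .
  qed
qed

section \<open>Duality for finite assignments\<close>

fun walk_weight :: "('i \<Rightarrow> 'i \<Rightarrow> real) \<Rightarrow> 'i list \<Rightarrow> real" where
  "walk_weight w (x # y # ys) = w x y + walk_weight w (y # ys)"
| "walk_weight w _ = 0"

text \<open>The vertex at the cut ends one piece and starts the other, so no edge is lost.\<close>

lemma walk_weight_append:
  "walk_weight w (xs @ a # ys) = walk_weight w (xs @ [a]) + walk_weight w (a # ys)"
proof (induction xs rule: induct_list012)
  case (3 x y zs)
  then show ?case by simp
next
  case (2 x)
  then show ?case by simp
qed simp

lemma walk_weight_map2:
  "walk_weight w (x # xs @ [y]) = sum_list (map2 w (x # xs) (xs @ [y]))"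
  by (induction xs arbitrary: x) auto

text \<open>A closed walk without repeated vertices has the weight of the cyclic permutation along
  it. At a repeated vertex the walk splits into two shorter closed walks.\<close>

lemma closed_walk_nonneg:
  assumes perm: "\<And>\<tau>. \<tau> permutes I \<Longrightarrow> 0 \<le> (\<Sum>i\<in>I. w i (\<tau> i))"
    and diag: "\<And>i. i \<in> I \<Longrightarrow> w i i = 0" and fin: "finite I"
    and xs: "xs \<noteq> []" "set xs \<subseteq> I"
  shows "0 \<le> walk_weight w (xs @ [hd xs])"
  using xs
proof (induction "length xs" arbitrary: xs rule: less_induct)
  case less
  show ?case
  proof (cases "distinct xs")
    case True
    let ?\<tau> = "cycle_of_list xs"
    obtain x ys where xs: "xs = x # ys" using less.prems by (cases xs) auto
    have rot: "map ?\<tau> xs = ys @ [x]" using cyclic_rotation[OF True, of 1] xs by simp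
    have "walk_weight w (xs @ [hd xs]) = sum_list (map2 w xs (map ?\<tau> xs))"
      unfolding rot using walk_weight_map2[of w x ys x] xs by simp
    also have "map2 w xs (map ?\<tau> xs) = map (\<lambda>i. w i (?\<tau> i)) xs"
      by (simp add: map_zip_map2 zip_map2 zip_same_conv_map case_prod_unfold)
    also have "sum_list (map (\<lambda>i. w i (?\<tau> i)) xs) = (\<Sum>i\<in>set xs. w i (?\<tau> i))"
      using True by (rule sum_list_distinct_conv_sum_set)
    \<comment> \<open>Off the cycle the permutation fixes \<open>i\<close>, and loops have weight
      0.\<close>
    also have "\<dots> = (\<Sum>i\<in>I. w i (?\<tau> i))"
      using less.prems diag fin by (intro sum.mono_neutral_left) (auto simp: id_outside_supp)
    also have "\<dots> \<ge> 0" using perm permutes_subset[OF cycle_permutes less.prems(2)] by blast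
    finally show ?thesis .
  next
    case False
    then obtain us vs ts a where xs: "xs = us @ [a] @ vs @ [a] @ ts"
      using not_distinct_decomp by blast
    have "walk_weight w (xs @ [hd xs])
        = walk_weight w (us @ [a]) + (walk_weight w (a # vs @ [a]) + walk_weight w (a # ts @ [hd xs]))"
      unfolding xs using walk_weight_append[of w us a "vs @ a # ts @ [hd xs]"]
        walk_weight_append[of w "a # vs" a "ts @ [hd xs]"] xs by simp
    also have "\<dots> = walk_weight w ((a # vs) @ [hd (a # vs)])
        + walk_weight w ((us @ a # ts) @ [hd (us @ a # ts)])"
    proof -
      have "hd (us @ a # ts) = hd xs" unfolding xs by (cases us) auto
      then show ?thesis using walk_weight_append[of w us a "ts @ [hd xs]"] by simp
    qed
    also have "\<dots> \<ge> 0"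
      using less.hyps[of "a # vs"] less.hyps[of "us @ a # ts"] less.prems unfolding xs by simp
    finally show ?thesis .
  qed
qed

text \<open>Shortest-path distances to a root exist because optimality of the identity rules out
  negative cycles.\<close>

lemma optimal_assignment_potential:
  fixes c :: "'i \<Rightarrow> 'i \<Rightarrow> real"
  assumes fin: "finite I"
    and opt: "\<And>\<tau>. \<tau> permutes I \<Longrightarrow> (\<Sum>i\<in>I. c i i) \<le> (\<Sum>i\<in>I. c i (\<tau> i))"
  obtains a where "\<And>i j. i \<in> I \<Longrightarrow> j \<in> I \<Longrightarrow> a i - a j \<le> c i j - c j j"
proof (cases "I = {}")
  case True
  then show thesis using that by blast
next
  case False
  then obtain r where r: "r \<in> I" by blast
  \<comment> \<open>Summed over a permutation, the subtracted terms give the cost of the identity,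
    so optimality says that every permutation has nonnegative weight.\<close>
  define w where "w i j = c i j - c j j" for i j
  have closed: "0 \<le> walk_weight w (xs @ [hd xs])" if "xs \<noteq> []" "set xs \<subseteq> I" for xs
  proof (rule closed_walk_nonneg[OF _ _ fin that])
    fix \<tau> assume \<tau>: "\<tau> permutes I"
    have "(\<Sum>i\<in>I. c (\<tau> i) (\<tau> i)) = (\<Sum>i\<in>I. c i i)"
      using sum.permute[OF \<tau>, of "\<lambda>i. c i i"] by (simp add: o_def)
    then show "0 \<le> (\<Sum>i\<in>I. w i (\<tau> i))" using opt[OF \<tau>] unfolding w_def by (simp add: sum_subtractf)
  qed (simp add: w_def)
  define a where "a i = (INF zs\<in>lists I. walk_weight w (i # zs @ [r]))" for i
  have bdd: "bdd_below ((\<lambda>zs. walk_weight w (i # zs @ [r])) ` lists I)" if i: "i \<in> I" for i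
  \<comment> \<open>The edge from \<open>r\<close> back to \<open>i\<close> closes the walk, and
    closed walks have nonnegative weight.\<close>
  proof (rule bdd_belowI2[where m="- w r i"])
    fix zs assume "zs \<in> lists I"
    then have "0 \<le> walk_weight w ((i # zs @ [r]) @ [i])" using closed[of "i # zs @ [r]"] i r by auto
    moreover have "walk_weight w ((i # zs @ [r]) @ [i]) = walk_weight w (i # zs @ [r]) + w r i"
      using walk_weight_append[of w "i # zs" r "[i]"] by simp
    ultimately show "- w r i \<le> walk_weight w (i # zs @ [r])" by simp
  qed
  have "a i - w i j \<le> a j" if ij: "i \<in> I" "j \<in> I" for i j
    unfolding a_def[of j]
  proof (rule cINF_greatest)
    fix zs assume zs: "zs \<in> lists I"
    have "a i \<le> walk_weight w (i # (j # zs) @ [r])"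
      unfolding a_def by (rule cINF_lower[OF bdd[OF ij(1)]]) (use zs ij in simp)
    then show "a i - w i j \<le> walk_weight w (j # zs @ [r])" by simp
  qed auto
  then have "a i - a j \<le> c i j - c j j" if "i \<in> I" "j \<in> I" for i j
    using that unfolding w_def by (simp add: algebra_simps)
  then show thesis using that by blast
qed

section \<open>Assignment cost and dual pairs\<close>

definition assignment_cost :: "('a \<Rightarrow> 'b \<Rightarrow> real) \<Rightarrow> nat \<Rightarrow> (nat \<Rightarrow> 'a) \<Rightarrow> (nat \<Rightarrow> 'b) \<Rightarrow> real" where
  "assignment_cost c n x y = Min ((\<lambda>\<sigma>. (\<Sum>i<n. c (x i) (y (\<sigma> i))) / n) ` {\<sigma>. \<sigma> permutes {..<n}})"

lemma assignment_cost_le: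
  assumes "\<sigma> permutes {..<n}"
  shows "assignment_cost c n x y \<le> (\<Sum>i<n. c (x i) (y (\<sigma> i))) / n"
  unfolding assignment_cost_def using assms by (intro Min_le) (auto simp: finite_permutations)

lemma assignment_cost_attained:
  obtains \<sigma> where "\<sigma> permutes {..<n}" "assignment_cost c n x y = (\<Sum>i<n. c (x i) (y (\<sigma> i))) / n"
proof -
  have "assignment_cost c n x y \<in> (\<lambda>\<sigma>. (\<Sum>i<n. c (x i) (y (\<sigma> i))) / n) ` {\<sigma>. \<sigma> permutes {..<n}}"
    unfolding assignment_cost_def
    by (rule Min_in) (auto simp: finite_permutations intro: permutes_id)
  then show thesis using that by blast
qed

text \<open>Feasible dual pairs whose increments are dominated, up to \<open>\<epsilon>\<close>, by
  increments of the cost against a single point of the other side. The last two clauses pass upper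
  tangents of the cost on to the potentials; \<open>\<epsilon>\<close> stands in for attainment of
  infima. The common bound 1 lets one scaling serve all pairs.\<close>

definition semidual_pair ::
    "('a::topological_space \<Rightarrow> 'b::topological_space \<Rightarrow> real) \<Rightarrow> 'a set \<Rightarrow> 'b set \<Rightarrow> ('a \<Rightarrow> real) \<Rightarrow> ('b \<Rightarrow> real) \<Rightarrow> bool"
  where "semidual_pair c X Y \<phi> \<psi> \<longleftrightarrow>
     \<phi> \<in> borel_measurable borel \<and> \<psi> \<in> borel_measurable borel \<and>
     (\<forall>x\<in>X. \<bar>\<phi> x\<bar> \<le> 1) \<and> (\<forall>y\<in>Y. \<bar>\<psi> y\<bar> \<le> 1) \<and> (\<forall>x\<in>X. \<forall>y\<in>Y. \<phi> x + \<psi> y \<le> c x y) \<and>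
     (\<forall>x0\<in>X. \<forall>\<epsilon>>0. \<exists>y\<in>Y. \<forall>x\<in>X. \<phi> x - \<phi> x0 \<le> c x y - c x0 y + \<epsilon>) \<and>
     (\<forall>y0\<in>Y. \<forall>\<epsilon>>0. \<exists>x\<in>X. \<forall>y\<in>Y. \<psi> y - \<psi> y0 \<le> c x y - c x y0 + \<epsilon>)"

text \<open>The infimum is upper semicontinuous: its strict sublevel sets are unions of open sets,
  even for uncountable \<open>I\<close>.\<close>

lemma borel_measurable_INF_continuous:
  fixes f :: "'i \<Rightarrow> 'b::topological_space \<Rightarrow> real"
  assumes I: "I \<noteq> {}" and cont: "\<And>i. i \<in> I \<Longrightarrow> continuous_on UNIV (f i)"
    and bdd: "\<And>y. bdd_below ((\<lambda>i. f i y) ` I)"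
  shows "(\<lambda>y. INF i\<in>I. f i y) \<in> borel_measurable borel"
proof (rule borel_measurableI_less)
  fix a
  have "{y. (INF i\<in>I. f i y) < a} = (\<Union>i\<in>I. {y. f i y < a})"
    using cINF_less_iff[OF I bdd] by auto
  moreover have "open (\<Union>i\<in>I. {y. f i y < a})"
    using cont by (intro open_UN ballI open_Collect_less) (auto intro: continuous_on_const)
  ultimately show "{y \<in> space borel. (INF i\<in>I. f i y) < a} \<in> sets borel" by simp
qed

text \<open>The potential of the optimal permutation prices the sample points. The prices extend to
  all points by letting \<open>\<phi>\<close> be a minimum over the sampled targets and
  \<open>\<psi>\<close> its c-transform over the whole of \<open>X\<close>, which makes the pair
  feasible beyond the sample without lowering its value on the sample.\<close>

lemma semidual_pair_exists:
  fixes c :: "'a::topological_space \<Rightarrow> 'b::topological_space \<Rightarrow> real"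
  assumes contx: "\<And>y. continuous_on UNIV (\<lambda>x. c x y)" and conty: "\<And>x. continuous_on UNIV (c x)"
    and c0: "\<And>x y. 0 \<le> c x y" and c1: "\<And>x y. x \<in> X \<Longrightarrow> y \<in> Y \<Longrightarrow> c x y \<le> 1"
    and n: "n > 0" and x: "\<And>i. i < n \<Longrightarrow> x i \<in> X" and y: "\<And>i. i < n \<Longrightarrow> y i \<in> Y"
  obtains \<phi> \<psi> where "semidual_pair c X Y \<phi> \<psi>"
    "assignment_cost c n x y \<le> (\<Sum>i<n. \<phi> (x i)) / n + (\<Sum>i<n. \<psi> (y i)) / n"
proof -
  obtain \<sigma> where \<sigma>: "\<sigma> permutes {..<n}" and opt: "assignment_cost c n x y = (\<Sum>i<n. c (x i) (y (\<sigma> i))) / n"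
    by (rule assignment_cost_attained)
  \<comment> \<open>Relabelling the targets makes the identity an optimal permutation.\<close>
  define y' where "y' i = y (\<sigma> i)" for i
  have y': "y' i \<in> Y" if "i < n" for i
    unfolding y'_def using y permutes_in_image[OF \<sigma>, of i] that by simp
  have "(\<Sum>i<n. c (x i) (y' i)) \<le> (\<Sum>i<n. c (x i) (y' (\<tau> i)))" if \<tau>: "\<tau> permutes {..<n}" for \<tau>
  proof -
    have "assignment_cost c n x y \<le> (\<Sum>i<n. c (x i) (y ((\<sigma> \<circ> \<tau>) i))) / n"
      by (rule assignment_cost_le[OF permutes_compose[OF \<tau> \<sigma>]])
    then show ?thesis using n unfolding opt y'_def by (simp add: divide_le_cancel)
  qed
  then obtain a where a: "\<And>i j. i < n \<Longrightarrow> j < n \<Longrightarrow> a i - a j \<le> c (x i) (y' j) - c (x j) (y' j)"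
    using optimal_assignment_potential[of "{..<n}" "\<lambda>i j. c (x i) (y' j)"] by auto
  \<comment> \<open>The shift makes every \<open>b j\<close> at most 0, with equality for some
    \<open>m\<close>: the former gives \<open>0 \<le> \<phi>\<close>, the latter
    \<open>\<phi> \<le> 1\<close> on \<open>X\<close>.\<close>
  define t where "t = Max ((\<lambda>j. c (x j) (y' j) - a j) ` {..<n})"
  define b where "b j = c (x j) (y' j) - a j - t" for j
  have b0: "b j \<le> 0" if "j < n" for j
    unfolding b_def t_def using that by (simp add: Max_ge)
  have "t \<in> (\<lambda>j. c (x j) (y' j) - a j) ` {..<n}" unfolding t_def using n by (intro Max_in) auto
  then obtain m where m: "m < n" "b m = 0" unfolding b_def by auto
  define \<phi> where "\<phi> z = Min ((\<lambda>j. c z (y' j) - b j) ` {..<n})" for z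
  define \<psi> where "\<psi> w = (INF z\<in>X. c z w - \<phi> z)" for w
  have \<phi>_le: "\<phi> z \<le> c z (y' j) - b j" if "j < n" for z j
    unfolding \<phi>_def using that by (intro Min_le) auto
  have \<phi>_att: "\<exists>j<n. \<phi> z = c z (y' j) - b j" for z
  proof -
    have "\<phi> z \<in> (\<lambda>j. c z (y' j) - b j) ` {..<n}" unfolding \<phi>_def using n by (intro Min_in) auto
    then show ?thesis by auto
  qed
  have \<phi>_0: "0 \<le> \<phi> z" for z using \<phi>_att[of z] c0 b0 by (smt (verit))
  have \<phi>_1: "\<phi> z \<le> 1" if "z \<in> X" for z
    using \<phi>_le[OF m(1), of z] m c1[OF that y'[OF m(1)]] by simp
  have \<phi>_x: "a i + t \<le> \<phi> (x i)" if i: "i < n" for i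
  proof -
    obtain j where "j < n" "\<phi> (x i) = c (x i) (y' j) - b j" using \<phi>_att by blast
    then show ?thesis using a[OF i, of j] unfolding b_def by simp
  qed
  have Xne: "X \<noteq> {}" using x n by blast
  have bdd: "bdd_below ((\<lambda>z. c z w - \<phi> z) ` X)" for w
  proof (rule bdd_belowI2[where m="-1"])
    fix z assume "z \<in> X"
    then show "-1 \<le> c z w - \<phi> z" using \<phi>_1[of z] c0[of z w] by linarith
  qed
  have \<psi>_le: "\<psi> w \<le> c z w - \<phi> z" if "z \<in> X" for z w
    unfolding \<psi>_def by (rule cINF_lower[OF bdd that])
  have \<psi>_y: "b j \<le> \<psi> (y' j)" if "j < n" for j
    unfolding \<psi>_def using \<phi>_le[OF that] by (intro cINF_greatest[OF Xne]) (simp add: algebra_simps)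
  have \<psi>_lo: "-1 \<le> \<psi> w" for w
    unfolding \<psi>_def
  proof (rule cINF_greatest[OF Xne])
    fix z assume "z \<in> X"
    then show "-1 \<le> c z w - \<phi> z" using \<phi>_1[of z] c0[of z w] by linarith
  qed
  show thesis
  proof (rule that[of \<phi> \<psi>])
    show "semidual_pair c X Y \<phi> \<psi>" unfolding semidual_pair_def
    proof (intro conjI ballI allI impI)
      have mc: "(\<lambda>z. c z w) \<in> borel_measurable borel" for w
        by (rule borel_measurable_continuous_onI[OF contx])
      then show "\<phi> \<in> borel_measurable borel" unfolding \<phi>_def
        by (intro borel_measurable_Min borel_measurable_diff) auto
      show "\<psi> \<in> borel_measurable borel" unfolding \<psi>_def
        by (intro borel_measurable_INF_continuous Xne bdd continuous_on_diff conty continuous_on_const)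
      show "\<bar>\<phi> z\<bar> \<le> 1" if "z \<in> X" for z using \<phi>_0[of z] \<phi>_1[OF that] by linarith
      show "\<bar>\<psi> w\<bar> \<le> 1" if w: "w \<in> Y" for w
      proof -
        obtain z where z: "z \<in> X" using Xne by blast
        show ?thesis using \<psi>_lo[of w] \<psi>_le[OF z, of w] c1[OF z w] \<phi>_0[of z] by linarith
      qed
      show "\<phi> z + \<psi> w \<le> c z w" if "z \<in> X" for z w using \<psi>_le[OF that, of w] by linarith
      show "\<exists>w\<in>Y. \<forall>z\<in>X. \<phi> z - \<phi> z0 \<le> c z w - c z0 w + \<epsilon>" if "\<epsilon> > 0" for z0 and \<epsilon> :: real
      proof -
        obtain j where j: "j < n" "\<phi> z0 = c z0 (y' j) - b j" using \<phi>_att by blast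
        show ?thesis
        proof (intro bexI[of _ "y' j"] ballI y'[OF j(1)])
          fix z show "\<phi> z - \<phi> z0 \<le> c z (y' j) - c z0 (y' j) + \<epsilon>"
            using \<phi>_le[OF j(1), of z] j(2) that by linarith
        qed
      qed
      show "\<exists>z\<in>X. \<forall>w\<in>Y. \<psi> w - \<psi> w0 \<le> c z w - c z w0 + \<epsilon>" if "\<epsilon> > 0" for w0 and \<epsilon> :: real
      proof -
        have "(INF z\<in>X. c z w0 - \<phi> z) < \<psi> w0 + \<epsilon>" using that unfolding \<psi>_def by simp
        then obtain z where z: "z \<in> X" "c z w0 - \<phi> z < \<psi> w0 + \<epsilon>"
          using cINF_less_iff[OF Xne bdd] by blast
        show ?thesis
        proof (intro bexI[of _ z] ballI z(1))
          fix w show "\<psi> w - \<psi> w0 \<le> c z w - c z w0 + \<epsilon>" using \<psi>_le[OF z(1), of w] z(2) by linarith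
        qed
      qed
    qed
    \<comment> \<open>The matched cost splits into the prices \<open>a i + t\<close> and
      \<open>b i\<close>, which \<open>\<phi>\<close> and \<open>\<psi>\<close> dominate at the
      sample points.\<close>
    have "(\<Sum>i<n. c (x i) (y' i)) = (\<Sum>i<n. (a i + t) + b i)" unfolding b_def by simp
    also have "\<dots> \<le> (\<Sum>i<n. \<phi> (x i) + \<psi> (y' i))"
      using \<phi>_x \<psi>_y by (intro sum_mono add_mono) auto
    also have "\<dots> = (\<Sum>i<n. \<phi> (x i)) + (\<Sum>i<n. \<psi> (y i))"
      using sum.permute[OF \<sigma>, of "\<lambda>i. \<psi> (y i)"] unfolding y'_def by (simp add: sum.distrib o_def)
    finally show "assignment_cost c n x y \<le> (\<Sum>i<n. \<phi> (x i)) / n + (\<Sum>i<n. \<psi> (y i)) / n"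
      unfolding opt y'_def[symmetric] add_divide_distrib[symmetric] by (intro divide_right_mono) auto
  qed
qed

section \<open>Transport costs of empirical measures\<close>

lemma integral_empirical:
  fixes f :: "'a::topological_space \<Rightarrow> real"
  assumes "f \<in> borel_measurable borel"
  shows "(\<integral>x. f x \<partial>empirical xs n) = (\<Sum>i<n. f (xs i)) / n"
  unfolding empirical_def using assms
  by (subst integral_distr) (auto simp: integral_uniform_count_measure)

lemma empirical_prob_measures_on:
  assumes n: "n > 0" and x: "\<And>i. i < n \<Longrightarrow> xs i \<in> X" and X: "X \<in> sets borel"
  shows "empirical xs n \<in> prob_measures_on X"
proof -
  interpret U: prob_space "uniform_count_measure {..<n}"
    by (rule prob_space_uniform_count_measure) (use n in auto)
  have m: "xs \<in> measurable (uniform_count_measure {..<n}) borel" by simp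
  have "prob_space (empirical xs n)" unfolding empirical_def by (rule U.prob_space_distr[OF m])
  moreover have "emeasure (empirical xs n) X = 1"
  proof -
    have "xs -` X \<inter> space (uniform_count_measure {..<n}) = space (uniform_count_measure {..<n})"
      using x by (auto simp: space_uniform_count_measure)
    then show ?thesis unfolding empirical_def emeasure_distr[OF m X] by (simp add: U.emeasure_space_1)
  qed
  ultimately show ?thesis unfolding prob_measures_on_def by (simp add: empirical_def)
qed

lemma coupling_fst_snd:
  assumes "\<pi> \<in> couplings \<mu> \<nu>"
  shows "prob_space \<pi>" "sets \<pi> = sets borel" "fst \<in> measurable \<pi> borel" "snd \<in> measurable \<pi> borel"
    "distr \<pi> borel fst = \<mu>" "distr \<pi> borel snd = \<nu>"
proof -
  show "prob_space \<pi>" "distr \<pi> borel fst = \<mu>" "distr \<pi> borel snd = \<nu>"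
    and s: "sets \<pi> = sets borel"
    using assms unfolding couplings_def by auto
  have "fst \<in> measurable borel borel" "snd \<in> measurable borel borel"
    by (intro borel_measurable_continuous_onI continuous_intros)+
  then show "fst \<in> measurable \<pi> borel" "snd \<in> measurable \<pi> borel"
    using s by (simp_all cong: measurable_cong_sets)
qed

lemma coupling_AE:
  assumes \<pi>: "\<pi> \<in> couplings \<mu> \<nu>" and \<mu>: "\<mu> \<in> prob_measures_on X" and \<nu>: "\<nu> \<in> prob_measures_on Y"
    and XY: "X \<in> sets borel" "Y \<in> sets borel"
  shows "AE z in \<pi>. fst z \<in> X \<and> snd z \<in> Y"
proof -
  note c = coupling_fst_snd[OF \<pi>]
  have "AE x in distr \<pi> borel fst. x \<in> X" "AE y in distr \<pi> borel snd. y \<in> Y"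
    using AE_prob_measures_on[OF \<mu>] AE_prob_measures_on[OF \<nu>] c by auto
  then have "AE z in \<pi>. fst z \<in> X" "AE z in \<pi>. snd z \<in> Y"
    using c XY by (auto simp: AE_distr_iff)
  then show ?thesis by eventually_elim simp
qed

locale bounded_cost =
  fixes c :: "'a::euclidean_space \<Rightarrow> 'a \<Rightarrow> real" and X Y :: "'a set"
  assumes contxy: "continuous_on UNIV (\<lambda>z. c (fst z) (snd z))"
    and c0: "\<And>x y. 0 \<le> c x y" and c1: "\<And>x y. x \<in> X \<Longrightarrow> y \<in> Y \<Longrightarrow> c x y \<le> 1"
    and Xm: "X \<in> sets borel" and Ym: "Y \<in> sets borel"
begin

lemma contx: "continuous_on UNIV (\<lambda>x. c x y)"
  using continuous_on_compose2[OF contxy, of UNIV "\<lambda>x. (x, y)"] by (simp add: continuous_intros)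

lemma conty: "continuous_on UNIV (c x)"
  using continuous_on_compose2[OF contxy, of UNIV "\<lambda>y. (x, y)"] by (simp add: continuous_intros)

lemma cost_measurable: "(\<lambda>z. c (fst z) (snd z)) \<in> borel_measurable borel"
  by (rule borel_measurable_continuous_onI[OF contxy])

text \<open>Weak duality, integrated over the coupling. The second bound keeps the infimum in
  \<open>ot_cost\<close> finite.\<close>

lemma integral_le_coupling_cost:
  assumes \<pi>: "\<pi> \<in> couplings \<mu> \<nu>" and \<mu>: "\<mu> \<in> prob_measures_on X" and \<nu>: "\<nu> \<in> prob_measures_on Y"
    and sd: "semidual_pair c X Y \<phi> \<psi>"
  shows "ennreal ((\<integral>x. \<phi> x \<partial>\<mu>) + (\<integral>y. \<psi> y \<partial>\<nu>)) \<le> (\<integral>\<^sup>+z. ennreal (c (fst z) (snd z)) \<partial>\<pi>)"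
    and "(\<integral>\<^sup>+z. ennreal (c (fst z) (snd z)) \<partial>\<pi>) \<le> 1"
proof -
  note k = coupling_fst_snd[OF \<pi>]
  interpret prob_space \<pi> by (rule k(1))
  have ae: "AE z in \<pi>. fst z \<in> X \<and> snd z \<in> Y" by (rule coupling_AE[OF \<pi> \<mu> \<nu> Xm Ym])
  have cm: "(\<lambda>z. c (fst z) (snd z)) \<in> borel_measurable \<pi>"
    using cost_measurable k(2) by (simp cong: measurable_cong_sets)
  have cint: "integrable \<pi> (\<lambda>z. c (fst z) (snd z))"
    by (rule integrable_const_bound[OF _ cm, where B=1])
       (use ae in eventually_elim, use c0 c1 in auto)
  have m: "\<phi> \<in> borel_measurable borel" "\<psi> \<in> borel_measurable borel"
    using sd unfolding semidual_pair_def by auto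
  have b: "\<And>x. x \<in> X \<Longrightarrow> \<bar>\<phi> x\<bar> \<le> 1" "\<And>y. y \<in> Y \<Longrightarrow> \<bar>\<psi> y\<bar> \<le> 1"
    using sd unfolding semidual_pair_def by auto
  have "integrable (distr \<pi> borel fst) \<phi>" "integrable (distr \<pi> borel snd) \<psi>"
    using integrable_prob_measures_on[OF \<mu> m(1) b(1)] integrable_prob_measures_on[OF \<nu> m(2) b(2)] k by auto
  then have i: "integrable \<pi> (\<lambda>z. \<phi> (fst z))" "integrable \<pi> (\<lambda>z. \<psi> (snd z))"
    using k m by (auto simp: integrable_distr_eq)
  have "(\<integral>x. \<phi> x \<partial>\<mu>) + (\<integral>y. \<psi> y \<partial>\<nu>) = (\<integral>z. \<phi> (fst z) \<partial>\<pi>) + (\<integral>z. \<psi> (snd z) \<partial>\<pi>)"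
    using integral_distr[OF k(3) m(1)] integral_distr[OF k(4) m(2)] k by simp
  also have "\<dots> = (\<integral>z. \<phi> (fst z) + \<psi> (snd z) \<partial>\<pi>)" using i by simp
  also have "\<dots> \<le> (\<integral>z. c (fst z) (snd z) \<partial>\<pi>)"
  proof (rule integral_mono_AE)
    show "AE z in \<pi>. \<phi> (fst z) + \<psi> (snd z) \<le> c (fst z) (snd z)"
      using ae by eventually_elim (use sd in \<open>auto simp: semidual_pair_def\<close>)
  qed (use i cint in auto)
  finally show "ennreal ((\<integral>x. \<phi> x \<partial>\<mu>) + (\<integral>y. \<psi> y \<partial>\<nu>)) \<le> (\<integral>\<^sup>+z. ennreal (c (fst z) (snd z)) \<partial>\<pi>)"
    using c0 by (subst nn_integral_eq_integral[OF cint]) (auto intro: ennreal_leI)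
  have "(\<integral>\<^sup>+z. ennreal (c (fst z) (snd z)) \<partial>\<pi>) \<le> (\<integral>\<^sup>+z. 1 \<partial>\<pi>)"
    using ae by (intro nn_integral_mono_AE, eventually_elim) (simp add: c1)
  then show "(\<integral>\<^sup>+z. ennreal (c (fst z) (snd z)) \<partial>\<pi>) \<le> 1" by (simp add: emeasure_space_1)
qed

lemma ot_cost_le:
  assumes "\<pi> \<in> couplings \<mu> \<nu>" "(\<integral>\<^sup>+z. ennreal (c (fst z) (snd z)) \<partial>\<pi>) \<le> ennreal r" "0 \<le> r"
  shows "ot_cost c \<mu> \<nu> \<le> r"
  unfolding ot_cost_def
proof (rule enn2real_leI[OF assms(3)])
  show "(INF \<pi>\<in>couplings \<mu> \<nu>. \<integral>\<^sup>+z. ennreal (c (fst z) (snd z)) \<partial>\<pi>) \<le> ennreal r"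
    by (rule INF_lower2) (rule assms)+
qed

text \<open>\<open>enn2real\<close> sends infinity to 0, so a lower bound needs a finite infimum;
  one coupling, of cost at most 1, provides it.\<close>

lemma ot_cost_ge:
  assumes ne: "couplings \<mu> \<nu> \<noteq> {}" and \<mu>: "\<mu> \<in> prob_measures_on X" and \<nu>: "\<nu> \<in> prob_measures_on Y"
    and sd: "semidual_pair c X Y \<phi> \<psi>"
  shows "(\<integral>x. \<phi> x \<partial>\<mu>) + (\<integral>y. \<psi> y \<partial>\<nu>) \<le> ot_cost c \<mu> \<nu>"
proof -
  let ?I = "INF \<pi>\<in>couplings \<mu> \<nu>. \<integral>\<^sup>+z. ennreal (c (fst z) (snd z)) \<partial>\<pi>"
  obtain \<pi> where \<pi>: "\<pi> \<in> couplings \<mu> \<nu>" using ne by blast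
  have "?I \<le> 1" using integral_le_coupling_cost(2)[OF \<pi> \<mu> \<nu> sd] by (rule INF_lower2[OF \<pi>])
  then have fin: "?I < \<top>" by (rule le_less_trans) simp
  have "ennreal ((\<integral>x. \<phi> x \<partial>\<mu>) + (\<integral>y. \<psi> y \<partial>\<nu>)) \<le> ?I"
    by (rule INF_greatest) (rule integral_le_coupling_cost(1)[OF _ \<mu> \<nu> sd])
  also have "?I = ennreal (enn2real ?I)" using fin by simp
  finally show ?thesis unfolding ot_cost_def
    by (subst (asm) ennreal_le_iff) auto
qed

text \<open>The uniform measure on the indices is invariant under \<open>\<sigma>\<close>, so the
  second marginal is the same for every permutation.\<close>

lemma permutation_coupling:
  fixes x y :: "nat \<Rightarrow> 'a"
  assumes n: "n > 0" and \<sigma>: "\<sigma> permutes {..<n}"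
  defines "\<pi> \<equiv> distr (uniform_count_measure {..<n}) borel (\<lambda>i. (x i, y (\<sigma> i)))"
  shows "\<pi> \<in> couplings (empirical x n) (empirical y n)"
    and "(\<integral>\<^sup>+z. ennreal (c (fst z) (snd z)) \<partial>\<pi>) = ennreal ((\<Sum>i<n. c (x i) (y (\<sigma> i))) / n)"
proof -
  interpret U: prob_space "uniform_count_measure {..<n}"
    by (rule prob_space_uniform_count_measure) (use n in auto)
  have m: "(\<lambda>i. (x i, y (\<sigma> i))) \<in> measurable (uniform_count_measure {..<n}) borel" by simp
  have fs: "fst \<in> measurable (borel :: ('a \<times> 'a) measure) (borel :: 'a measure)"
    "snd \<in> measurable (borel :: ('a \<times> 'a) measure) (borel :: 'a measure)"
    by (intro borel_measurable_continuous_onI continuous_intros)+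
  have "distr \<pi> borel fst = empirical x n"
    unfolding \<pi>_def empirical_def by (subst distr_distr[OF fs(1) m]) (simp add: o_def)
  moreover have "distr \<pi> borel snd = empirical y n"
  proof -
    have "distr \<pi> borel snd = distr (uniform_count_measure {..<n}) borel (y \<circ> \<sigma>)"
      unfolding \<pi>_def by (subst distr_distr[OF fs(2) m]) (simp add: o_def)
    also have "\<dots> = distr (distr (uniform_count_measure {..<n}) (uniform_count_measure {..<n}) \<sigma>) borel y"
      using permutes_in_image[OF \<sigma>]
      by (subst distr_distr) (auto simp: measurable_def space_uniform_count_measure sets_uniform_count_measure Pi_iff)
    also have "distr (uniform_count_measure {..<n}) (uniform_count_measure {..<n}) \<sigma> = uniform_count_measure {..<n}"
    proof (rule measure_eqI)
      fix A assume "A \<in> sets (distr (uniform_count_measure {..<n}) (uniform_count_measure {..<n}) \<sigma>)"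
      then have A: "A \<subseteq> {..<n}" by (simp add: sets_uniform_count_measure)
      have sub: "\<sigma> -` A \<inter> {..<n} \<subseteq> {..<n}" by simp
      have "\<sigma> ` (\<sigma> -` A \<inter> {..<n}) = A"
      proof (intro equalityI subsetI)
        fix a assume "a \<in> A"
        moreover then obtain i where "i \<in> {..<n}" "a = \<sigma> i" using permutes_image[OF \<sigma>] A by blast
        ultimately show "a \<in> \<sigma> ` (\<sigma> -` A \<inter> {..<n})" by blast
      qed auto
      then have "card (\<sigma> -` A \<inter> {..<n}) = card A"
        using card_image[OF inj_on_subset[OF permutes_inj_on[OF \<sigma>] sub]] by simp
      then show "emeasure (distr (uniform_count_measure {..<n}) (uniform_count_measure {..<n}) \<sigma>) A
          = emeasure (uniform_count_measure {..<n}) A"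
        using A permutes_in_image[OF \<sigma>]
        by (subst emeasure_distr)
           (auto simp: measurable_def space_uniform_count_measure sets_uniform_count_measure Pi_iff
              emeasure_uniform_count_measure)
    qed simp
    finally show ?thesis unfolding empirical_def .
  qed
  moreover have "prob_space \<pi>" unfolding \<pi>_def by (rule U.prob_space_distr[OF m])
  ultimately show "\<pi> \<in> couplings (empirical x n) (empirical y n)"
    unfolding couplings_def by (simp add: \<pi>_def)
  have "(\<integral>\<^sup>+z. ennreal (c (fst z) (snd z)) \<partial>\<pi>)
      = (\<integral>\<^sup>+i. ennreal (c (x i) (y (\<sigma> i))) \<partial>uniform_count_measure {..<n})"
    unfolding \<pi>_def by (subst nn_integral_distr[OF m]) (use cost_measurable in auto)
  also have "\<dots> = ennreal ((\<Sum>i<n. c (x i) (y (\<sigma> i))) / n)"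
    unfolding uniform_count_measure_def using c0
    by (subst nn_integral_point_measure_finite)
       (auto simp: ennreal_mult[symmetric] sum_ennreal sum_divide_distrib)
  finally show "(\<integral>\<^sup>+z. ennreal (c (fst z) (snd z)) \<partial>\<pi>) = ennreal ((\<Sum>i<n. c (x i) (y (\<sigma> i))) / n)" .
qed

lemma ot_cost_empirical_le:
  assumes n: "n > 0"
  shows "ot_cost c (empirical x n) (empirical y n) \<le> assignment_cost c n x y"
proof -
  obtain \<sigma> where \<sigma>: "\<sigma> permutes {..<n}" and opt: "assignment_cost c n x y = (\<Sum>i<n. c (x i) (y (\<sigma> i))) / n"
    by (rule assignment_cost_attained)
  have "0 \<le> (\<Sum>i<n. c (x i) (y (\<sigma> i))) / n" using c0 by (intro divide_nonneg_nonneg sum_nonneg) auto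
  then show ?thesis unfolding opt
    using ot_cost_le[OF permutation_coupling(1)[OF n \<sigma>]] permutation_coupling(2)[OF n \<sigma>] by simp
qed

end

section \<open>A coupling of the population measures built from samples\<close>

lemma nn_integral_uniform_count:
  assumes "n > 0"
  shows "(\<integral>\<^sup>+i. f i \<partial>uniform_count_measure {..<n}) = (\<Sum>i<n. f i) / of_nat n"
proof -
  have "(\<integral>\<^sup>+i. f i \<partial>uniform_count_measure {..<n}) = (\<Sum>i<n. ennreal (1 / real n) * f i)"
    unfolding uniform_count_measure_def by (subst nn_integral_point_measure_finite) auto
  also have "\<dots> = ennreal (1 / real n) * (\<Sum>i<n. f i)" by (simp add: sum_distrib_left)
  also have "ennreal (1 / real n) = 1 / of_nat n"
    using assms by (simp add: divide_ennreal[symmetric] ennreal_of_nat_eq_real_of_nat)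
  finally show ?thesis by (simp add: ennreal_times_divide mult.commute)
qed

lemma nn_integral_PiM_component:
  assumes "prob_space \<mu>" "i < n" "f \<in> borel_measurable \<mu>"
  shows "(\<integral>\<^sup>+x. f (x i) \<partial>PiM {..<n} (\<lambda>_. \<mu>)) = (\<integral>\<^sup>+x. f x \<partial>\<mu>)"
proof -
  have "(\<integral>\<^sup>+x. f x \<partial>\<mu>) = (\<integral>\<^sup>+x. f x \<partial>distr (PiM {..<n} (\<lambda>_. \<mu>)) \<mu> (\<lambda>x. x i))"
    using distr_PiM_component[of "{..<n}" "\<lambda>_. \<mu>" i] assms by simp
  also have "\<dots> = (\<integral>\<^sup>+x. f (x i) \<partial>PiM {..<n} (\<lambda>_. \<mu>))"
    by (rule nn_integral_distr) (use assms in auto)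
  finally show ?thesis by simp
qed

text \<open>The coupling draws both samples and a uniform index and returns the pair of points that an
  optimal permutation matches at this index. Averaging over the index makes the second marginal
  independent of the permutation.\<close>

lemma (in bounded_cost) averaged_optimal_coupling:
  assumes \<mu>: "prob_space \<mu>" "sets \<mu> = sets borel" and \<nu>: "prob_space \<nu>" "sets \<nu> = sets borel"
    and n: "n > 0"
  obtains \<pi> where "\<pi> \<in> couplings \<mu> \<nu>"
    "(\<integral>\<^sup>+z. ennreal (c (fst z) (snd z)) \<partial>\<pi>) =
       (\<integral>\<^sup>+\<omega>. ennreal (assignment_cost c n (fst \<omega>) (snd \<omega>))
          \<partial>(PiM {..<n} (\<lambda>_. \<mu>) \<Otimes>\<^sub>M PiM {..<n} (\<lambda>_. \<nu>)))"
proof -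
  let ?Q = "PiM {..<n} (\<lambda>_. \<mu>)" and ?R = "PiM {..<n} (\<lambda>_. \<nu>)" and ?U = "uniform_count_measure {..<n}"
  interpret Q: prob_space ?Q by (intro prob_space_PiM \<mu>)
  interpret R: prob_space ?R by (intro prob_space_PiM \<nu>)
  interpret U: prob_space ?U by (rule prob_space_uniform_count_measure) (use n in auto)
  interpret QR: pair_prob_space ?Q ?R ..
  interpret S: pair_prob_space "?Q \<Otimes>\<^sub>M ?R" ?U ..
  note [measurable_cong] = \<mu>(2) \<nu>(2)
  \<comment> \<open>Enumerating the permutations makes an optimal one measurably selectable:
    \<open>sel\<close> takes the least index of a minimiser.\<close>
  obtain L where L: "set L = {\<sigma>. \<sigma> permutes {..<n}}"
    using finite_list[OF finite_permutations[of "{..<n}"]] by auto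
  define val where "val \<sigma> \<omega> = (\<Sum>i<n. c (fst \<omega> i) (snd \<omega> (\<sigma> i))) / n" for \<sigma> and \<omega> :: "(nat \<Rightarrow> 'a) \<times> (nat \<Rightarrow> 'a)"
  define best where "best k \<omega> \<longleftrightarrow> k < length L \<and> (\<forall>j<length L. val (L ! k) \<omega> \<le> val (L ! j) \<omega>)" for k \<omega>
  define sel where "sel \<omega> = L ! (LEAST k. best k \<omega>)" for \<omega>
  have L_perm: "L ! k permutes {..<n}" if "k < length L" for k
    using L nth_mem[OF that] by blast
  have mc: "(\<lambda>\<omega>. c (f \<omega>) (g \<omega>)) \<in> borel_measurable M"
    if "f \<in> borel_measurable M" "g \<in> borel_measurable M" for f g and M :: "'z measure"
  proof -
    have "(\<lambda>\<omega>. (f \<omega>, g \<omega>)) \<in> borel_measurable M" using that by (rule borel_measurable_Pair)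
    from measurable_compose[OF this cost_measurable] show ?thesis by simp
  qed
  have comp1: "(\<lambda>\<omega>. fst \<omega> i) \<in> measurable (?Q \<Otimes>\<^sub>M ?R) borel" if "i < n" for i
    using that by (intro measurable_compose[OF measurable_fst] measurable_compose[OF measurable_snd]) (simp add: measurable_component_singleton)
  have comp2: "(\<lambda>\<omega>. snd \<omega> i) \<in> measurable (?Q \<Otimes>\<^sub>M ?R) borel" if "i < n" for i
    using that by (intro measurable_compose[OF measurable_fst] measurable_compose[OF measurable_snd]) (simp add: measurable_component_singleton)
  have val_meas: "val \<sigma> \<in> borel_measurable (?Q \<Otimes>\<^sub>M ?R)" if "\<sigma> permutes {..<n}" for \<sigma>
    unfolding val_def using permutes_in_image[OF that]
    by (intro borel_measurable_divide borel_measurable_sum mc comp1 comp2) auto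
  have best_ex: "\<exists>k. best k \<omega>" for \<omega>
  proof -
    obtain \<sigma> where \<sigma>: "\<sigma> permutes {..<n}" "assignment_cost c n (fst \<omega>) (snd \<omega>) = val \<sigma> \<omega>"
      unfolding val_def by (rule assignment_cost_attained)
    then obtain k where k: "k < length L" "L ! k = \<sigma>" using L by (metis in_set_conv_nth mem_Collect_eq)
    have "val (L ! k) \<omega> \<le> val (L ! j) \<omega>" if "j < length L" for j
      using assignment_cost_le[OF L_perm[OF that], of c "fst \<omega>" "snd \<omega>"] \<sigma>(2) k unfolding val_def by simp
    then show ?thesis using k unfolding best_def by blast
  qed
  have best_Least: "best (LEAST k. best k \<omega>) \<omega>" for \<omega> using best_ex by (metis LeastI_ex)
  have sel_perm: "sel \<omega> permutes {..<n}" for \<omega>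
    using best_Least[of \<omega>] L_perm unfolding sel_def best_def by blast
  have sel_cost: "val (sel \<omega>) \<omega> = assignment_cost c n (fst \<omega>) (snd \<omega>)" for \<omega>
  proof (rule antisym)
    obtain \<sigma> where \<sigma>: "\<sigma> permutes {..<n}" "assignment_cost c n (fst \<omega>) (snd \<omega>) = val \<sigma> \<omega>"
      unfolding val_def by (rule assignment_cost_attained)
    then obtain j where "j < length L" "L ! j = \<sigma>" using L by (metis in_set_conv_nth mem_Collect_eq)
    then show "val (sel \<omega>) \<omega> \<le> assignment_cost c n (fst \<omega>) (snd \<omega>)"
      using best_Least[of \<omega>] \<sigma>(2) unfolding best_def sel_def by auto
    show "assignment_cost c n (fst \<omega>) (snd \<omega>) \<le> val (sel \<omega>) \<omega>"
      unfolding val_def by (rule assignment_cost_le[OF sel_perm])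
  qed
  have best_meas: "Measurable.pred (?Q \<Otimes>\<^sub>M ?R) (best k)" for k
  proof (cases "k < length L")
    case True
    have "Measurable.pred (?Q \<Otimes>\<^sub>M ?R) (\<lambda>\<omega>. \<forall>j\<in>{..<length L}. val (L ! k) \<omega> \<le> val (L ! j) \<omega>)"
    proof (intro pred_intros_finite ballI finite_lessThan)
      fix j assume "j \<in> {..<length L}"
      then show "Measurable.pred (?Q \<Otimes>\<^sub>M ?R) (\<lambda>\<omega>. val (L ! k) \<omega> \<le> val (L ! j) \<omega>)"
        unfolding pred_def using val_meas[OF L_perm] True by (intro borel_measurable_le) auto
    qed
    moreover have "best k = (\<lambda>\<omega>. \<forall>j\<in>{..<length L}. val (L ! k) \<omega> \<le> val (L ! j) \<omega>)"
      using True unfolding best_def fun_eq_iff by blast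
    ultimately show ?thesis by (simp only:)
  next
    case False
    then show ?thesis unfolding best_def by simp
  qed
  have Least_meas: "(\<lambda>\<omega>. LEAST k. best k \<omega>) \<in> measurable (?Q \<Otimes>\<^sub>M ?R) (count_space UNIV)"
    by (rule measurable_Least) (rule best_meas)
  \<comment> \<open>Evaluation at a random permutation and a random index is reduced to fixed
    \<open>k\<close> and \<open>i\<close>. The default 0 makes \<open>point k i\<close> total in
    \<open>k\<close>; it never occurs at the selected index, since \<open>best\<close> entails
    \<open>k < length L\<close>.\<close>
  define point where "point k i z = (if k < length L then snd (fst z) ((L ! k) i) else 0)"
    for k i and z :: "((nat \<Rightarrow> 'a) \<times> (nat \<Rightarrow> 'a)) \<times> nat"
  define T where "T z = (fst (fst z) (snd z), snd (fst z) (sel (fst z) (snd z)))"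
    for z :: "((nat \<Rightarrow> 'a) \<times> (nat \<Rightarrow> 'a)) \<times> nat"
  let ?S = "(?Q \<Otimes>\<^sub>M ?R) \<Otimes>\<^sub>M ?U"
  have index_meas: "snd \<in> measurable ?S (count_space {..<n})"
    by (rule measurable_compose[OF measurable_snd])
       (simp add: measurable_def space_uniform_count_measure sets_uniform_count_measure)
  have T1: "(\<lambda>z. fst (fst z) (snd z)) \<in> measurable ?S borel"
    by (rule measurable_compose_countable'[OF _ index_meas]) (auto intro: measurable_compose[OF measurable_fst comp1])
  have point_meas: "point k i \<in> measurable ?S borel" if "i < n" for k i
    unfolding point_def using permutes_in_image[OF L_perm, of k i] that
    by (cases "k < length L") (auto intro: measurable_compose[OF measurable_fst comp2])
  have "(\<lambda>z. point (LEAST k. best k (fst z)) (snd z) z) \<in> measurable ?S borel"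
  proof (rule measurable_compose_countable'[where I=UNIV, OF _ measurable_compose[OF measurable_fst Least_meas]])
    show "(\<lambda>z. point k (snd z) z) \<in> measurable ?S borel" for k
      by (rule measurable_compose_countable'[OF _ index_meas]) (auto intro: point_meas)
  qed simp
  moreover have "point (LEAST k. best k (fst z)) (snd z) z = snd (fst z) (sel (fst z) (snd z))" for z
    using best_Least[of "fst z"] unfolding point_def sel_def best_def by simp
  ultimately have T2: "(\<lambda>z. snd (fst z) (sel (fst z) (snd z))) \<in> measurable ?S borel" by simp
  have T_meas: "T \<in> measurable ?S borel" unfolding T_def using T1 T2 by (rule borel_measurable_Pair)
  define \<pi> where "\<pi> = distr ?S borel T"
  have fs: "fst \<in> measurable (borel :: ('a \<times> 'a) measure) (borel :: 'a measure)"
    "snd \<in> measurable (borel :: ('a \<times> 'a) measure) (borel :: 'a measure)"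
    by (intro borel_measurable_continuous_onI continuous_intros)+
  \<comment> \<open>Integrating out the index first leaves the average over the matched pairs; both
    marginals and the cost are instances.\<close>
  have int_\<pi>: "(\<integral>\<^sup>+z. g z \<partial>\<pi>) = (\<integral>\<^sup>+\<omega>. (\<Sum>i<n. g (fst \<omega> i, snd \<omega> (sel \<omega> i))) / of_nat n \<partial>(?Q \<Otimes>\<^sub>M ?R))"
    if g: "g \<in> borel_measurable borel" for g :: "'a \<times> 'a \<Rightarrow> ennreal"
  proof -
    have "(\<integral>\<^sup>+z. g z \<partial>\<pi>) = (\<integral>\<^sup>+z. g (T z) \<partial>?S)"
      unfolding \<pi>_def by (rule nn_integral_distr[OF T_meas]) (simp add: g)
    also have "\<dots> = (\<integral>\<^sup>+\<omega>. \<integral>\<^sup>+i. g (T (\<omega>, i)) \<partial>?U \<partial>(?Q \<Otimes>\<^sub>M ?R))"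
      by (rule U.nn_integral_fst[symmetric]) (rule measurable_compose[OF T_meas g])
    finally show ?thesis unfolding nn_integral_uniform_count[OF n] by (simp add: T_def)
  qed
  have avg: "(\<Sum>i<n. a) / of_nat n = a" for a :: ennreal
    using n by (simp add: mult.commute[of "of_nat n"] mult_divide_eq_ennreal)
  have marg1: "(\<integral>\<^sup>+z. h (fst z) \<partial>\<pi>) = (\<integral>\<^sup>+x. h x \<partial>\<mu>)"
    if h: "h \<in> borel_measurable borel" for h :: "'a \<Rightarrow> ennreal"
  proof -
    have hm: "(\<lambda>x. h (x i)) \<in> borel_measurable ?Q" if "i < n" for i
      using h that by (intro measurable_compose[OF measurable_component_singleton]) auto
    have sm: "(\<lambda>x. (\<Sum>i<n. h (x i)) / of_nat n) \<in> borel_measurable ?Q"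
      by (intro borel_measurable_divide_ennreal borel_measurable_sum hm) auto
    have "(\<integral>\<^sup>+z. h (fst z) \<partial>\<pi>) = (\<integral>\<^sup>+\<omega>. (\<Sum>i<n. h (fst \<omega> i)) / of_nat n \<partial>(?Q \<Otimes>\<^sub>M ?R))"
      using int_\<pi>[OF measurable_compose[OF fs(1) h]] by simp
    also have "\<dots> = (\<integral>\<^sup>+x. \<integral>\<^sup>+y. (\<Sum>i<n. h (x i)) / of_nat n \<partial>?R \<partial>?Q)"
      by (subst R.nn_integral_fst[OF measurable_compose[OF measurable_fst sm], symmetric]) simp
    also have "\<dots> = (\<integral>\<^sup>+x. (\<Sum>i<n. h (x i)) \<partial>?Q) / of_nat n"
      using hm by (simp add: R.emeasure_space_1 nn_integral_divide)
    also have "(\<integral>\<^sup>+x. (\<Sum>i<n. h (x i)) \<partial>?Q) = (\<Sum>i<n. \<integral>\<^sup>+x. h (x i) \<partial>?Q)"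
      by (rule nn_integral_sum) (use hm in auto)
    also have "\<dots> = (\<Sum>i<n. \<integral>\<^sup>+x. h x \<partial>\<mu>)"
      using h \<mu> by (intro sum.cong refl nn_integral_PiM_component) (auto cong: measurable_cong_sets)
    finally show ?thesis unfolding avg .
  qed
  have marg2: "(\<integral>\<^sup>+z. h (snd z) \<partial>\<pi>) = (\<integral>\<^sup>+y. h y \<partial>\<nu>)"
    if h: "h \<in> borel_measurable borel" for h :: "'a \<Rightarrow> ennreal"
  proof -
    have hm: "(\<lambda>y. h (y i)) \<in> borel_measurable ?R" if "i < n" for i
      using h that by (intro measurable_compose[OF measurable_component_singleton]) auto
    have sm: "(\<lambda>y. (\<Sum>i<n. h (y i)) / of_nat n) \<in> borel_measurable ?R"
      by (intro borel_measurable_divide_ennreal borel_measurable_sum hm) auto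
    have "(\<Sum>i<n. h (snd \<omega> (sel \<omega> i))) = (\<Sum>i<n. h (snd \<omega> i))" for \<omega>
      using sum.permute[OF sel_perm[of \<omega>], of "\<lambda>i. h (snd \<omega> i)"] by (simp add: o_def)
    then have "(\<integral>\<^sup>+z. h (snd z) \<partial>\<pi>) = (\<integral>\<^sup>+\<omega>. (\<Sum>i<n. h (snd \<omega> i)) / of_nat n \<partial>(?Q \<Otimes>\<^sub>M ?R))"
      using int_\<pi>[OF measurable_compose[OF fs(2) h]] by simp
    also have "\<dots> = (\<integral>\<^sup>+x. \<integral>\<^sup>+y. (\<Sum>i<n. h (y i)) / of_nat n \<partial>?R \<partial>?Q)"
      by (subst R.nn_integral_fst[OF measurable_compose[OF measurable_snd sm], symmetric]) simp
    also have "\<dots> = (\<integral>\<^sup>+y. (\<Sum>i<n. h (y i)) \<partial>?R) / of_nat n"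
      using hm by (simp add: Q.emeasure_space_1 nn_integral_divide)
    also have "(\<integral>\<^sup>+y. (\<Sum>i<n. h (y i)) \<partial>?R) = (\<Sum>i<n. \<integral>\<^sup>+y. h (y i) \<partial>?R)"
      by (rule nn_integral_sum) (use hm in auto)
    also have "\<dots> = (\<Sum>i<n. \<integral>\<^sup>+y. h y \<partial>\<nu>)"
      using h \<nu> by (intro sum.cong refl nn_integral_PiM_component) (auto cong: measurable_cong_sets)
    finally show ?thesis unfolding avg .
  qed
  have distr_eq: "distr \<pi> borel p = \<rho>"
    if p: "p \<in> measurable borel borel" and s: "sets \<rho> = sets borel"
      and eq: "\<And>h :: 'a \<Rightarrow> ennreal. h \<in> borel_measurable borel \<Longrightarrow> (\<integral>\<^sup>+z. h (p z) \<partial>\<pi>) = (\<integral>\<^sup>+x. h x \<partial>\<rho>)"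
    for p :: "'a \<times> 'a \<Rightarrow> 'a" and \<rho>
  proof (rule measure_eqI)
    have p': "p \<in> measurable \<pi> borel" using p by (simp add: \<pi>_def)
    fix A assume "A \<in> sets (distr \<pi> borel p)"
    then have A: "A \<in> sets borel" by simp
    have "emeasure (distr \<pi> borel p) A = (\<integral>\<^sup>+x. indicator A x \<partial>distr \<pi> borel p)" using A by simp
    also have "\<dots> = (\<integral>\<^sup>+z. indicator A (p z) \<partial>\<pi>)" using p' A by (intro nn_integral_distr) auto
    also have "\<dots> = (\<integral>\<^sup>+x. indicator A x \<partial>\<rho>)" using A by (intro eq) simp
    also have "\<dots> = emeasure \<rho> A" using A s by simp
    finally show "emeasure (distr \<pi> borel p) A = emeasure \<rho> A" .
  qed (simp add: s)
  show thesis
  proof (rule that[of \<pi>])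
    have "prob_space \<pi>" unfolding \<pi>_def by (rule S.prob_space_distr[OF T_meas])
    then show "\<pi> \<in> couplings \<mu> \<nu>"
      unfolding couplings_def using distr_eq[OF fs(1) \<mu>(2) marg1] distr_eq[OF fs(2) \<nu>(2) marg2]
      by (simp add: \<pi>_def)
    have "(\<Sum>i<n. ennreal (c (fst \<omega> i) (snd \<omega> (sel \<omega> i)))) / of_nat n
        = ennreal (assignment_cost c n (fst \<omega>) (snd \<omega>))" for \<omega>
      unfolding sel_cost[symmetric] val_def using c0 n
      by (simp add: sum_ennreal divide_ennreal[symmetric] sum_nonneg ennreal_of_nat_eq_real_of_nat)
    then show "(\<integral>\<^sup>+z. ennreal (c (fst z) (snd z)) \<partial>\<pi>) =
       (\<integral>\<^sup>+\<omega>. ennreal (assignment_cost c n (fst \<omega>) (snd \<omega>)) \<partial>(?Q \<Otimes>\<^sub>M ?R))"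
      using int_\<pi>[of "\<lambda>z. ennreal (c (fst z) (snd z))"] cost_measurable by simp
  qed
qed

section \<open>Dual potentials of smooth costs\<close>

lemma mderiv_empty: "mderiv {#} f = f"
  unfolding mderiv_def by simp

text \<open>A singleton multiset has only one enumeration, which forces the choice in
  \<open>mderiv\<close>.\<close>

lemma mderiv_single: "mderiv {#b#} f x = frechet_derivative f (at x) b"
proof -
  have "(SOME bs. mset bs = {#b#}) = [b]" by (rule some_equality) auto
  then show ?thesis unfolding mderiv_def by simp
qed

lemma multi_indices_0: "multi_indices 0 = {{#}}"
  unfolding multi_indices_def by auto

lemma multi_indices_1: "multi_indices (Suc 0) = (\<lambda>b. {#b#}) ` Basis"
  unfolding multi_indices_def by (auto dest!: size_1_singleton_mset[unfolded One_nat_def])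

lemma finite_multi_indices: "j \<le> 1 \<Longrightarrow> finite (multi_indices j :: 'a::euclidean_space multiset set)"
  by (cases j) (auto simp: multi_indices_0 multi_indices_1)

lemma multi_indices_nonempty: "j \<le> 1 \<Longrightarrow> (multi_indices j :: 'a::euclidean_space multiset set) \<noteq> {}"
  by (cases j) (auto simp: multi_indices_0 multi_indices_1)

lemma floor_strict_le_1: "0 < \<alpha> \<Longrightarrow> \<alpha> \<le> 1 \<Longrightarrow> floor_strict \<alpha> = 0"
  unfolding floor_strict_def by (simp add: ceiling_le_iff) 

lemma floor_strict_gt_1:
  assumes "1 < \<alpha>" "\<alpha> \<le> 2" shows "floor_strict \<alpha> = Suc 0"
proof -
  have "\<lceil>\<alpha>\<rceil> = 2" using assms by (simp add: ceiling_eq_iff)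
  then show ?thesis unfolding floor_strict_def by simp
qed

text \<open>\<open>holder_norm\<close> is a sum of suprema, so it bounds each of them once the
  others are known to be nonnegative. For the Hoelder quotients this takes two distinct points of
  \<open>Z\<close>, since the supremum of the empty set is unspecified.\<close>

lemma holder_space_bounds:
  fixes Z :: "'a::euclidean_space set"
  assumes h: "holder_space \<alpha> Z h" and Z: "open Z" "Z \<noteq> {}" and fl: "floor_strict \<alpha> \<le> 1"
  shows "\<And>\<beta> j x. j \<le> floor_strict \<alpha> \<Longrightarrow> \<beta> \<in> multi_indices j \<Longrightarrow> x \<in> Z \<Longrightarrow>
           \<bar>mderiv \<beta> h x\<bar> \<le> holder_norm \<alpha> Z h"
    and "\<And>\<beta> x y. \<beta> \<in> multi_indices (floor_strict \<alpha>) \<Longrightarrow> x \<in> Z \<Longrightarrow> y \<in> Z \<Longrightarrow> x \<noteq> y \<Longrightarrow>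
           \<bar>mderiv \<beta> h x - mderiv \<beta> h y\<bar> \<le> holder_norm \<alpha> Z h * norm (x - y) powr (\<alpha> - real (floor_strict \<alpha>))"
proof -
  define k where "k = floor_strict \<alpha>"
  define S where "S j = Sup (deriv_vals Z h j)" for j
  define R where "R \<beta> = Sup (holder_quots Z (mderiv \<beta> h) (\<alpha> - real k))" for \<beta> :: "'a multiset"
  have int: "interior Z = Z" using Z(1) by (rule interior_open)
  have norm_eq: "holder_norm \<alpha> Z h = (\<Sum>j\<le>k. S j) + (\<Sum>\<beta>\<in>multi_indices k. R \<beta>)"
    unfolding holder_norm_def S_def R_def k_def ..
  have bdd: "bdd_above (deriv_vals Z h j)" if "j \<le> k" for j
    using h that unfolding holder_space_def k_def by (elim conjE) simp
  have bddq: "bdd_above (holder_quots Z (mderiv \<beta> h) (\<alpha> - real k))" if "\<beta> \<in> multi_indices k" for \<beta>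
    using h that unfolding holder_space_def k_def by (elim conjE) simp
  have S_ge: "\<bar>mderiv \<beta> h x\<bar> \<le> S j" if "j \<le> k" "\<beta> \<in> multi_indices j" "x \<in> Z" for \<beta> j x
    unfolding S_def by (rule cSup_upper[OF _ bdd[OF that(1)]]) (use that int in \<open>auto simp: deriv_vals_def\<close>)
  have R_ge: "\<bar>mderiv \<beta> h x - mderiv \<beta> h y\<bar> / norm (x - y) powr (\<alpha> - real k) \<le> R \<beta>"
    if "\<beta> \<in> multi_indices k" "x \<in> Z" "y \<in> Z" "x \<noteq> y" for \<beta> x y
    unfolding R_def by (rule cSup_upper[OF _ bddq[OF that(1)]]) (use that int in \<open>auto simp: holder_quots_def\<close>)
  obtain x0 where x0: "x0 \<in> Z" using Z by blast
  have "\<not> Z \<subseteq> {x0}" using Z(1) x0 not_open_singleton[of x0] by (metis subset_singletonD empty_iff)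
  then obtain x1 where x1: "x1 \<in> Z" "x1 \<noteq> x0" by blast
  have S0: "0 \<le> S j" if j: "j \<le> k" for j
  proof -
    have "j \<le> 1" using j fl unfolding k_def by simp
    then obtain \<beta> :: "'a multiset" where "\<beta> \<in> multi_indices j" using multi_indices_nonempty by blast
    then show ?thesis using S_ge[OF j _ x0, of \<beta>] by linarith
  qed
  have R0: "0 \<le> R \<beta>" if "\<beta> \<in> multi_indices k" for \<beta>
  proof -
    have "0 \<le> \<bar>mderiv \<beta> h x1 - mderiv \<beta> h x0\<bar> / norm (x1 - x0) powr (\<alpha> - real k)" by simp
    then show ?thesis using R_ge[OF that x1(1) x0 x1(2)] by linarith
  qed
  have finm: "finite (multi_indices k :: 'a multiset set)" using finite_multi_indices fl unfolding k_def by blast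
  have S_le: "S j \<le> holder_norm \<alpha> Z h" if "j \<le> k" for j
  proof -
    have "S j \<le> (\<Sum>j\<le>k. S j)" using that S0 by (intro member_le_sum) auto
    moreover have "0 \<le> (\<Sum>\<beta>\<in>multi_indices k. R \<beta>)" by (intro sum_nonneg R0)
    ultimately show ?thesis unfolding norm_eq by linarith
  qed
  have R_le: "R \<beta> \<le> holder_norm \<alpha> Z h" if "\<beta> \<in> multi_indices k" for \<beta>
  proof -
    have "R \<beta> \<le> (\<Sum>\<beta>\<in>multi_indices k. R \<beta>)" using that R0 finm by (intro member_le_sum) auto
    moreover have "0 \<le> (\<Sum>j\<le>k. S j)" by (intro sum_nonneg S0) auto
    ultimately show ?thesis unfolding norm_eq by linarith
  qed
  show "\<bar>mderiv \<beta> h x\<bar> \<le> holder_norm \<alpha> Z h"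
    if "j \<le> floor_strict \<alpha>" "\<beta> \<in> multi_indices j" "x \<in> Z" for \<beta> j x
    using S_ge[OF that[folded k_def]] S_le[OF that(1)[folded k_def]] by linarith
  show "\<bar>mderiv \<beta> h x - mderiv \<beta> h y\<bar> \<le> holder_norm \<alpha> Z h * norm (x - y) powr (\<alpha> - real (floor_strict \<alpha>))"
    if "\<beta> \<in> multi_indices (floor_strict \<alpha>)" "x \<in> Z" "y \<in> Z" "x \<noteq> y" for \<beta> x y
  proof -
    have "\<bar>mderiv \<beta> h x - mderiv \<beta> h y\<bar> / norm (x - y) powr (\<alpha> - real k) \<le> holder_norm \<alpha> Z h"
      using R_ge[OF that[folded k_def]] R_le[OF that(1)[folded k_def]] by linarith
    moreover have "norm (x - y) powr (\<alpha> - real k) > 0" using that(4) by simp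
    ultimately show ?thesis unfolding k_def by (simp only: pos_divide_le_eq)
  qed
qed

text \<open>For \<open>\<alpha> \<le> 1\<close> the Hoelder bound on \<open>h\<close> itself
  suffices and \<open>p\<close> is 0. For \<open>\<alpha> > 1\<close>, \<open>p\<close> is the
  gradient, and the mean value theorem on a segment in \<open>Z\<close> reduces the remainder to the
  Hoelder bound on partial derivatives. Summing over the coordinates gives the factor d in
  \<open>L\<close>.\<close>

lemma holder_space_tangent:
  fixes Z :: "'a::euclidean_space set"
  assumes h: "holder_space \<alpha> Z h" and Z: "open Z" "convex Z" "Z \<noteq> {}" and \<alpha>: "0 < \<alpha>" "\<alpha> \<le> 2"
  defines "L \<equiv> real DIM('a) * max 1 (holder_norm \<alpha> Z h)"
  obtains p where "\<And>z. z \<in> Z \<Longrightarrow> norm (p z) \<le> L"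
    "\<And>z0 z. z0 \<in> Z \<Longrightarrow> z \<in> Z \<Longrightarrow> h z \<le> h z0 + p z0 \<bullet> (z - z0) + L * norm (z - z0) powr \<alpha>"
proof -
  define \<Lambda> where "\<Lambda> = max 1 (holder_norm \<alpha> Z h)"
  have \<Lambda>1: "\<Lambda> \<ge> 1" and \<Lambda>n: "holder_norm \<alpha> Z h \<le> \<Lambda>" unfolding \<Lambda>_def by auto
  have L_eq: "L = real DIM('a) * \<Lambda>" unfolding L_def \<Lambda>_def ..
  have d1: "real DIM('a) \<ge> 1" by (simp add: Suc_leI)
  have \<Lambda>L: "\<Lambda> \<le> L" unfolding L_eq using d1 \<Lambda>1 by (simp add: mult_le_cancel_right1)
  show thesis
  proof (cases "\<alpha> \<le> 1")
    case True
    then have fl: "floor_strict \<alpha> = 0" using floor_strict_le_1 \<alpha> by blast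
    show thesis
    proof (rule that[of "\<lambda>_. 0"])
      show "norm (0 :: 'a) \<le> L" using \<Lambda>1 \<Lambda>L by simp
      fix z0 z assume z: "z0 \<in> Z" "z \<in> Z"
      show "h z \<le> h z0 + 0 \<bullet> (z - z0) + L * norm (z - z0) powr \<alpha>"
      proof (cases "z = z0")
        case False
        have "\<bar>h z - h z0\<bar> \<le> holder_norm \<alpha> Z h * norm (z - z0) powr \<alpha>"
          using holder_space_bounds(2)[OF h Z(1,3), of "{#}" z z0] z False fl
          by (simp add: multi_indices_0 mderiv_empty)
        also have "\<dots> \<le> L * norm (z - z0) powr \<alpha>"
          using \<Lambda>n \<Lambda>L by (intro mult_right_mono) auto
        finally show ?thesis by simp
      qed (use \<Lambda>1 \<Lambda>L in simp)
    qed
  next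
    case False
    then have fl: "floor_strict \<alpha> = Suc 0" using floor_strict_gt_1 \<alpha> by simp
    let ?D = "\<lambda>z b. frechet_derivative h (at z) b"
    define p where "p z = (\<Sum>b\<in>Basis. ?D z b *\<^sub>R b)" for z
    have diff: "h differentiable (at z)" if "z \<in> Z" for z
    proof -
      have "\<forall>x\<in>interior Z. pdiff [] h differentiable (at x)"
        using h fl unfolding holder_space_def by (metis empty_set empty_subsetI length_0_conv less_Suc_eq_0_disj)
      then show ?thesis using that interior_open[OF Z(1)] by simp
    qed
    have p_inner: "p z \<bullet> w = (\<Sum>b\<in>Basis. ?D z b * (w \<bullet> b))" for z w
      unfolding p_def by (simp only: inner_sum_left inner_scaleR_left inner_commute[of w])
    have pw: "?D z w = p z \<bullet> w" if "z \<in> Z" for z w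
    proof -
      have lin: "linear (frechet_derivative h (at z))" by (rule linear_frechet_derivative[OF diff[OF that]])
      have "?D z w = ?D z (\<Sum>b\<in>Basis. (w \<bullet> b) *\<^sub>R b)" by (simp add: euclidean_representation)
      also have "\<dots> = (\<Sum>b\<in>Basis. (w \<bullet> b) * ?D z b)"
        by (simp add: linear_sum[OF lin] linear_scale[OF lin])
      also have "\<dots> = p z \<bullet> w" unfolding p_inner by (simp only: mult.commute)
      finally show ?thesis .
    qed
    have Db: "\<bar>?D z b\<bar> \<le> \<Lambda>" if "z \<in> Z" "b \<in> Basis" for z b
      using holder_space_bounds(1)[OF h Z(1,3), of "Suc 0" "{#b#}" z] that fl \<Lambda>n
      by (simp add: multi_indices_1 mderiv_single)
    have Dd: "\<bar>?D z b - ?D z0 b\<bar> \<le> \<Lambda> * norm (z - z0) powr (\<alpha> - 1)"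
      if "z \<in> Z" "z0 \<in> Z" "b \<in> Basis" for z z0 b
    proof (cases "z = z0")
      case False
      have "\<bar>?D z b - ?D z0 b\<bar> \<le> holder_norm \<alpha> Z h * norm (z - z0) powr (\<alpha> - 1)"
        using holder_space_bounds(2)[OF h Z(1,3), of "{#b#}" z z0] that fl False
        by (simp add: multi_indices_1 mderiv_single)
      also have "\<dots> \<le> \<Lambda> * norm (z - z0) powr (\<alpha> - 1)" using \<Lambda>n by (intro mult_right_mono) auto
      finally show ?thesis .
    qed simp
    show thesis
    proof (rule that[of p])
      fix z assume z: "z \<in> Z"
      have "norm (p z) \<le> (\<Sum>b\<in>(Basis::'a set). norm (?D z b *\<^sub>R b))" unfolding p_def by (rule norm_sum)
      also have "\<dots> \<le> (\<Sum>b\<in>(Basis::'a set). \<Lambda>)" using Db[OF z] by (intro sum_mono) simp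
      finally show "norm (p z) \<le> L" unfolding L_eq by simp
    next
      fix z0 z assume z: "z0 \<in> Z" "z \<in> Z"
      define w where "w = z - z0"
      have seg: "z0 + t *\<^sub>R w \<in> Z" if "0 \<le> t" "t \<le> 1" for t
      proof -
        have "z0 + t *\<^sub>R w = (1 - t) *\<^sub>R z0 + t *\<^sub>R z" unfolding w_def by (simp add: algebra_simps)
        then show ?thesis using convexD_alt[OF Z(2) z that] by simp
      qed
      have "((\<lambda>t. h (z0 + t *\<^sub>R w)) has_derivative (\<lambda>s. ?D (z0 + t *\<^sub>R w) (s *\<^sub>R w))) (at t within {0..1})"
        if "0 \<le> t" "t \<le> 1" for t :: real
      proof -
        have 1: "((\<lambda>t. z0 + t *\<^sub>R w) has_derivative (\<lambda>s. s *\<^sub>R w)) (at t within {0..1})"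
          by (auto intro!: derivative_eq_intros)
        have "(h has_derivative ?D (z0 + t *\<^sub>R w)) (at (z0 + t *\<^sub>R w))"
          using diff[OF seg[OF that]] by (simp add: frechet_derivative_works)
        from has_derivative_compose[OF 1 this] show ?thesis .
      qed
      then obtain t :: real where t: "0 < t" "t < 1"
        and eq: "h (z0 + 1 *\<^sub>R w) - h (z0 + 0 *\<^sub>R w) = ?D (z0 + t *\<^sub>R w) ((1 - 0) *\<^sub>R w)"
        using mvt_simple[of 0 1 "\<lambda>t. h (z0 + t *\<^sub>R w)" "\<lambda>t s. ?D (z0 + t *\<^sub>R w) (s *\<^sub>R w)"] by auto
      define \<xi> where "\<xi> = z0 + t *\<^sub>R w"
      have \<xi>: "\<xi> \<in> Z" unfolding \<xi>_def using seg t by simp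
      have "h z - h z0 = p \<xi> \<bullet> w" using eq pw[OF \<xi>] unfolding \<xi>_def w_def by simp
      also have "\<dots> = p z0 \<bullet> w + (\<Sum>b\<in>Basis. (?D \<xi> b - ?D z0 b) * (w \<bullet> b))"
        unfolding p_inner by (simp add: sum_subtractf left_diff_distrib)
      also have "(\<Sum>b\<in>Basis. (?D \<xi> b - ?D z0 b) * (w \<bullet> b)) \<le> (\<Sum>b\<in>(Basis::'a set). \<Lambda> * norm w powr \<alpha>)"
      proof (rule sum_mono)
        fix b :: 'a assume b: "b \<in> Basis"
        have "norm (\<xi> - z0) \<le> norm w" unfolding \<xi>_def using t by (simp add: mult_left_le_one_le)
        then have "norm (\<xi> - z0) powr (\<alpha> - 1) \<le> norm w powr (\<alpha> - 1)"
          using False by (intro powr_mono2) auto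
        then have 1: "\<bar>?D \<xi> b - ?D z0 b\<bar> \<le> \<Lambda> * norm w powr (\<alpha> - 1)"
          using Dd[OF \<xi> z(1) b] \<Lambda>1 by (meson mult_left_mono order_trans zero_le_one)
        have "(?D \<xi> b - ?D z0 b) * (w \<bullet> b) \<le> \<bar>?D \<xi> b - ?D z0 b\<bar> * \<bar>w \<bullet> b\<bar>"
          by (metis abs_ge_self abs_mult)
        also have "\<dots> \<le> (\<Lambda> * norm w powr (\<alpha> - 1)) * norm w"
          using 1 Basis_le_norm[OF b, of w] \<Lambda>1 by (intro mult_mono) auto
        also have "\<dots> = \<Lambda> * norm w powr \<alpha>"
        proof (cases "w = 0")
          case False
          then have "norm w powr (\<alpha> - 1) * norm w = norm w powr \<alpha>"
            by (simp add: powr_diff)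
          then show ?thesis by simp
        qed simp
        finally show "(?D \<xi> b - ?D z0 b) * (w \<bullet> b) \<le> \<Lambda> * norm w powr \<alpha>" .
      qed
      finally show "h z \<le> h z0 + p z0 \<bullet> (z - z0) + L * norm (z - z0) powr \<alpha>"
        unfolding L_eq w_def by simp
    qed
  qed
qed

text \<open>Up to \<open>\<delta>\<close> the first term dominates; beyond it the second does,
  because the exponent \<open>\<alpha> - 2\<close> is not positive.\<close>

lemma powr_le_quadratic:
  fixes t :: real
  assumes "0 \<le> t" "0 < \<delta>" "0 < \<alpha>" "\<alpha> \<le> 2"
  shows "t powr \<alpha> \<le> \<delta> powr \<alpha> + \<delta> powr (\<alpha> - 2) * t\<^sup>2"
proof (cases "t \<le> \<delta>")
  case True
  then have "t powr \<alpha> \<le> \<delta> powr \<alpha>" using assms by (intro powr_mono2) auto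
  then show ?thesis using assms by (simp add: add_increasing2)
next
  case False
  then have t: "t > 0" using assms by linarith
  have "t powr \<alpha> = t powr (\<alpha> - 2) * t\<^sup>2" using t by (simp add: powr_diff powr_numeral)
  also have "\<dots> \<le> \<delta> powr (\<alpha> - 2) * t\<^sup>2"
    using assms False by (intro mult_right_mono powr_mono2') auto
  also have "\<dots> \<le> \<delta> powr \<alpha> + \<delta> powr (\<alpha> - 2) * t\<^sup>2" by simp
  finally show ?thesis .
qed

text \<open>With \<open>K = 2 * L * \<delta> powr (\<alpha> - 2)\<close>, the term
  \<open>L * t powr \<alpha>\<close> is at most
  \<open>K / 2 * t\<^sup>2 + K / 2 * \<delta>\<^sup>2\<close>, and the choice
  \<open>\<epsilon> = L * \<delta> powr \<alpha>\<close> adds another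
  \<open>K / 2 * \<delta>\<^sup>2\<close>: together they fill the slack.
  \<open>K \<ge> 2 * L\<close> keeps the scaled values below 1 and the vertices in the ball of
  radius 2.\<close>

lemma scaled_semiconcave:
  fixes \<phi> :: "'a::euclidean_space \<Rightarrow> real"
  assumes meas: "\<phi> \<in> borel_measurable borel" and bound: "\<And>x. x \<in> X \<Longrightarrow> \<bar>\<phi> x\<bar> \<le> 1"
    and X: "X \<subseteq> cball 0 1"
    and tangent: "\<And>x0 \<epsilon>. x0 \<in> X \<Longrightarrow> \<epsilon> > 0 \<Longrightarrow> \<exists>p. norm p \<le> L \<and>
        (\<forall>x\<in>X. \<phi> x \<le> \<phi> x0 + p \<bullet> (x - x0) + L * norm (x - x0) powr \<alpha> + \<epsilon>)"
    and L: "L \<ge> 1" and \<delta>: "0 < \<delta>" "\<delta> \<le> 1" and \<alpha>: "0 < \<alpha>" "\<alpha> \<le> 2"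
  shows "(\<lambda>x. \<phi> x / (2 * L * \<delta> powr (\<alpha> - 2))) \<in> semiconcave_class X (\<delta>\<^sup>2)"
proof -
  define q where "q = \<delta> powr (\<alpha> - 2)"
  define K where "K = 2 * L * q"
  have q1: "q \<ge> 1"
    using powr_mono2'[of "\<alpha> - 2" \<delta> 1] \<delta> \<alpha> unfolding q_def by simp
  have "L * 1 \<le> L * q" using q1 L by (intro mult_left_mono) auto
  then have K: "K \<ge> 2 * L" unfolding K_def by simp
  have K1: "K \<ge> 1" using K L by linarith
  have q\<delta>: "q * \<delta>\<^sup>2 = \<delta> powr \<alpha>" unfolding q_def using \<delta> by (simp add: powr_diff powr_numeral)
  show ?thesis unfolding semiconcave_class_def q_def[symmetric] K_def[symmetric]
  proof (intro CollectI conjI ballI)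
    show "(\<lambda>x. \<phi> x / K) \<in> borel_measurable borel" using meas by simp
    show "\<bar>\<phi> x / K\<bar> \<le> 1" if "x \<in> X" for x
      using bound[OF that] K1 by (simp add: abs_divide pos_divide_le_eq)
    fix x0 assume x0: "x0 \<in> X"
    have "L * \<delta> powr \<alpha> > 0" using L \<delta> by simp
    then obtain p where p: "norm p \<le> L"
      and le: "\<And>x. x \<in> X \<Longrightarrow> \<phi> x \<le> \<phi> x0 + p \<bullet> (x - x0) + L * norm (x - x0) powr \<alpha> + L * \<delta> powr \<alpha>"
      using tangent[OF x0] by blast
    \<comment> \<open>The vertex for which \<open>|x - v|^2\<close> has gradient
      \<open>p / K\<close> at \<open>x0\<close>.\<close>
    define v where "v = x0 - (1 / (2 * K)) *\<^sub>R p"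
    show "\<exists>v. norm v \<le> 2 \<and> (\<forall>x\<in>X. \<phi> x / K \<le> \<phi> x0 / K + (norm (x - v))\<^sup>2 - (norm (x0 - v))\<^sup>2 + \<delta>\<^sup>2)"
    proof (intro exI[of _ v] conjI ballI)
      have "norm ((1 / (2 * K)) *\<^sub>R p) \<le> 1" using p K L K1 by (simp add: pos_divide_le_eq)
      then show "norm v \<le> 2" using norm_triangle_ineq4[of x0 "(1 / (2 * K)) *\<^sub>R p"] x0 X
        unfolding v_def by auto
      fix x assume x: "x \<in> X"
      have "L * norm (x - x0) powr \<alpha> \<le> L * (\<delta> powr \<alpha> + q * (norm (x - x0))\<^sup>2)"
        unfolding q_def using L \<delta> \<alpha> by (intro mult_left_mono powr_le_quadratic) auto
      then have "\<phi> x \<le> \<phi> x0 + p \<bullet> (x - x0) + L * q * (norm (x - x0))\<^sup>2 + 2 * L * \<delta> powr \<alpha>"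
        using le[OF x] by (simp add: algebra_simps)
      also have "\<dots> = \<phi> x0 + p \<bullet> (x - x0) + K / 2 * (norm (x - x0))\<^sup>2 + K * \<delta>\<^sup>2"
        unfolding q\<delta>[symmetric] K_def by simp
      \<comment> \<open>Relaxing \<open>K / 2\<close> to \<open>K\<close> gives leading coefficient
        1 after division by \<open>K\<close>.\<close>
      also have "\<dots> \<le> \<phi> x0 + p \<bullet> (x - x0) + K * (norm (x - x0))\<^sup>2 + K * \<delta>\<^sup>2"
        using K1 by (simp add: mult_right_mono)
      also have "\<dots> = \<phi> x0 + K * ((norm (x - v))\<^sup>2 - (norm (x0 - v))\<^sup>2) + K * \<delta>\<^sup>2"
      proof -
        have "(norm (x - v))\<^sup>2 - (norm (x0 - v))\<^sup>2 = (norm (x - x0))\<^sup>2 + (1 / K) * (p \<bullet> (x - x0))"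
        proof -
          have a: "x - v = (x - x0) + (1 / (2 * K)) *\<^sub>R p" and b: "x0 - v = (1 / (2 * K)) *\<^sub>R p"
            unfolding v_def by simp_all
          have c: "(norm (y + r *\<^sub>R p))\<^sup>2 - (norm (r *\<^sub>R p))\<^sup>2 = (norm y)\<^sup>2 + (2 * r) * (p \<bullet> y)" for y r
            by (simp add: power2_norm_eq_inner inner_simps inner_commute algebra_simps) (simp add: power2_eq_square)
          have "2 * (1 / (2 * K)) = 1 / K" by simp
          then show ?thesis unfolding a b c by (simp only:)
        qed
        then show ?thesis using K1 by (simp add: distrib_left)
      qed
      finally show "\<phi> x / K \<le> \<phi> x0 / K + (norm (x - v))\<^sup>2 - (norm (x0 - v))\<^sup>2 + \<delta>\<^sup>2"
        using K1 by (simp add: pos_divide_le_eq field_simps)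
    qed
  qed
qed

section \<open>Convergence rate\<close>

text \<open>The slack \<open>1 / 4 ^ J\<close> is admissible at every level up to \<open>J\<close>,
  so one class serves the whole chain, and it equals the resolution of the finest code.\<close>

lemma semiconcave_class_deviation:
  assumes dim: "DIM('a::euclidean_space) \<ge> 5"
  obtains C where "C > 0"
    "\<And>(X::'a set) \<mu> J n. \<lbrakk>X \<noteq> {}; X \<subseteq> cball 0 1; \<mu> \<in> prob_measures_on X; (2 ^ DIM('a)) ^ J \<le> real n\<rbrakk> \<Longrightarrow>
       \<exists>G. G \<in> borel_measurable (PiM {..<n} (\<lambda>_. \<mu>)) \<and> (\<forall>\<omega>. 0 \<le> G \<omega>) \<and>
         (\<forall>f\<in>semiconcave_class X (1 / 4 ^ J). \<forall>\<omega>. (\<forall>i<n. \<omega> i \<in> X) \<longrightarrow> \<bar>emp_dev n \<mu> f \<omega>\<bar> \<le> G \<omega>) \<and>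
         (\<integral>\<^sup>+\<omega>. ennreal (G \<omega>) \<partial>PiM {..<n} (\<lambda>_. \<mu>)) \<le> ennreal (C / 4 ^ J)"
proof -
  define D :: real where "D = 2 ^ DIM('a)"
  have "(2::real) ^ 5 \<le> D" unfolding D_def using dim by (intro power_increasing) auto
  then have D: "D \<ge> 32" by simp
  obtain A where A: "A > 0" and
    card: "\<And>(X::'a set) \<eta> j. \<lbrakk>X \<noteq> {}; X \<subseteq> cball 0 1; \<eta> \<le> 1 / 4 ^ j\<rbrakk> \<Longrightarrow>
     finite (level_code X \<eta> j ` semiconcave_class X \<eta>) \<and>
     real (card (level_code X \<eta> j ` semiconcave_class X \<eta>)) \<le> exp (A * D ^ j)"
    using card_level_code_semiconcave[where 'a='a] unfolding D_def by blast
  define B where "B = code_radius TYPE('a) + 1"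
  have B: "B \<ge> 0" unfolding B_def using code_radius_pos[where 'a='a] by linarith
  define C where "C = 2 * B + 4 * (2 * A + 2 + (1 + 5 * B)\<^sup>2)"
  have C: "C > 0" unfolding C_def using A B by (intro add_nonneg_pos mult_pos_pos) (auto intro: add_pos_nonneg)
  show thesis
  proof (rule that[OF C])
    fix X :: "'a set" and \<mu> J n
    assume X: "X \<noteq> {}" "X \<subseteq> cball 0 1" and \<mu>: "\<mu> \<in> prob_measures_on X"
      and n: "(2 ^ DIM('a)) ^ J \<le> real n"
    let ?F = "semiconcave_class X (1 / 4 ^ J)"
    have scale: "(1::real) / 4 ^ J \<le> 1 / 4 ^ k" if "k \<le> J" for k
      using that by (simp add: frac_le power_increasing)
    have "(\<lambda>_. 0) \<in> ?F" unfolding semiconcave_class_def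
    proof (intro CollectI conjI ballI)
      fix x0 assume x0: "x0 \<in> X"
      show "\<exists>v. norm v \<le> 2 \<and> (\<forall>x\<in>X. 0 \<le> 0 + (norm (x - v))\<^sup>2 - (norm (x0 - v))\<^sup>2 + 1 / 4 ^ J)"
        using x0 X by (intro exI[of _ x0]) auto
    qed auto
    then have ne: "?F \<noteq> {}" by blast
    have Fm: "?F \<subseteq> borel_measurable borel" unfolding semiconcave_class_def by blast
    have Fb: "\<bar>f x\<bar> \<le> 1" if "f \<in> ?F" "x \<in> X" for f x using that unfolding semiconcave_class_def by blast
    have Fc: "\<bar>f x - g x\<bar> \<le> B / 4 ^ k"
      if "k \<le> J" "f \<in> ?F" "g \<in> ?F" "level_code X (1 / 4 ^ J) k f = level_code X (1 / 4 ^ J) k g" "x \<in> X" for k f g x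
      unfolding B_def by (rule level_code_close[OF that(2,3,4) scale[OF that(1)] X(2) that(5)])
    have fin: "finite (level_code X (1 / 4 ^ J) k ` ?F)"
      and cd: "real (card (level_code X (1 / 4 ^ J) k ` ?F)) \<le> exp (A * D ^ k)" if "k \<le> J" for k
      using card[OF X scale[OF that]] by auto
    show "\<exists>G. G \<in> borel_measurable (PiM {..<n} (\<lambda>_. \<mu>)) \<and> (\<forall>\<omega>. 0 \<le> G \<omega>) \<and>
         (\<forall>f\<in>?F. \<forall>\<omega>. (\<forall>i<n. \<omega> i \<in> X) \<longrightarrow> \<bar>emp_dev n \<mu> f \<omega>\<bar> \<le> G \<omega>) \<and>
         (\<integral>\<^sup>+\<omega>. ennreal (G \<omega>) \<partial>PiM {..<n} (\<lambda>_. \<mu>)) \<le> ennreal (C / 4 ^ J)" (is ?goal)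
    proof (rule chaining[where code="level_code X (1 / 4 ^ J)" and F="?F" and X=X and J=J and B=B
            and A=A and D=D and n=n and \<mu>=\<mu>, OF \<mu> ne Fm])
      show "\<bar>f x\<bar> \<le> 1" if "f \<in> ?F" "x \<in> X" for f x by (rule Fb[OF that])
      show "\<bar>f x - g x\<bar> \<le> B / 4 ^ k"
        if "k \<le> J" "f \<in> ?F" "g \<in> ?F" "level_code X (1 / 4 ^ J) k f = level_code X (1 / 4 ^ J) k g" "x \<in> X" for k f g x
        by (rule Fc[OF that])
      show "finite (level_code X (1 / 4 ^ J) k ` ?F)" if "k \<le> J" for k by (rule fin[OF that])
      show "real (card (level_code X (1 / 4 ^ J) k ` ?F)) \<le> exp (A * D ^ k)" if "k \<le> J" for k by (rule cd[OF that])
      show "0 \<le> A" "0 \<le> B" "32 \<le> D" "D ^ J \<le> real n" using A B D n unfolding D_def by auto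
      fix G
      assume G: "G \<in> borel_measurable (PiM {..<n} (\<lambda>_. \<mu>))" "\<And>\<omega>. 0 \<le> G \<omega>"
        "\<And>f \<omega>. f \<in> ?F \<Longrightarrow> (\<And>i. i < n \<Longrightarrow> \<omega> i \<in> X) \<Longrightarrow> \<bar>emp_dev n \<mu> f \<omega>\<bar> \<le> G \<omega>"
        "(\<integral>\<^sup>+\<omega>. ennreal (G \<omega>) \<partial>PiM {..<n} (\<lambda>_. \<mu>))
           \<le> ennreal ((2 * B + 4 * (2 * A + 2 + (1 + 5 * B)\<^sup>2)) / 4 ^ J)"
      have "\<bar>emp_dev n \<mu> f \<omega>\<bar> \<le> G \<omega>" if "f \<in> ?F" "\<forall>i<n. \<omega> i \<in> X" for f \<omega>
        by (rule G(3)) (use that in auto)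
      then show ?goal using G(1,2) G(4)[folded C_def] by blast
    qed
  qed
qed

section \<open>From uniform deviations to transport costs\<close>

lemma emp_dev_divide: "emp_dev n \<mu> (\<lambda>x. f x / K) \<omega> = emp_dev n \<mu> f \<omega> / K"
  unfolding emp_dev_def by (simp add: sum_divide_distrib[symmetric] diff_divide_distrib)

lemma AE_sample_in:
  fixes n :: nat
  assumes \<mu>: "\<mu> \<in> prob_measures_on X"
  shows "AE \<omega> in PiM {..<n} (\<lambda>_. \<mu>). \<forall>i<n. \<omega> i \<in> X"
proof -
  have ps: "prob_space \<mu>" using \<mu> unfolding prob_measures_on_def by blast
  have "AE \<omega> in PiM {..<n} (\<lambda>_. \<mu>). \<forall>i\<in>{..<n}. \<omega> i \<in> X"
    by (intro AE_finite_allI finite_lessThan AE_PiM_component ps AE_prob_measures_on[OF \<mu>]) auto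
  then show ?thesis by (simp add: Ball_def)
qed

lemma AE_pair_fst_snd:
  assumes "prob_space M" "prob_space N" "AE x in M. P x" "AE y in N. Q y"
  shows "AE \<omega> in M \<Otimes>\<^sub>M N. P (fst \<omega>) \<and> Q (snd \<omega>)"
proof -
  have "AE x in distr (M \<Otimes>\<^sub>M N) M fst. P x"
    by (subst prob_space.distr_pair_fst[OF assms(2)]) (rule assms(3))
  then have 1: "AE \<omega> in M \<Otimes>\<^sub>M N. P (fst \<omega>)" by (rule AE_distrD[rotated]) simp
  interpret N: prob_space N by (rule assms(2))
  interpret M: prob_space M by (rule assms(1))
  interpret pair_prob_space M N ..
  have eq: "distr (M \<Otimes>\<^sub>M N) N snd = N"
  proof (rule measure_eqI)
    fix A assume "A \<in> sets (distr (M \<Otimes>\<^sub>M N) N snd)"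
    then have A: "A \<in> sets N" by simp
    have "snd -` A \<inter> space (M \<Otimes>\<^sub>M N) = space M \<times> A"
      using sets.sets_into_space[OF A] by (auto simp: space_pair_measure)
    then show "emeasure (distr (M \<Otimes>\<^sub>M N) N snd) A = emeasure N A"
      using A by (simp add: emeasure_distr N.emeasure_pair_measure_Times M.emeasure_space_1)
  qed simp
  have "AE y in distr (M \<Otimes>\<^sub>M N) N snd. Q y" by (subst eq) (rule assms(4))
  then have 2: "AE \<omega> in M \<Otimes>\<^sub>M N. Q (snd \<omega>)" by (rule AE_distrD[rotated]) simp
  from 1 2 show ?thesis by eventually_elim simp
qed

text \<open>For the upper bound on the empirical cost, the dual pair of the sample is tested against
  \<open>\<mu>\<close> and \<open>\<nu>\<close>. For the lower bound, the dual pair of a fresh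
  sample is moved to the population and from there to the empirical measures at hand, at the price
  of one deviation per sample; the averaged coupling turns the expected assignment cost into a bound
  on the population cost.\<close>

lemma (in bounded_cost) expected_ot_dev_le:
  assumes \<mu>: "\<mu> \<in> prob_measures_on X" and \<nu>: "\<nu> \<in> prob_measures_on Y" and n: "n > 0"
    and G: "G \<in> borel_measurable (PiM {..<n} (\<lambda>_. \<mu>))" "\<And>x. 0 \<le> G x"
      "(\<integral>\<^sup>+x. ennreal (G x) \<partial>PiM {..<n} (\<lambda>_. \<mu>)) \<le> ennreal e"
    and H: "H \<in> borel_measurable (PiM {..<n} (\<lambda>_. \<nu>))" "\<And>y. 0 \<le> H y"
      "(\<integral>\<^sup>+y. ennreal (H y) \<partial>PiM {..<n} (\<lambda>_. \<nu>)) \<le> ennreal e"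
    and e: "e \<ge> 0"
    and devX: "\<And>\<phi> \<psi> x. semidual_pair c X Y \<phi> \<psi> \<Longrightarrow> (\<And>i. i < n \<Longrightarrow> x i \<in> X) \<Longrightarrow> \<bar>emp_dev n \<mu> \<phi> x\<bar> \<le> G x"
    and devY: "\<And>\<phi> \<psi> y. semidual_pair c X Y \<phi> \<psi> \<Longrightarrow> (\<And>i. i < n \<Longrightarrow> y i \<in> Y) \<Longrightarrow> \<bar>emp_dev n \<nu> \<psi> y\<bar> \<le> H y"
  shows "expected_ot_dev c \<mu> \<nu> n \<le> ennreal (4 * e)"
proof -
  let ?Q = "PiM {..<n} (\<lambda>_. \<mu>)" and ?R = "PiM {..<n} (\<lambda>_. \<nu>)"
  have ps: "prob_space \<mu>" "sets \<mu> = sets borel" "prob_space \<nu>" "sets \<nu> = sets borel"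
    using \<mu> \<nu> unfolding prob_measures_on_def by auto
  interpret Q: prob_space ?Q by (intro prob_space_PiM ps)
  interpret R: prob_space ?R by (intro prob_space_PiM ps)
  interpret QR: pair_prob_space ?Q ?R ..
  define S where "S \<omega> = G (fst \<omega>) + H (snd \<omega>)" for \<omega>
  have S0: "0 \<le> S \<omega>" for \<omega> unfolding S_def using G(2) H(2) by (intro add_nonneg_nonneg)
  note Gm = measurable_compose[OF measurable_fst G(1), of ?R] and Hm = measurable_compose[OF measurable_snd H(1), of ?Q]
  have Sm: "S \<in> borel_measurable (?Q \<Otimes>\<^sub>M ?R)" unfolding S_def using Gm Hm by simp
  have intS: "(\<integral>\<^sup>+\<omega>. ennreal (S \<omega>) \<partial>(?Q \<Otimes>\<^sub>M ?R)) \<le> ennreal (2 * e)"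
  proof -
    have "(\<integral>\<^sup>+\<omega>. ennreal (S \<omega>) \<partial>(?Q \<Otimes>\<^sub>M ?R))
        = (\<integral>\<^sup>+\<omega>. ennreal (G (fst \<omega>)) \<partial>(?Q \<Otimes>\<^sub>M ?R)) + (\<integral>\<^sup>+\<omega>. ennreal (H (snd \<omega>)) \<partial>(?Q \<Otimes>\<^sub>M ?R))"
      unfolding S_def using G(2) H(2) Gm Hm by (simp add: nn_integral_add)
    also have "(\<integral>\<^sup>+\<omega>. ennreal (G (fst \<omega>)) \<partial>(?Q \<Otimes>\<^sub>M ?R)) = (\<integral>\<^sup>+x. ennreal (G x) \<partial>?Q)"
      using Gm by (subst R.nn_integral_fst[symmetric]) (auto simp: R.emeasure_space_1)
    also have "(\<integral>\<^sup>+\<omega>. ennreal (H (snd \<omega>)) \<partial>(?Q \<Otimes>\<^sub>M ?R)) = (\<integral>\<^sup>+y. ennreal (H y) \<partial>?R)"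
      using Hm by (subst R.nn_integral_fst[symmetric]) (auto simp: Q.emeasure_space_1)
    also have "(\<integral>\<^sup>+x. ennreal (G x) \<partial>?Q) + (\<integral>\<^sup>+y. ennreal (H y) \<partial>?R) \<le> ennreal e + ennreal e"
      by (intro add_mono G(3) H(3))
    also have "\<dots> = ennreal (2 * e)" using e by (simp add: ennreal_plus[symmetric] del: ennreal_plus)
    finally show ?thesis .
  qed
  define good where "good \<omega> \<longleftrightarrow> (\<forall>i<n. fst \<omega> i \<in> X) \<and> (\<forall>i<n. snd \<omega> i \<in> Y)"
    for \<omega> :: "(nat \<Rightarrow> 'a) \<times> (nat \<Rightarrow> 'a)"
  have ae: "AE \<omega> in ?Q \<Otimes>\<^sub>M ?R. good \<omega>"
    unfolding good_def
    by (intro AE_pair_fst_snd AE_sample_in \<mu> \<nu> Q.prob_space_axioms R.prob_space_axioms)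
  obtain \<pi> where \<pi>: "\<pi> \<in> couplings \<mu> \<nu>" and \<pi>_cost: "(\<integral>\<^sup>+z. ennreal (c (fst z) (snd z)) \<partial>\<pi>) =
       (\<integral>\<^sup>+\<omega>. ennreal (assignment_cost c n (fst \<omega>) (snd \<omega>)) \<partial>(?Q \<Otimes>\<^sub>M ?R))"
    by (rule averaged_optimal_coupling[OF ps n])
  define T where "T \<omega> = ot_cost c (empirical (fst \<omega>) n) (empirical (snd \<omega>) n)" for \<omega>
  have dual: "\<exists>\<phi> \<psi>. semidual_pair c X Y \<phi> \<psi> \<and>
      assignment_cost c n (fst \<omega>) (snd \<omega>) \<le> (\<integral>x. \<phi> x \<partial>\<mu>) + (\<integral>y. \<psi> y \<partial>\<nu>) + S \<omega>" if g: "good \<omega>" for \<omega>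
  proof -
    obtain \<phi> \<psi> where sd: "semidual_pair c X Y \<phi> \<psi>" and le: "assignment_cost c n (fst \<omega>) (snd \<omega>)
        \<le> (\<Sum>i<n. \<phi> (fst \<omega> i)) / n + (\<Sum>i<n. \<psi> (snd \<omega> i)) / n"
      using semidual_pair_exists[OF contx conty c0 c1 n, of X Y "fst \<omega>" "snd \<omega>"] g
      unfolding good_def by blast
    have "\<bar>emp_dev n \<mu> \<phi> (fst \<omega>)\<bar> \<le> G (fst \<omega>)" "\<bar>emp_dev n \<nu> \<psi> (snd \<omega>)\<bar> \<le> H (snd \<omega>)"
      using devX[OF sd] devY[OF sd] g unfolding good_def by auto
    then have "assignment_cost c n (fst \<omega>) (snd \<omega>) \<le> (\<integral>x. \<phi> x \<partial>\<mu>) + (\<integral>y. \<psi> y \<partial>\<nu>) + S \<omega>"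
      using le unfolding emp_dev_def S_def by linarith
    then show ?thesis using sd by blast
  qed
  have dual_le_T: "(\<integral>x. \<phi> x \<partial>\<mu>) + (\<integral>y. \<psi> y \<partial>\<nu>) \<le> T \<omega> + S \<omega>"
    if sd: "semidual_pair c X Y \<phi> \<psi>" and g: "good \<omega>" for \<phi> \<psi> \<omega>
  proof -
    have m: "\<phi> \<in> borel_measurable borel" "\<psi> \<in> borel_measurable borel"
      using sd unfolding semidual_pair_def by auto
    have "couplings (empirical (fst \<omega>) n) (empirical (snd \<omega>) n) \<noteq> {}"
      using permutation_coupling(1)[OF n permutes_id] by blast
    then have "(\<integral>x. \<phi> x \<partial>empirical (fst \<omega>) n) + (\<integral>y. \<psi> y \<partial>empirical (snd \<omega>) n) \<le> T \<omega>"
      unfolding T_def using g unfolding good_def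
      by (intro ot_cost_ge[OF _ _ _ sd] empirical_prob_measures_on n Xm Ym) auto
    then have "(\<Sum>i<n. \<phi> (fst \<omega> i)) / n + (\<Sum>i<n. \<psi> (snd \<omega> i)) / n \<le> T \<omega>"
      by (simp only: integral_empirical[OF m(1)] integral_empirical[OF m(2)])
    moreover have "\<bar>emp_dev n \<mu> \<phi> (fst \<omega>)\<bar> \<le> G (fst \<omega>)" "\<bar>emp_dev n \<nu> \<psi> (snd \<omega>)\<bar> \<le> H (snd \<omega>)"
      using devX[OF sd] devY[OF sd] g unfolding good_def by auto
    ultimately show ?thesis unfolding emp_dev_def S_def by linarith
  qed
  have T0: "0 \<le> T \<omega>" for \<omega> unfolding T_def ot_cost_def by simp
  have upper: "T \<omega> \<le> ot_cost c \<mu> \<nu> + S \<omega>" if g: "good \<omega>" for \<omega>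
  proof -
    obtain \<phi> \<psi> where sd: "semidual_pair c X Y \<phi> \<psi>" and
      le: "assignment_cost c n (fst \<omega>) (snd \<omega>) \<le> (\<integral>x. \<phi> x \<partial>\<mu>) + (\<integral>y. \<psi> y \<partial>\<nu>) + S \<omega>"
      using dual[OF g] by blast
    have "T \<omega> \<le> assignment_cost c n (fst \<omega>) (snd \<omega>)" unfolding T_def by (rule ot_cost_empirical_le[OF n])
    moreover have "(\<integral>x. \<phi> x \<partial>\<mu>) + (\<integral>y. \<psi> y \<partial>\<nu>) \<le> ot_cost c \<mu> \<nu>"
      using \<pi> by (intro ot_cost_ge[OF _ \<mu> \<nu> sd]) auto
    ultimately show ?thesis using le by linarith
  qed
  \<comment> \<open>\<open>\<omega>\<close> stays fixed while the fresh sample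
    \<open>\<omega>'\<close> is integrated. The dual pair belongs to \<open>\<omega>'\<close>, but
    the bound \<open>T \<omega> + S \<omega>\<close> on its value does not depend on it and leaves
    the integral.\<close>
  have lower: "ot_cost c \<mu> \<nu> \<le> T \<omega> + S \<omega> + 2 * e" if g: "good \<omega>" for \<omega>
  proof (rule ot_cost_le[OF \<pi>])
    have "(\<integral>\<^sup>+z. ennreal (c (fst z) (snd z)) \<partial>\<pi>)
        \<le> (\<integral>\<^sup>+\<omega>'. ennreal (T \<omega> + S \<omega>) + ennreal (S \<omega>') \<partial>(?Q \<Otimes>\<^sub>M ?R))"
      unfolding \<pi>_cost
    proof (rule nn_integral_mono_AE)
      show "AE \<omega>' in ?Q \<Otimes>\<^sub>M ?R. ennreal (assignment_cost c n (fst \<omega>') (snd \<omega>'))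
          \<le> ennreal (T \<omega> + S \<omega>) + ennreal (S \<omega>')"
        using ae
      proof eventually_elim
        case (elim \<omega>')
        obtain \<phi> \<psi> where sd: "semidual_pair c X Y \<phi> \<psi>" and
          le: "assignment_cost c n (fst \<omega>') (snd \<omega>') \<le> (\<integral>x. \<phi> x \<partial>\<mu>) + (\<integral>y. \<psi> y \<partial>\<nu>) + S \<omega>'"
          using dual[OF elim] by blast
        have "assignment_cost c n (fst \<omega>') (snd \<omega>') \<le> T \<omega> + S \<omega> + S \<omega>'"
          using le dual_le_T[OF sd g] by linarith
        then have "ennreal (assignment_cost c n (fst \<omega>') (snd \<omega>')) \<le> ennreal (T \<omega> + S \<omega> + S \<omega>')"
          by (rule ennreal_leI)
        also have "\<dots> = ennreal (T \<omega> + S \<omega>) + ennreal (S \<omega>')"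
          using T0[of \<omega>] S0[of \<omega>] S0[of \<omega>'] by (intro ennreal_plus) auto
        finally show ?case .
      qed
    qed
    also have "\<dots> = ennreal (T \<omega> + S \<omega>) + (\<integral>\<^sup>+\<omega>'. ennreal (S \<omega>') \<partial>(?Q \<Otimes>\<^sub>M ?R))"
      using Sm by (subst nn_integral_add) (auto simp: QR.emeasure_space_1)
    also have "\<dots> \<le> ennreal (T \<omega> + S \<omega>) + ennreal (2 * e)" by (intro add_left_mono intS)
    also have "\<dots> = ennreal (T \<omega> + S \<omega> + 2 * e)"
      using T0[of \<omega>] S0[of \<omega>] e by (intro ennreal_plus[symmetric]) auto
    finally show "(\<integral>\<^sup>+z. ennreal (c (fst z) (snd z)) \<partial>\<pi>) \<le> ennreal (T \<omega> + S \<omega> + 2 * e)" .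
    show "0 \<le> T \<omega> + S \<omega> + 2 * e" using T0[of \<omega>] S0[of \<omega>] e by simp
  qed
  \<comment> \<open>The absolute deviation is dominated by a measurable function before integrating.
    \<open>2 * e\<close> comes from the fresh sample and another \<open>2 * e\<close> from the
    integral of \<open>S\<close>.\<close>
  have "expected_ot_dev c \<mu> \<nu> n \<le> (\<integral>\<^sup>+\<omega>. ennreal (2 * e) + ennreal (S \<omega>) \<partial>(?Q \<Otimes>\<^sub>M ?R))"
    unfolding expected_ot_dev_def T_def[symmetric]
  proof (rule nn_integral_mono_AE)
    show "AE \<omega> in ?Q \<Otimes>\<^sub>M ?R. ennreal \<bar>T \<omega> - ot_cost c \<mu> \<nu>\<bar> \<le> ennreal (2 * e) + ennreal (S \<omega>)"
      using ae
    proof eventually_elim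
      case (elim \<omega>)
      have "\<bar>T \<omega> - ot_cost c \<mu> \<nu>\<bar> \<le> 2 * e + S \<omega>"
        using upper[OF elim] lower[OF elim] e by linarith
      then have "ennreal \<bar>T \<omega> - ot_cost c \<mu> \<nu>\<bar> \<le> ennreal (2 * e + S \<omega>)" by (rule ennreal_leI)
      also have "\<dots> = ennreal (2 * e) + ennreal (S \<omega>)" using e S0 by (intro ennreal_plus) auto
      finally show ?case .
    qed
  qed
  also have "\<dots> = ennreal (2 * e) + (\<integral>\<^sup>+\<omega>. ennreal (S \<omega>) \<partial>(?Q \<Otimes>\<^sub>M ?R))"
    using Sm by (subst nn_integral_add) (auto simp: QR.emeasure_space_1)
  also have "\<dots> \<le> ennreal (2 * e) + ennreal (2 * e)" by (intro add_left_mono intS)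
  also have "\<dots> = ennreal (4 * e)" using e by (simp add: ennreal_plus[symmetric] del: ennreal_plus)
  finally show ?thesis .
qed

theorem mainTheorem1:
  fixes X Y Z1 :: "'a::euclidean_space set" and \<alpha> :: real
  assumes dim: "DIM('a) \<ge> 5"
    and S1: "convex X" "compact X" "interior X \<noteq> {}"
            "convex Y" "compact Y" "interior Y \<noteq> {}"
            "X \<subseteq> cball 0 1" "Y \<subseteq> cball 0 1"
            "{x - y | x y. x \<in> X \<and> y \<in> Y} \<subseteq> cball 0 1"
    and H1_params: "0 < \<alpha>" "\<alpha> \<le> 2" "convex Z1" "open Z1"
            "{x - y | x y. x \<in> X \<and> y \<in> Y} \<subseteq> Z1" "Z1 \<subseteq> cball 0 2"
  shows "\<exists>C>0. \<forall>h :: 'a \<Rightarrow> real.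
           ((\<forall>z. 0 \<le> h z) \<and> convex_on UNIV h \<and> (\<forall>z. h (- z) = h z) \<and> lsc h \<and>
            holder_space \<alpha> Z1 h \<and> (\<forall>z\<in>Z1. 0 \<le> h z \<and> h z \<le> 1)) \<longrightarrow>
           (\<forall>n::nat. n \<ge> 1 \<longrightarrow>
              (\<forall>\<mu> \<in> prob_measures_on X. \<forall>\<nu> \<in> prob_measures_on Y.
                 expected_ot_dev (\<lambda>x y. h (x - y)) \<mu> \<nu> n
                   \<le> ennreal (C * max 1 (holder_norm \<alpha> Z1 h) * real n powr (- \<alpha> / real DIM('a)))))"
proof -
  obtain C0 where C0: "C0 > 0" and dev:
    "\<And>(X::'a set) \<mu> J n. \<lbrakk>X \<noteq> {}; X \<subseteq> cball 0 1; \<mu> \<in> prob_measures_on X; (2 ^ DIM('a)) ^ J \<le> real n\<rbrakk> \<Longrightarrow>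
       \<exists>G. G \<in> borel_measurable (PiM {..<n} (\<lambda>_. \<mu>)) \<and> (\<forall>\<omega>. 0 \<le> G \<omega>) \<and>
         (\<forall>f\<in>semiconcave_class X (1 / 4 ^ J). \<forall>\<omega>. (\<forall>i<n. \<omega> i \<in> X) \<longrightarrow> \<bar>emp_dev n \<mu> f \<omega>\<bar> \<le> G \<omega>) \<and>
         (\<integral>\<^sup>+\<omega>. ennreal (G \<omega>) \<partial>PiM {..<n} (\<lambda>_. \<mu>)) \<le> ennreal (C0 / 4 ^ J)"
    using semiconcave_class_deviation[OF dim] by metis
  have Xne: "X \<noteq> {}" and Yne: "Y \<noteq> {}" using S1(3,6) by auto
  have XY: "x - y \<in> Z1" if "x \<in> X" "y \<in> Y" for x y using H1_params(5) that by blast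
  have Zne: "Z1 \<noteq> {}" using XY Xne Yne by blast
  have Xm: "X \<in> sets borel" and Ym: "Y \<in> sets borel"
    using S1(2,5) by (auto intro: borel_compact)
  define d where "d = real DIM('a)"
  have d: "d \<ge> 1" unfolding d_def using dim by simp
  \<comment> \<open>32 is 4 from \<open>expected_ot_dev_le\<close>, times 2 from \<open>K\<close>,
    times a bound 4 for \<open>2 powr \<alpha>\<close> from rounding \<open>n\<close> to a power of
    \<open>2 ^ d\<close>. The factor \<open>d\<close> comes from \<open>L\<close>. All of this is
    fixed before \<open>h\<close> is.\<close>
  define C where "C = 32 * C0 * d"
  have C: "C > 0" unfolding C_def using C0 d by simp
  show ?thesis
  proof (intro exI[of _ C] conjI C allI impI ballI, elim conjE)
    fix h :: "'a \<Rightarrow> real" and n :: nat and \<mu> \<nu> :: "'a measure"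
    assume n: "n \<ge> 1" and \<mu>: "\<mu> \<in> prob_measures_on X" and \<nu>: "\<nu> \<in> prob_measures_on Y"
      and h0: "\<forall>z. 0 \<le> h z" and conv: "convex_on UNIV h" and hol: "holder_space \<alpha> Z1 h"
      and h1: "\<forall>z\<in>Z1. 0 \<le> h z \<and> h z \<le> 1"
    define L where "L = d * max 1 (holder_norm \<alpha> Z1 h)"
    have "d * 1 \<le> L" unfolding L_def using d by (intro mult_left_mono) auto
    then have L: "L \<ge> 1" using d by linarith
    obtain p where p: "\<And>z. z \<in> Z1 \<Longrightarrow> norm (p z) \<le> L"
      and tan: "\<And>z0 z. z0 \<in> Z1 \<Longrightarrow> z \<in> Z1 \<Longrightarrow>
        h z \<le> h z0 + p z0 \<bullet> (z - z0) + L * norm (z - z0) powr \<alpha>"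
      using holder_space_tangent[OF hol H1_params(4,3) Zne H1_params(1,2)] unfolding L_def d_def by blast
    define c where "c x y = h (x - y)" for x y
    \<comment> \<open>Convexity on the whole space makes \<open>h\<close> continuous also away from
      \<open>Z1\<close>, which gives the cost its global measurability.\<close>
    have hcont: "continuous_on UNIV h" by (rule convex_on_continuous[OF open_UNIV conv])
    interpret bounded_cost c X Y
    proof
      show "continuous_on UNIV (\<lambda>z. c (fst z) (snd z))" unfolding c_def
        by (rule continuous_on_compose2[OF hcont]) (auto intro!: continuous_intros)
      show "0 \<le> c x y" for x y unfolding c_def using h0 by simp
      show "c x y \<le> 1" if "x \<in> X" "y \<in> Y" for x y unfolding c_def using h1 XY[OF that] by blast
    qed (rule Xm Ym)+
    \<comment> \<open>\<open>J\<close> is the finest level that the sample size supports; its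
      maximality gives \<open>\<delta> \<le> 2 * n powr (- 1 / d)\<close>.\<close>
    have "2 ^ DIM('a) \<ge> (2::nat)" using dim by (simp add: self_le_power)
    then obtain J where J: "(2 ^ DIM('a)) ^ J \<le> n" "n < (2 ^ DIM('a)) ^ (J + 1)"
      using ex_power_ivl1[of "2 ^ DIM('a)" n] n by blast
    have Jr: "(2 ^ DIM('a)) ^ J \<le> real n"
      using of_nat_mono[OF J(1), where 'a=real] by simp
    define \<delta> :: real where "\<delta> = 1 / 2 ^ J"
    have \<delta>: "0 < \<delta>" "\<delta> \<le> 1" unfolding \<delta>_def by auto
    have \<delta>2: "\<delta>\<^sup>2 = 1 / 4 ^ J" unfolding \<delta>_def power_divide
      by (simp add: power2_eq_square flip: power_mult_distrib)
    define K where "K = 2 * L * \<delta> powr (\<alpha> - 2)"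
    have K: "K > 0" unfolding K_def using L \<delta> by simp
    obtain G where G: "G \<in> borel_measurable (PiM {..<n} (\<lambda>_. \<mu>))" "\<And>\<omega>. 0 \<le> G \<omega>"
      and Gdev: "\<And>f \<omega>. f \<in> semiconcave_class X (\<delta>\<^sup>2) \<Longrightarrow> (\<forall>i<n. \<omega> i \<in> X) \<Longrightarrow> \<bar>emp_dev n \<mu> f \<omega>\<bar> \<le> G \<omega>"
      and Gint: "(\<integral>\<^sup>+\<omega>. ennreal (G \<omega>) \<partial>PiM {..<n} (\<lambda>_. \<mu>)) \<le> ennreal (C0 * \<delta>\<^sup>2)"
      using dev[OF Xne S1(7) \<mu> Jr] unfolding \<delta>2 by auto
    obtain H where H: "H \<in> borel_measurable (PiM {..<n} (\<lambda>_. \<nu>))" "\<And>\<omega>. 0 \<le> H \<omega>"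
      and Hdev: "\<And>f \<omega>. f \<in> semiconcave_class Y (\<delta>\<^sup>2) \<Longrightarrow> (\<forall>i<n. \<omega> i \<in> Y) \<Longrightarrow> \<bar>emp_dev n \<nu> f \<omega>\<bar> \<le> H \<omega>"
      and Hint: "(\<integral>\<^sup>+\<omega>. ennreal (H \<omega>) \<partial>PiM {..<n} (\<lambda>_. \<nu>)) \<le> ennreal (C0 * \<delta>\<^sup>2)"
      using dev[OF Yne S1(8) \<nu> Jr] unfolding \<delta>2 by auto
    have classX: "(\<lambda>x. \<phi> x / K) \<in> semiconcave_class X (\<delta>\<^sup>2)" if sd: "semidual_pair c X Y \<phi> \<psi>" for \<phi> \<psi>
      unfolding K_def
    proof (rule scaled_semiconcave[OF _ _ S1(7) _ L \<delta> H1_params(1,2)])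
      show "\<phi> \<in> borel_measurable borel" "\<And>x. x \<in> X \<Longrightarrow> \<bar>\<phi> x\<bar> \<le> 1"
        using sd unfolding semidual_pair_def by auto
      fix x0 and \<epsilon> :: real assume x0: "x0 \<in> X" and "\<epsilon> > 0"
      then obtain y where y: "y \<in> Y" and le: "\<And>x. x \<in> X \<Longrightarrow> \<phi> x - \<phi> x0 \<le> c x y - c x0 y + \<epsilon>"
        using sd unfolding semidual_pair_def by blast
      show "\<exists>p. norm p \<le> L \<and> (\<forall>x\<in>X. \<phi> x \<le> \<phi> x0 + p \<bullet> (x - x0) + L * norm (x - x0) powr \<alpha> + \<epsilon>)"
      \<comment> \<open>At \<open>x0\<close> the potential inherits the tangent of \<open>h\<close>
        at \<open>x0 - y\<close>, where \<open>y\<close> is the point that nearly realises the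
        contact.\<close>
      proof (intro exI[of _ "p (x0 - y)"] conjI ballI p XY x0 y)
        fix x assume x: "x \<in> X"
        have "x - y - (x0 - y) = x - x0" by simp
        then show "\<phi> x \<le> \<phi> x0 + p (x0 - y) \<bullet> (x - x0) + L * norm (x - x0) powr \<alpha> + \<epsilon>"
          using le[OF x] tan[OF XY[OF x0 y] XY[OF x y]] unfolding c_def by simp
      qed
    qed
    have classY: "(\<lambda>y. \<psi> y / K) \<in> semiconcave_class Y (\<delta>\<^sup>2)" if sd: "semidual_pair c X Y \<phi> \<psi>" for \<phi> \<psi>
      unfolding K_def
    proof (rule scaled_semiconcave[OF _ _ S1(8) _ L \<delta> H1_params(1,2)])
      show "\<psi> \<in> borel_measurable borel" "\<And>y. y \<in> Y \<Longrightarrow> \<bar>\<psi> y\<bar> \<le> 1"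
        using sd unfolding semidual_pair_def by auto
      fix y0 and \<epsilon> :: real assume y0: "y0 \<in> Y" and "\<epsilon> > 0"
      then obtain x where x: "x \<in> X" and le: "\<And>y. y \<in> Y \<Longrightarrow> \<psi> y - \<psi> y0 \<le> c x y - c x y0 + \<epsilon>"
        using sd unfolding semidual_pair_def by blast
      show "\<exists>p. norm p \<le> L \<and> (\<forall>y\<in>Y. \<psi> y \<le> \<psi> y0 + p \<bullet> (y - y0) + L * norm (y - y0) powr \<alpha> + \<epsilon>)"
      \<comment> \<open>The second variable enters \<open>h (x - y)\<close> with a minus sign, which
        reverses the tangent.\<close>
      proof (intro exI[of _ "- p (x - y0)"] conjI ballI)
        show "norm (- p (x - y0)) \<le> L" using p[OF XY[OF x y0]] by simp
        fix y assume y: "y \<in> Y"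
        have "x - y - (x - y0) = - (y - y0)" by simp
        then have "c x y \<le> c x y0 + (- p (x - y0)) \<bullet> (y - y0) + L * norm (y - y0) powr \<alpha>"
          using tan[OF XY[OF x y0] XY[OF x y]] unfolding c_def
          by (simp only: norm_minus_cancel inner_minus_right inner_minus_left)
        then show "\<psi> y \<le> \<psi> y0 + (- p (x - y0)) \<bullet> (y - y0) + L * norm (y - y0) powr \<alpha> + \<epsilon>"
          using le[OF y] by linarith
      qed
    qed
    have scaled_int: "(\<integral>\<^sup>+\<omega>. ennreal (K * F \<omega>) \<partial>M) \<le> ennreal (K * (C0 * \<delta>\<^sup>2))"
      if "F \<in> borel_measurable M" "\<And>\<omega>. 0 \<le> F \<omega>" "(\<integral>\<^sup>+\<omega>. ennreal (F \<omega>) \<partial>M) \<le> ennreal (C0 * \<delta>\<^sup>2)"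
      for F :: "(nat \<Rightarrow> 'a) \<Rightarrow> real" and M
    proof -
      have "(\<integral>\<^sup>+\<omega>. ennreal (K * F \<omega>) \<partial>M) = ennreal K * (\<integral>\<^sup>+\<omega>. ennreal (F \<omega>) \<partial>M)"
        using that(1,2) K by (simp add: ennreal_mult nn_integral_cmult)
      also have "\<dots> \<le> ennreal K * ennreal (C0 * \<delta>\<^sup>2)" by (intro mult_left_mono that(3)) simp
      also have "\<dots> = ennreal (K * (C0 * \<delta>\<^sup>2))" using K C0 by (simp add: ennreal_mult)
      finally show ?thesis .
    qed
    have "expected_ot_dev c \<mu> \<nu> n \<le> ennreal (4 * (K * (C0 * \<delta>\<^sup>2)))"
    proof (rule expected_ot_dev_le[OF \<mu> \<nu>, where G="\<lambda>\<omega>. K * G \<omega>" and H="\<lambda>\<omega>. K * H \<omega>"])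
      show "n > 0" using n by simp
      show "(\<lambda>\<omega>. K * G \<omega>) \<in> borel_measurable (PiM {..<n} (\<lambda>_. \<mu>))" using G(1) by simp
      show "(\<lambda>\<omega>. K * H \<omega>) \<in> borel_measurable (PiM {..<n} (\<lambda>_. \<nu>))" using H(1) by simp
      show "0 \<le> K * G \<omega>" "0 \<le> K * H \<omega>" for \<omega> using K G(2) H(2) by simp_all
      show "(\<integral>\<^sup>+\<omega>. ennreal (K * G \<omega>) \<partial>PiM {..<n} (\<lambda>_. \<mu>)) \<le> ennreal (K * (C0 * \<delta>\<^sup>2))"
        by (rule scaled_int[OF G Gint])
      show "(\<integral>\<^sup>+\<omega>. ennreal (K * H \<omega>) \<partial>PiM {..<n} (\<lambda>_. \<nu>)) \<le> ennreal (K * (C0 * \<delta>\<^sup>2))"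
        by (rule scaled_int[OF H Hint])
      show "0 \<le> K * (C0 * \<delta>\<^sup>2)" using K C0 by simp
      show "\<bar>emp_dev n \<mu> \<phi> x\<bar> \<le> K * G x"
        if "semidual_pair c X Y \<phi> \<psi>" "\<And>i. i < n \<Longrightarrow> x i \<in> X" for \<phi> \<psi> x
        using Gdev[OF classX[OF that(1)], of x] that(2) K
        by (simp add: emp_dev_divide abs_divide pos_divide_le_eq mult.commute)
      show "\<bar>emp_dev n \<nu> \<psi> y\<bar> \<le> K * H y"
        if "semidual_pair c X Y \<phi> \<psi>" "\<And>i. i < n \<Longrightarrow> y i \<in> Y" for \<phi> \<psi> y
        using Hdev[OF classY[OF that(1)], of y] that(2) K
        by (simp add: emp_dev_divide abs_divide pos_divide_le_eq mult.commute)
    qed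
    also have "4 * (K * (C0 * \<delta>\<^sup>2)) \<le> C * max 1 (holder_norm \<alpha> Z1 h) * real n powr (- \<alpha> / real DIM('a))"
    proof -
      have "\<delta> powr (\<alpha> - 2) * \<delta>\<^sup>2 = \<delta> powr \<alpha>" using \<delta> by (simp add: powr_diff powr_numeral)
      then have eq: "4 * (K * (C0 * \<delta>\<^sup>2)) = 8 * C0 * L * \<delta> powr \<alpha>"
        unfolding K_def by (metis (no_types) mult.assoc mult.commute mult.left_commute numeral_times_numeral semiring_norm(12,13) mult_numeral_left_semiring_numeral)
      have "\<delta> \<le> 2 * real n powr (- 1 / d)"
      proof -
        have "real n \<le> 2 ^ (DIM('a) * (J + 1))"
          using of_nat_mono[OF less_imp_le[OF J(2)], where 'a=real] by (simp only: of_nat_power of_nat_numeral power_mult)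
        also have "\<dots> = (2 ^ (J + 1)) powr d"
          unfolding d_def by (simp add: powr_realpow power_mult[symmetric] power_add mult.commute)
        finally have "real n powr (1 / d) \<le> ((2 ^ (J + 1)) powr d) powr (1 / d)"
          using d by (intro powr_mono2) auto
        also have "\<dots> = 2 ^ (J + 1)" using d by (simp add: powr_powr)
        finally have "real n powr (1 / d) \<le> 2 * 2 ^ J" by simp
        moreover have "1 / P \<le> 2 * (1 / q)" if "q \<le> 2 * P" "q > 0" "P > 0" for P q :: real
          using that by (simp add: field_simps)
        moreover have "real n powr (- 1 / d) = 1 / real n powr (1 / d)" by (simp add: powr_minus_divide)
        moreover have "real n powr (1 / d) > 0" using n by simp
        ultimately show ?thesis unfolding \<delta>_def by simp
      qed
      then have "\<delta> powr \<alpha> \<le> (2 * real n powr (- 1 / d)) powr \<alpha>"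
        using \<delta> H1_params by (intro powr_mono2) auto
      also have "\<dots> = 2 powr \<alpha> * real n powr (- \<alpha> / d)"
        by (simp add: powr_mult powr_powr)
      also have "\<dots> \<le> 4 * real n powr (- \<alpha> / d)"
      proof (rule mult_right_mono)
        have "(2::real) powr \<alpha> \<le> 2 powr 2" using H1_params by (intro powr_mono) auto
        then show "(2::real) powr \<alpha> \<le> 4" by (simp add: powr_numeral)
      qed simp
      finally have "8 * C0 * L * \<delta> powr \<alpha> \<le> 8 * C0 * L * (4 * real n powr (- \<alpha> / d))"
        using C0 L by (intro mult_left_mono) auto
      also have "\<dots> = C * max 1 (holder_norm \<alpha> Z1 h) * real n powr (- \<alpha> / real DIM('a))"
        unfolding C_def L_def d_def by simp
      finally show ?thesis unfolding eq .
    qed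
    finally show "expected_ot_dev (\<lambda>x y. h (x - y)) \<mu> \<nu> n
        \<le> ennreal (C * max 1 (holder_norm \<alpha> Z1 h) * real n powr (- \<alpha> / real DIM('a)))"
      unfolding c_def by (simp add: ennreal_leI)
  qed
qed

end
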